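(* Let $C,\gamma,\sigma\in\mathbb{R}$, let $M$ be a compact oriented spin $7$-manifold, and let $(\varphi,\phi)$ be a $G_2$-structure and a smooth function on $M$ with $d(e^{-4\phi}\psi)=0$ which is a fixed point of the generic heterotic $G_2$ flow, that is, $(\varphi,\phi)$ solves \begin{align*} -dH_\varphi+\frac74C\,d(\tau_0\varphi)&=0,\\ \Delta\phi-\gamma|d\phi|^2+\frac14|\tau_3|^2-\sigma\tau_0^2&=0. \end{align*} Assuming that $$\gamma<-1,\qquad \sigma<\frac{7(21C-2)}{144},$$ it follows that $\varphi$ is torsion-free and $\phi$ is constant.
   Context: A $G_2$-structure on $M$ is a $3$-form $\varphi$ which at each point is identified, by a linear isomorphism $T_xM\to\mathbb{R}^7$, with $\varphi_0=e^{127}+e^{347}+e^{567}+e^{135}-e^{146}-e^{236}-e^{245}$. It determines a Riemannian metric $g=g_\varphi$ and volume form by $(X\lrcorner\varphi)\wedge(Y\lrcorner\varphi)\wedge\varphi=6g(X,Y)\mathrm{Vol}_\varphi$, hence a Hodge star $\star$, and one sets $\psi=\star\varphi$. The torsion forms $\tau_k\in\Omega^k(M)$, $k=0,1,2,3$, are the unique forms with $\tau_2\wedge\psi=0$, $\tau_3\wedge\varphi=0$, $\tau_3\wedge\psi=0$ and $$d\varphi=\tau_0\psi+3\tau_1\wedge\varphi+\star\tau_3,\qquad d\psi=4\tau_1\wedge\psi+\tau_2\wedge\varphi.$$ The structure is torsion-free if all $\tau_k$ vanish. Define $H_\varphi=\frac16\tau_0\varphi-\tau_1\lrcorner\psi-\tau_3$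 (contraction via the metric). The generic heterotic $G_2$ flow is $$\frac{\partial}{\partial t}(e^{-4\phi}\psi)=-dH_\varphi+\frac74C\,d(\tau_0\varphi),\qquad \frac{\partial}{\partial t}\phi=e^{4\phi}\left(\Delta\phi-\gamma|d\phi|^2+\frac14|\tau_3|^2-\sigma\tau_0^2\right).$$ The norm of a $k$-form is $|\gamma|^2=\frac1{k!}\gamma_{i_1\dots i_k}\gamma_{i_1\dots i_k}$, and $\Delta=-d^\star d$ on functions.
   Formalization: M is additionally assumed connected; otherwise the claim that φ (the function) is constant fails, e.g. on two disjoint flat 7-tori with different constant values of the function on each. *)

theory Defs
  imports "HOL-Analysis.Analysis"
begin

section \<open>Smooth 7-manifolds\<close>

text \<open>On an open set, \<open>C\<^sup>k\<close> means that all iterated directional derivatives up to order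
  \<open>k\<close> exist as Frechet derivatives and are continuous.\<close>

primrec C_on :: "nat \<Rightarrow> 'a::euclidean_space set \<Rightarrow> ('a \<Rightarrow> 'b::real_normed_vector) \<Rightarrow> bool" where
  "C_on 0 S f \<longleftrightarrow> continuous_on S f"
| "C_on (Suc k) S f \<longleftrightarrow> (\<forall>x\<in>S. f differentiable (at x)) \<and>
     (\<forall>v. C_on k S (\<lambda>x. frechet_derivative f (at x) v))"

definition smooth_on :: "'a::euclidean_space set \<Rightarrow> ('a \<Rightarrow> 'b::real_normed_vector) \<Rightarrow> bool" where
  "smooth_on S f \<longleftrightarrow> (\<forall>k. C_on k S f)"

text \<open>A chart is a pair of its domain and its coordinate map (irrelevant outside the domain).\<close>

type_synonym 'm chart = "'m set \<times> ('m \<Rightarrow> real^7)"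

definition chart_dom :: "'m chart \<Rightarrow> 'm set" where
  "chart_dom c = fst c"

definition chart_map :: "'m chart \<Rightarrow> 'm \<Rightarrow> real^7" where
  "chart_map c = snd c"

definition chart_img :: "'m chart \<Rightarrow> (real^7) set" where
  "chart_img c = chart_map c ` chart_dom c"

definition chart_inv :: "'m chart \<Rightarrow> real^7 \<Rightarrow> 'm" where
  "chart_inv c = inv_into (chart_dom c) (chart_map c)"

definition is_chart :: "('m::topological_space) chart \<Rightarrow> bool" where
  "is_chart c \<longleftrightarrow> open (chart_dom c) \<and> open (chart_img c) \<and>
     homeomorphism (chart_dom c) (chart_img c) (chart_map c) (chart_inv c)"

definition transition :: "'m chart \<Rightarrow> 'm chart \<Rightarrow> real^7 \<Rightarrow> real^7" where
  "transition c c' = chart_map c' \<circ> chart_inv c"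

definition transition_deriv :: "'m chart \<Rightarrow> 'm chart \<Rightarrow> 'm \<Rightarrow> real^7 \<Rightarrow> real^7" where
  "transition_deriv c c' p = frechet_derivative (transition c c') (at (chart_map c p))"

text \<open>The manifold is the whole type \<open>'m\<close>, its smooth structure is given by an atlas (which need
  not be maximal); there is no boundary.\<close>

definition smooth_atlas :: "('m::{t2_space, second_countable_topology}) chart set \<Rightarrow> bool" where
  "smooth_atlas A \<longleftrightarrow> (\<forall>c\<in>A. is_chart c) \<and> (\<Union>c\<in>A. chart_dom c) = UNIV \<and>
     (\<forall>c\<in>A. \<forall>c'\<in>A. smooth_on (chart_map c ` (chart_dom c \<inter> chart_dom c')) (transition c c'))"

definition oriented_atlas :: "('m::{t2_space, second_countable_topology}) chart set \<Rightarrow> bool" where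
  "oriented_atlas A \<longleftrightarrow> smooth_atlas A \<and>
     (\<forall>c\<in>A. \<forall>c'\<in>A. \<forall>p\<in>chart_dom c \<inter> chart_dom c'. det (matrix (transition_deriv c c' p)) > 0)"

definition smooth_fun :: "'m chart set \<Rightarrow> ('m \<Rightarrow> real) \<Rightarrow> bool" where
  "smooth_fun A f \<longleftrightarrow> (\<forall>c\<in>A. smooth_on (chart_img c) (f \<circ> chart_inv c))"


section \<open>Spin structures\<close>

text \<open>The Clifford algebra of \<open>\<real>\<^sup>7\<close> with \<open>v\<^sup>2 = - |v|\<^sup>2\<close>, on its basis of ordered monomials
  \<open>e\<^sub>S\<close>. Reordering \<open>e\<^sub>S e\<^sub>T\<close> costs a sign for each inversion, and \<open>e\<^sub>i e\<^sub>i = -1\<close> one for each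
  common index.\<close>

type_synonym clifford7 = "real^(7 set)"

definition cl_sign :: "7 set \<Rightarrow> 7 set \<Rightarrow> real" where
  "cl_sign S T = (-1) ^ (card {(s, t). s \<in> S \<and> t \<in> T \<and> t < s} + card (S \<inter> T))"

definition cl_mult :: "clifford7 \<Rightarrow> clifford7 \<Rightarrow> clifford7" where
  "cl_mult a b = (\<Sum>S\<in>UNIV. \<Sum>T\<in>UNIV. (cl_sign S T * a $ S * b $ T) *\<^sub>R axis ((S - T) \<union> (T - S)) 1)"

definition cl_vec :: "real^7 \<Rightarrow> clifford7" where
  "cl_vec v = (\<Sum>i\<in>UNIV. (v $ i) *\<^sub>R axis {i} 1)"

definition Spin7 :: "clifford7 set" where
  "Spin7 = {foldr cl_mult (map cl_vec vs) (axis {} 1) | vs. even (length vs) \<and> (\<forall>v\<in>set vs. norm v = 1)}"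

text \<open>The double cover \<open>Spin(7) \<rightarrow> SO(7)\<close> sends \<open>s\<close> to \<open>v \<mapsto> s v s\<^sup>-\<^sup>1\<close>.\<close>

definition spin_covers :: "clifford7 \<Rightarrow> real^7^7 \<Rightarrow> bool" where
  "spin_covers s Q \<longleftrightarrow> s \<in> Spin7 \<and> rotation_matrix Q \<and>
     (\<forall>v. cl_mult s (cl_vec v) = cl_mult (cl_vec (Q *v v)) s)"

text \<open>A triple \<open>(c, W, E)\<close> is an oriented frame of the tangent bundle over \<open>W\<close>: the columns of \<open>E p\<close>
  are the components in the chart \<open>c\<close> of its vectors at \<open>p\<close>. Declaring the frames orthonormal
  defines a metric exactly when they differ by rotations \<open>Q\<close>; a spin structure is a lift of these
  transition functions to a \<open>Spin(7)\<close>-valued cocycle.\<close>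

type_synonym 'm frame_field = "'m chart \<times> 'm set \<times> ('m \<Rightarrow> real^7^7)"

definition is_frame_field :: "('m::topological_space) chart set \<Rightarrow> 'm frame_field \<Rightarrow> bool" where
  "is_frame_field A F = (case F of (c, W, E) \<Rightarrow>
     c \<in> A \<and> open W \<and> W \<subseteq> chart_dom c \<and> continuous_on W E \<and> (\<forall>p\<in>W. det (E p) > 0))"

definition frame_dom :: "'m frame_field \<Rightarrow> 'm set" where
  "frame_dom F = fst (snd F)"

definition frame_change :: "'m frame_field \<Rightarrow> 'm frame_field \<Rightarrow> 'm \<Rightarrow> real^7^7 \<Rightarrow> bool" where
  "frame_change F F' p Q = (case F of (c, W, E) \<Rightarrow> case F' of (c', W', E') \<Rightarrow>
     E' p ** Q = matrix (transition_deriv c c' p) ** E p)"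

definition spin_manifold :: "('m::{t2_space, second_countable_topology}) chart set \<Rightarrow> bool" where
  "spin_manifold A \<longleftrightarrow> oriented_atlas A \<and>
     (\<exists>\<F> s. (\<forall>F\<in>\<F>. is_frame_field A F) \<and> (\<Union>F\<in>\<F>. frame_dom F) = UNIV \<and>
       (\<forall>F\<in>\<F>. \<forall>F'\<in>\<F>. continuous_on (frame_dom F \<inter> frame_dom F') (s F F') \<and>
          (\<forall>p\<in>frame_dom F \<inter> frame_dom F'. \<exists>Q. frame_change F F' p Q \<and> spin_covers (s F F' p) Q)) \<and>
       (\<forall>F\<in>\<F>. \<forall>F'\<in>\<F>. \<forall>F''\<in>\<F>. \<forall>p\<in>frame_dom F \<inter> frame_dom F' \<inter> frame_dom F''.
          cl_mult (s F' F'' p) (s F F' p) = s F F'' p))"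


section \<open>Exterior algebra of \<open>\<real>\<^sup>7\<close>\<close>

text \<open>A \<open>k\<close>-covector is a function on lists of vectors, extended by 0 to lists whose length is
  not \<open>k\<close>. Thus covectors of all degrees share one type and a 0-covector is a number, its value
  on the empty list.\<close>

type_synonym covector = "(real^7) list \<Rightarrow> real"

definition is_covector :: "nat \<Rightarrow> covector \<Rightarrow> bool" where
  "is_covector k \<alpha> \<longleftrightarrow> (\<forall>vs. length vs \<noteq> k \<longrightarrow> \<alpha> vs = 0) \<and>
     (\<forall>us ws. linear (\<lambda>v. \<alpha> (us @ v # ws))) \<and>
     (\<forall>vs. \<not> distinct vs \<longrightarrow> \<alpha> vs = 0)"

text \<open>The wedge product as a sum over shuffles, \<open>S\<close> being the set of positions given to \<open>\<alpha>\<close>: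
  for a \<open>p\<close>-covector and a \<open>q\<close>-covector it is the antisymmetrisation with factor \<open>1/(p! q!)\<close>.\<close>

definition wedge :: "covector \<Rightarrow> covector \<Rightarrow> covector"  (infixr \<open>\<and>\<^sub>\<Lambda>\<close> 75) where
  "(\<alpha> \<and>\<^sub>\<Lambda> \<beta>) vs = (\<Sum>S\<in>Pow {..<length vs}.
     (-1) ^ card {(i, j). i \<in> S \<and> j \<in> {..<length vs} - S \<and> j < i} *
     \<alpha> (nths vs S) * \<beta> (nths vs (- S)))"

definition int_prod :: "real^7 \<Rightarrow> covector \<Rightarrow> covector"  (infixr \<open>\<lrcorner>\<close> 80) where
  "(X \<lrcorner> \<alpha>) vs = \<alpha> (X # vs)"

definition dual_basis :: "7 \<Rightarrow> covector" where
  "dual_basis i vs = (if length vs = 1 then hd vs $ i else 0)"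

definition e3 :: "7 \<Rightarrow> 7 \<Rightarrow> 7 \<Rightarrow> covector" where
  "e3 i j k = dual_basis i \<and>\<^sub>\<Lambda> dual_basis j \<and>\<^sub>\<Lambda> dual_basis k"

text \<open>In the index type \<open>7\<close> the numeral 7 equals 0; only the distinctness of the labels matters.\<close>

definition phi0 :: covector where
  "phi0 vs = e3 1 2 7 vs + e3 3 4 7 vs + e3 5 6 7 vs + e3 1 3 5 vs
     - e3 1 4 6 vs - e3 2 3 6 vs - e3 2 4 5 vs"


section \<open>Metric, volume form and Hodge star of a \<open>G\<^sub>2\<close>-structure at a point\<close>

type_synonym metric = "real^7 \<Rightarrow> real^7 \<Rightarrow> real"

definition is_metric :: "metric \<Rightarrow> bool" where
  "is_metric g \<longleftrightarrow> bilinear g \<and> (\<forall>X Y. g X Y = g Y X) \<and> (\<forall>X. X \<noteq> 0 \<longrightarrow> g X X > 0)"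

text \<open>The volume form of \<open>g\<close> for one of the two orientations.\<close>

definition is_volume_of :: "metric \<Rightarrow> covector \<Rightarrow> bool" where
  "is_volume_of g vol \<longleftrightarrow> is_covector 7 vol \<and>
     (\<forall>vs. length vs = 7 \<and> (\<forall>i<7. \<forall>j<7. g (vs ! i) (vs ! j) = (if i = j then 1 else 0))
        \<longrightarrow> \<bar>vol vs\<bar> = 1)"

definition g2_determines :: "covector \<Rightarrow> metric \<Rightarrow> covector \<Rightarrow> bool" where
  "g2_determines \<phi> g vol \<longleftrightarrow> is_metric g \<and> is_volume_of g vol \<and>
     (\<forall>X Y vs. ((X \<lrcorner> \<phi>) \<and>\<^sub>\<Lambda> (Y \<lrcorner> \<phi>) \<and>\<^sub>\<Lambda> \<phi>) vs = 6 * g X Y * vol vs)"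

definition g2_metric :: "covector \<Rightarrow> metric" where
  "g2_metric \<phi> = (THE g. \<exists>vol. g2_determines \<phi> g vol)"

definition g2_vol :: "covector \<Rightarrow> covector" where
  "g2_vol \<phi> = (THE vol. \<exists>g. g2_determines \<phi> g vol)"

definition inverse_metric :: "metric \<Rightarrow> real^7^7" where
  "inverse_metric g = matrix_inv (\<chi> i j. g (axis i 1) (axis j 1))"

text \<open>Full contraction of the indices with the inverse metric, divided by \<open>k!\<close>; in an
  orthonormal frame this is the contraction of repeated lower indices.\<close>

definition covector_inner :: "metric \<Rightarrow> nat \<Rightarrow> covector \<Rightarrow> covector \<Rightarrow> real" where
  "covector_inner g k \<alpha> \<beta> =
     (\<Sum>I\<in>{I :: 7 list. length I = k}. \<Sum>J\<in>{J :: 7 list. length J = k}.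
        (\<Prod>l<k. inverse_metric g $ (I ! l) $ (J ! l)) *
        \<alpha> (map (\<lambda>i. axis i 1) I) * \<beta> (map (\<lambda>j. axis j 1) J)) / fact k"

definition hodge :: "metric \<Rightarrow> covector \<Rightarrow> nat \<Rightarrow> covector \<Rightarrow> covector" where
  "hodge g vol k \<beta> = (THE \<gamma>. is_covector (7 - k) \<gamma> \<and>
     (\<forall>\<alpha>. is_covector k \<alpha> \<longrightarrow> \<alpha> \<and>\<^sub>\<Lambda> \<gamma> = (\<lambda>vs. covector_inner g k \<alpha> \<beta> * vol vs)))"

text \<open>\<open>\<alpha> \<lrcorner> \<omega>\<close> for a 1-covector \<open>\<alpha>\<close>, i.e. the interior product with its metric dual vector.\<close>

definition contract :: "metric \<Rightarrow> covector \<Rightarrow> covector \<Rightarrow> covector" where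
  "contract g \<alpha> \<omega> vs =
     (\<Sum>i\<in>UNIV. \<Sum>j\<in>UNIV. inverse_metric g $ i $ j * \<alpha> [axis i 1] * (axis j 1 \<lrcorner> \<omega>) vs)"


section \<open>Differential forms\<close>

text \<open>A form is the family of its coordinate representations: \<open>\<omega> c u\<close> is the covector at the
  coordinate point \<open>u \<in> chart_img c\<close>, and different charts are related by pullback.\<close>

type_synonym 'm form = "'m chart \<Rightarrow> real^7 \<Rightarrow> covector"

definition is_form :: "'m chart set \<Rightarrow> nat \<Rightarrow> 'm form \<Rightarrow> bool" where
  "is_form A k \<omega> \<longleftrightarrow>
     (\<forall>c\<in>A. \<forall>u\<in>chart_img c. is_covector k (\<omega> c u)) \<and>
     (\<forall>c\<in>A. \<forall>vs. smooth_on (chart_img c) (\<lambda>u. \<omega> c u vs)) \<and>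
     (\<forall>c\<in>A. \<forall>c'\<in>A. \<forall>p\<in>chart_dom c \<inter> chart_dom c'. \<forall>vs.
        \<omega> c (chart_map c p) vs = \<omega> c' (chart_map c' p) (map (transition_deriv c c' p) vs))"

definition vanishes :: "'m chart set \<Rightarrow> 'm form \<Rightarrow> bool" where
  "vanishes A \<omega> \<longleftrightarrow> (\<forall>c\<in>A. \<forall>u\<in>chart_img c. \<forall>vs. \<omega> c u vs = 0)"

definition fun_form :: "('m \<Rightarrow> real) \<Rightarrow> 'm form" where
  "fun_form f c u vs = (if vs = [] then f (chart_inv c u) else 0)"

definition fun_mult :: "('m \<Rightarrow> real) \<Rightarrow> 'm form \<Rightarrow> 'm form" where
  "fun_mult f \<omega> c u vs = f (chart_inv c u) * \<omega> c u vs"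

definition wedge_form :: "'m form \<Rightarrow> 'm form \<Rightarrow> 'm form" where
  "wedge_form \<alpha> \<beta> c u = \<alpha> c u \<and>\<^sub>\<Lambda> \<beta> c u"

text \<open>\<open>d\<omega>(v\<^sub>0, \<dots>, v\<^sub>k) = \<Sum>\<^sub>i (-1)\<^sup>i D\<^bsub>v\<^sub>i\<^esub> \<omega>(v\<^sub>0, \<dots>, v\<^sub>i omitted, \<dots>, v\<^sub>k)\<close>, with the \<open>v\<^sub>i\<close>
  constant in the coordinates.\<close>

definition ext_d :: "'m form \<Rightarrow> 'm form" where
  "ext_d \<omega> c u vs = (\<Sum>i<length vs. (-1) ^ i *
     frechet_derivative (\<lambda>y. \<omega> c y (take i vs @ drop (Suc i) vs)) (at u) (vs ! i))"


section \<open>\<open>G\<^sub>2\<close>-structures and their torsion\<close>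

definition g2_structure :: "'m chart set \<Rightarrow> 'm form \<Rightarrow> bool" where
  "g2_structure A \<phi> \<longleftrightarrow> is_form A 3 \<phi> \<and>
     (\<forall>c\<in>A. \<forall>u\<in>chart_img c. \<exists>L :: real^7 \<Rightarrow> real^7. linear L \<and> bij L \<and>
        (\<forall>vs. \<phi> c u vs = phi0 (map L vs)))"

text \<open>The operators below take the degree \<open>k\<close> of the form as an argument.\<close>

definition star :: "'m form \<Rightarrow> nat \<Rightarrow> 'm form \<Rightarrow> 'm form" where
  "star \<phi> k \<omega> c u = hodge (g2_metric (\<phi> c u)) (g2_vol (\<phi> c u)) k (\<omega> c u)"

definition norm2 :: "'m form \<Rightarrow> nat \<Rightarrow> 'm form \<Rightarrow> 'm chart \<Rightarrow> real^7 \<Rightarrow> real" where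
  "norm2 \<phi> k \<omega> c u = covector_inner (g2_metric (\<phi> c u)) k (\<omega> c u) (\<omega> c u)"

definition contract_form :: "'m form \<Rightarrow> 'm form \<Rightarrow> 'm form \<Rightarrow> 'm form" where
  "contract_form \<phi> \<alpha> \<omega> c u = contract (g2_metric (\<phi> c u)) (\<alpha> c u) (\<omega> c u)"

definition psi :: "'m form \<Rightarrow> 'm form" where
  "psi \<phi> = star \<phi> 3 \<phi>"

text \<open>\<open>d\<^sup>\<star> = (-1)\<^sup>k \<star> d \<star>\<close> on \<open>k\<close>-forms in dimension 7, for \<open>k \<ge> 1\<close>.\<close>

definition codiff :: "'m form \<Rightarrow> nat \<Rightarrow> 'm form \<Rightarrow> 'm form" where
  "codiff \<phi> k \<omega> c u vs = (-1) ^ k * star \<phi> (8 - k) (ext_d (star \<phi> k \<omega>)) c u vs"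

definition laplacian :: "'m form \<Rightarrow> ('m \<Rightarrow> real) \<Rightarrow> 'm chart \<Rightarrow> real^7 \<Rightarrow> real" where
  "laplacian \<phi> f c u = - codiff \<phi> 1 (ext_d (fun_form f)) c u []"

definition torsion_forms ::
  "'m chart set \<Rightarrow> 'm form \<Rightarrow> ('m \<Rightarrow> real) \<Rightarrow> 'm form \<Rightarrow> 'm form \<Rightarrow> 'm form \<Rightarrow> bool" where
  "torsion_forms A \<phi> \<tau>\<^sub>0 \<tau>\<^sub>1 \<tau>\<^sub>2 \<tau>\<^sub>3 \<longleftrightarrow>
     smooth_fun A \<tau>\<^sub>0 \<and> is_form A 1 \<tau>\<^sub>1 \<and> is_form A 2 \<tau>\<^sub>2 \<and> is_form A 3 \<tau>\<^sub>3 \<and>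
     vanishes A (wedge_form \<tau>\<^sub>2 (psi \<phi>)) \<and>
     vanishes A (wedge_form \<tau>\<^sub>3 \<phi>) \<and>
     vanishes A (wedge_form \<tau>\<^sub>3 (psi \<phi>)) \<and>
     (\<forall>c\<in>A. \<forall>u\<in>chart_img c. \<forall>vs.
        ext_d \<phi> c u vs = fun_mult \<tau>\<^sub>0 (psi \<phi>) c u vs + 3 * wedge_form \<tau>\<^sub>1 \<phi> c u vs
          + star \<phi> 3 \<tau>\<^sub>3 c u vs \<and>
        ext_d (psi \<phi>) c u vs = 4 * wedge_form \<tau>\<^sub>1 (psi \<phi>) c u vs + wedge_form \<tau>\<^sub>2 \<phi> c u vs)"

definition H_form :: "'m form \<Rightarrow> ('m \<Rightarrow> real) \<Rightarrow> 'm form \<Rightarrow> 'm form \<Rightarrow> 'm form" where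
  "H_form \<phi> \<tau>\<^sub>0 \<tau>\<^sub>1 \<tau>\<^sub>3 c u vs =
     1/6 * fun_mult \<tau>\<^sub>0 \<phi> c u vs - contract_form \<phi> \<tau>\<^sub>1 (psi \<phi>) c u vs - \<tau>\<^sub>3 c u vs"

end

theory Submission
  imports Defs "HOL-Combinatorics.Multiset_Permutations"
begin

text \<open>The fixed point equations make \<open>f\<close> superharmonic. Since \<open>e\<^sup>-\<^sup>4\<^sup>f \<psi>\<close> is closed, \<open>\<tau>\<^sub>1 = df\<close> and \<open>\<tau>\<^sub>2 = 0\<close>,
  and then \<open>H \<and> \<phi> = - 4 \<star>df\<close>. Differentiating this and inserting the first equation for \<open>dH\<close> gives
  \<open>4 \<Delta>f = (7/6 - 49C/4) \<tau>\<^sub>0\<^sup>2 + 12 |df|\<^sup>2 - |\<tau>\<^sub>3|\<^sup>2\<close>. Adding twelve times the second equation,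
  \<open>16 \<Delta>f = 12 (\<gamma> + 1) |df|\<^sup>2 - 4 |\<tau>\<^sub>3|\<^sup>2 + 12 (\<sigma> - 7 (21C - 2)/144) \<tau>\<^sub>0\<^sup>2 \<le> 0\<close>.
  By the strong maximum principle \<open>f\<close> is constant, so every term on the right vanishes. The maximum
  principle is local, so that no integration over the manifold is needed.\<close>

section \<open>Covectors and the wedge product\<close>

text \<open>Twelve is the weight that meets both bounds at once: adding \<lambda> times the second
  equation gives |df|^2 the coefficient \<open>12 + \<lambda> * \<gamma>\<close> and \<tau>0^2 the
  coefficient \<open>\<lambda> * \<sigma> + 7/6 - 49/4 * C\<close>, and for
  \<open>\<lambda> = 12\<close> these change sign exactly at the two bounds. As f is superharmonic,
  it is the minimum, attained by compactness, that propagates. The algebra avoids the representation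
  theory of G2: at each point a frame is chosen in which \<phi> is the model form, and every
  identity becomes a finite computation with its 35 coefficients. Two obstacles shape the rest.
  Metric, volume form and star are definite descriptions, so they must be shown to be well
  determined before anything can be computed, and then differentiable in coordinates before the
  equations can be differentiated. And the adapted frames are chosen point by point, without
  continuity from one point to the next, so the minimum principle asks for continuity only of the
  frame sums that make up the inverse metric.\<close>

lemma is_covectorI:
  assumes "\<And>vs. length vs \<noteq> k \<Longrightarrow> \<alpha> vs = 0"
    and "\<And>us ws. linear (\<lambda>v. \<alpha> (us @ v # ws))"
    and "\<And>vs. \<not> distinct vs \<Longrightarrow> \<alpha> vs = 0"
  shows "is_covector k \<alpha>"
  using assms by (auto simp: is_covector_def)

lemma covector_length: "is_covector k \<alpha> \<Longrightarrow> length vs \<noteq> k \<Longrightarrow> \<alpha> vs = 0"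
  by (auto simp: is_covector_def)

lemma covector_linear: "is_covector k \<alpha> \<Longrightarrow> linear (\<lambda>v. \<alpha> (us @ v # ws))"
  by (auto simp: is_covector_def)

lemma covector_not_distinct: "is_covector k \<alpha> \<Longrightarrow> \<not> distinct vs \<Longrightarrow> \<alpha> vs = 0"
  by (auto simp: is_covector_def)

text \<open>Polarisation: the value with \<open>a + b\<close> in both slots is zero, and expanding
  it leaves only the two mixed terms.\<close>

lemma covector_swap:
  assumes "is_covector k \<alpha>"
  shows "\<alpha> (us @ a # b # ws) = - \<alpha> (us @ b # a # ws)"
proof -
  have l1: "\<alpha> (us @ (x + y) # zs) = \<alpha> (us @ x # zs) + \<alpha> (us @ y # zs)" for x y zs
    using linear_add[OF covector_linear[OF assms, of us zs]] by simp
  have l2: "\<alpha> (us @ x # (y + z) # zs) = \<alpha> (us @ x # y # zs) + \<alpha> (us @ x # z # zs)" for x y z zs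
    using linear_add[OF covector_linear[OF assms, of "us @ [x]" zs]] by simp
  have "0 = \<alpha> (us @ (a + b) # (a + b) # ws)"
    by (rule sym, rule covector_not_distinct[OF assms]) auto
  also have "\<dots> = \<alpha> (us @ a # b # ws) + \<alpha> (us @ b # a # ws)"
    using covector_not_distinct[OF assms, of "us @ a # a # ws"]
      covector_not_distinct[OF assms, of "us @ b # b # ws"] by (simp add: l1 l2)
  finally show ?thesis by simp
qed

lemma covector_move:
  assumes "is_covector k \<alpha>"
  shows "\<alpha> (us @ a # ws) = (-1) ^ length us * \<alpha> (a # us @ ws)"
proof (induction us arbitrary: ws rule: rev_induct)
  case (snoc x us)
  have "\<alpha> ((us @ [x]) @ a # ws) = - \<alpha> (us @ a # x # ws)"
    using covector_swap[OF assms, of us x a ws] by simp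
  then show ?case using snoc[of "x # ws"] by simp
qed simp

text \<open>For \<open>k = 0\<close> the degree \<open>k - 1\<close> is again 0; this is harmless
  because the contraction is then the zero function, a covector of every degree.\<close>

lemma covector_int_prod:
  assumes "is_covector k \<alpha>"
  shows "is_covector (k - 1) (v \<lrcorner> \<alpha>)"
proof (rule is_covectorI)
  show "(v \<lrcorner> \<alpha>) vs = 0" if "length vs \<noteq> k - 1" for vs
    using that covector_length[OF assms, of "v # vs"] by (cases k) (auto simp: int_prod_def)
  show "linear (\<lambda>w. (v \<lrcorner> \<alpha>) (us @ w # ws))" for us ws
    using covector_linear[OF assms, of "v # us" ws] by (simp add: int_prod_def)
  show "(v \<lrcorner> \<alpha>) vs = 0" if "\<not> distinct vs" for vs
    using that covector_not_distinct[OF assms, of "v # vs"] by (simp add: int_prod_def)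
qed

lemma int_prod_0: "is_covector 0 \<alpha> \<Longrightarrow> v \<lrcorner> \<alpha> = (\<lambda>_. 0)"
  by (auto simp: int_prod_def covector_length)

lemma covector_zero: "is_covector k (\<lambda>_. 0)"
  by (rule is_covectorI) (auto simp: linear_iff)

lemma covector_add: "is_covector k \<alpha> \<Longrightarrow> is_covector k \<beta> \<Longrightarrow> is_covector k (\<lambda>vs. \<alpha> vs + \<beta> vs)"
  by (rule is_covectorI)
    (auto simp: covector_length covector_not_distinct linear_iff algebra_simps
      linear_add[OF covector_linear] linear_cmul[OF covector_linear])

lemma covector_scale: "is_covector k \<alpha> \<Longrightarrow> is_covector k (\<lambda>vs. c * \<alpha> vs)"
  by (rule is_covectorI)
    (auto simp: covector_length covector_not_distinct linear_iff algebra_simps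
      linear_add[OF covector_linear] linear_cmul[OF covector_linear])

lemma covector_uminus: "is_covector k \<alpha> \<Longrightarrow> is_covector k (\<lambda>vs. - \<alpha> vs)"
  using covector_scale[of k \<alpha> "-1"] by simp

lemma covector_diff: "is_covector k \<alpha> \<Longrightarrow> is_covector k \<beta> \<Longrightarrow> is_covector k (\<lambda>vs. \<alpha> vs - \<beta> vs)"
  using covector_add[of k \<alpha> "\<lambda>vs. - \<beta> vs"] by (simp add: covector_uminus)

lemma covector_sum:
  "(\<And>i. i \<in> I \<Longrightarrow> is_covector k (\<alpha> i)) \<Longrightarrow> is_covector k (\<lambda>vs. \<Sum>i\<in>I. \<alpha> i vs)"
  by (induction I rule: infinite_finite_induct) (auto simp: covector_zero covector_add)

text \<open>Contracting one slot at a time reduces statements about wedge products to induction on the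
  list of arguments.\<close>

lemma wedge_Nil: "(\<alpha> \<and>\<^sub>\<Lambda> \<beta>) [] = \<alpha> [] * \<beta> []"
  by (simp add: wedge_def)

lemma Pow_lessThan_Suc:
  "Pow {..<Suc n} = (`) Suc ` Pow {..<n} \<union> (\<lambda>S. insert 0 (Suc ` S)) ` Pow {..<n}"
proof -
  have "{..<Suc n} = insert 0 (Suc ` {..<n})" by (simp add: lessThan_Suc_eq_insert_0)
  then show ?thesis
    by (auto simp: Pow_insert image_Pow_surj[of Suc "{..<n}" "Suc ` {..<n}", symmetric] image_image)
qed

text \<open>The shuffles are split by whether position 0 goes to \<alpha> or to \<beta>. In the
  second case 0 forms an inversion with every element of \<open>S\<close>, and homogeneity of
  \<alpha> turns \<open>card S\<close> into \<open>p\<close>. Only homogeneity is assumed, so that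
  the rule also applies to exterior derivatives, for which alternation is not established.\<close>

lemma wedge_Cons_homogeneous:
  assumes \<alpha>: "\<And>vs. length vs \<noteq> p \<Longrightarrow> \<alpha> vs = 0"
  shows "(\<alpha> \<and>\<^sub>\<Lambda> \<beta>) (v # vs) = ((v \<lrcorner> \<alpha>) \<and>\<^sub>\<Lambda> \<beta>) vs + (-1) ^ p * (\<alpha> \<and>\<^sub>\<Lambda> (v \<lrcorner> \<beta>)) vs"
proof -
  define n where "n = length vs"
  let ?c = "\<lambda>m S. card {(i, j). i \<in> S \<and> j \<in> {..<m} - S \<and> j < (i::nat)}"
  let ?t = "\<lambda>S. (-1) ^ ?c (Suc n) S * \<alpha> (nths (v # vs) S) * \<beta> (nths (v # vs) (- S))"
  have inj1: "inj_on ((`) Suc) (Pow {..<n})"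
    by (rule inj_onI) (simp add: inj_image_eq_iff)
  have inj2: "inj_on (\<lambda>S. insert 0 (Suc ` S)) (Pow {..<n})"
    by (rule inj_onI) (metis image_iff insert_ident inj_Suc inj_image_eq_iff nat.simps(3))
  have nths1: "nths (v # vs) (Suc ` S) = nths vs S" "nths (v # vs) (insert 0 (Suc ` S)) = v # nths vs S"
    "nths (v # vs) (- Suc ` S) = v # nths vs (- S)"
    "nths (v # vs) (- insert 0 (Suc ` S)) = nths vs (- S)" for S
    by (auto simp: nths_Cons intro!: arg_cong[where f = "nths vs"])
  have c2: "?c (Suc n) (insert 0 (Suc ` S)) = ?c n S" for S
  proof -
    have "{(i, j). i \<in> insert 0 (Suc ` S) \<and> j \<in> {..<Suc n} - insert 0 (Suc ` S) \<and> j < i} =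
        map_prod Suc Suc ` {(i, j). i \<in> S \<and> j \<in> {..<n} - S \<and> j < i}"
    proof (intro equalityI subsetI, clarsimp, goal_cases)
      case (1 i j) then show ?case by (cases i; cases j) (auto simp: image_iff)
    qed auto
    then show ?thesis by (simp add: card_image inj_on_def)
  qed
  have c1: "?c (Suc n) (Suc ` S) = ?c n S + card S" if "S \<subseteq> {..<n}" for S
  proof -
    have "finite S" using that finite_subset by blast
    have "{(i, j). i \<in> Suc ` S \<and> j \<in> {..<Suc n} - Suc ` S \<and> j < i} =
        map_prod Suc Suc ` {(i, j). i \<in> S \<and> j \<in> {..<n} - S \<and> j < i} \<union> (\<lambda>i. (Suc i, 0)) ` S"
    proof (intro equalityI subsetI, clarsimp, goal_cases)
      case (1 i j) then show ?case by (cases i; cases j) (auto simp: image_iff)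
    qed auto
    moreover have "finite {(i, j). i \<in> S \<and> j \<in> {..<n} - S \<and> j < i}"
      by (rule finite_subset[of _ "S \<times> {..<n}"]) (use \<open>finite S\<close> in auto)
    ultimately show ?thesis
      by (simp only:, subst card_Un_disjoint) (auto simp: card_image inj_on_def \<open>finite S\<close>)
  qed
  have len: "length (nths vs S) = card S" if "S \<subseteq> {..<n}" for S
    using that by (auto simp: length_nths n_def intro!: arg_cong[where f=card])
  have "(\<alpha> \<and>\<^sub>\<Lambda> \<beta>) (v # vs) = (\<Sum>S\<in>Pow {..<Suc n}. ?t S)"
    by (simp add: wedge_def n_def)
  also have "\<dots> = (\<Sum>S\<in>(`) Suc ` Pow {..<n}. ?t S) + (\<Sum>S\<in>(\<lambda>S. insert 0 (Suc ` S)) ` Pow {..<n}. ?t S)"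
    unfolding Pow_lessThan_Suc by (rule sum.union_disjoint) auto
  also have "(\<Sum>S\<in>(\<lambda>S. insert 0 (Suc ` S)) ` Pow {..<n}. ?t S) = ((v \<lrcorner> \<alpha>) \<and>\<^sub>\<Lambda> \<beta>) vs"
    by (simp only: sum.reindex[OF inj2] o_def c2 nths1) (simp add: wedge_def int_prod_def n_def)
  also have "(\<Sum>S\<in>(`) Suc ` Pow {..<n}. ?t S) = (\<Sum>S\<in>Pow {..<n}. ?t (Suc ` S))"
    by (simp only: sum.reindex[OF inj1] o_def)
  also have "\<dots> = (\<Sum>S\<in>Pow {..<n}. (-1) ^ p * ((-1) ^ ?c n S * \<alpha> (nths vs S) * (v \<lrcorner> \<beta>) (nths vs (- S))))"
  proof (rule sum.cong[OF refl], goal_cases)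
    case (1 S)
    then have S: "S \<subseteq> {..<n}" by simp
    show ?case
    proof (cases "card S = p")
      case True
      then show ?thesis by (simp only: c1[OF S] nths1) (simp add: power_add int_prod_def)
    next
      case False
      then have "\<alpha> (nths vs S) = 0" using len[OF S] \<alpha> by simp
      then show ?thesis by (simp only: nths1)
    qed
  qed
  also have "\<dots> = (-1) ^ p * (\<alpha> \<and>\<^sub>\<Lambda> (v \<lrcorner> \<beta>)) vs"
    by (simp add: wedge_def n_def sum_distrib_left)
  finally show ?thesis by simp
qed

lemma wedge_Cons:
  "is_covector p \<alpha> \<Longrightarrow>
    (\<alpha> \<and>\<^sub>\<Lambda> \<beta>) (v # vs) = ((v \<lrcorner> \<alpha>) \<and>\<^sub>\<Lambda> \<beta>) vs + (-1) ^ p * (\<alpha> \<and>\<^sub>\<Lambda> (v \<lrcorner> \<beta>)) vs"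
  using wedge_Cons_homogeneous covector_length by metis

lemma wedge_add_left: "((\<lambda>vs. \<alpha> vs + \<alpha>' vs) \<and>\<^sub>\<Lambda> \<beta>) vs = (\<alpha> \<and>\<^sub>\<Lambda> \<beta>) vs + (\<alpha>' \<and>\<^sub>\<Lambda> \<beta>) vs"
  and wedge_add_right: "(\<beta> \<and>\<^sub>\<Lambda> (\<lambda>vs. \<alpha> vs + \<alpha>' vs)) vs = (\<beta> \<and>\<^sub>\<Lambda> \<alpha>) vs + (\<beta> \<and>\<^sub>\<Lambda> \<alpha>') vs"
  by (simp_all add: wedge_def algebra_simps sum.distrib)

lemma wedge_scale_left: "((\<lambda>vs. c * \<alpha> vs) \<and>\<^sub>\<Lambda> \<beta>) vs = c * (\<alpha> \<and>\<^sub>\<Lambda> \<beta>) vs"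
  and wedge_scale_right: "(\<beta> \<and>\<^sub>\<Lambda> (\<lambda>vs. c * \<alpha> vs)) vs = c * (\<beta> \<and>\<^sub>\<Lambda> \<alpha>) vs"
  by (simp_all add: wedge_def sum_distrib_left mult_ac)

lemma wedge_zero_left: "((\<lambda>_. 0) \<and>\<^sub>\<Lambda> \<beta>) vs = 0"
  and wedge_zero_right: "(\<beta> \<and>\<^sub>\<Lambda> (\<lambda>_. 0)) vs = 0"
  by (simp_all add: wedge_def)

lemma wedge_diff_left: "((\<lambda>vs. \<alpha> vs - \<alpha>' vs) \<and>\<^sub>\<Lambda> \<beta>) vs = (\<alpha> \<and>\<^sub>\<Lambda> \<beta>) vs - (\<alpha>' \<and>\<^sub>\<Lambda> \<beta>) vs"
  and wedge_diff_right: "(\<beta> \<and>\<^sub>\<Lambda> (\<lambda>vs. \<alpha> vs - \<alpha>' vs)) vs = (\<beta> \<and>\<^sub>\<Lambda> \<alpha>) vs - (\<beta> \<and>\<^sub>\<Lambda> \<alpha>') vs"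
  by (simp_all add: wedge_def algebra_simps sum_subtractf)

lemma int_prod_wedge:
  assumes "is_covector p \<alpha>"
  shows "v \<lrcorner> (\<alpha> \<and>\<^sub>\<Lambda> \<beta>) = (\<lambda>vs. ((v \<lrcorner> \<alpha>) \<and>\<^sub>\<Lambda> \<beta>) vs + (-1) ^ p * (\<alpha> \<and>\<^sub>\<Lambda> (v \<lrcorner> \<beta>)) vs)"
  by (rule ext) (simp add: int_prod_def[of v "wedge \<alpha> \<beta>"] wedge_Cons[OF assms])

text \<open>The criterion behind the induction for wedge products. A later repetition of the head
  can be moved next to it inside the contraction, so repetitions need to be examined in the first
  two slots only.\<close>

lemma covector_Cons:
  assumes "\<And>v. is_covector (k - 1) (v \<lrcorner> \<alpha>)" and "k > 0"
    and "\<alpha> [] = 0" and "\<And>ws. linear (\<lambda>v. \<alpha> (v # ws))" and "\<And>v ws. \<alpha> (v # v # ws) = 0"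
  shows "is_covector k \<alpha>"
proof (rule is_covectorI)
  note ip = assms(1)[unfolded int_prod_def]
  show "\<alpha> vs = 0" if "length vs \<noteq> k" for vs
  proof (cases vs)
    case (Cons v ws)
    then show ?thesis using that covector_length[OF ip, of ws v] assms(2) by auto
  qed (use assms in simp)
  show "linear (\<lambda>v. \<alpha> (us @ v # ws))" for us ws
    by (cases us) (use assms(4) covector_linear[OF ip] in simp_all)
  show "\<alpha> vs = 0" if "\<not> distinct vs" for vs
  proof (cases vs)
    case (Cons v ws)
    show ?thesis
    proof (cases "distinct ws")
      case True
      then have "v \<in> set ws" using that Cons by simp
      then obtain a b where "ws = a @ v # b" by (meson split_list)
      then have "\<alpha> vs = (-1) ^ length a * \<alpha> (v # v # a @ b)"
        using covector_move[OF ip, of v a v b] Cons by simp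
      then show ?thesis using assms(5) by simp
    next
      case False
      then show ?thesis using covector_not_distinct[OF ip, of ws v] Cons by simp
    qed
  qed (use that in simp)
qed

lemma int_prod_int_prod_0: "is_covector p \<alpha> \<Longrightarrow> v \<lrcorner> v \<lrcorner> \<alpha> = (\<lambda>_. 0)"
  by (rule ext) (simp add: int_prod_def covector_not_distinct)

lemma linear_wedge_int_prod:
  assumes "is_covector p \<alpha>" "is_covector q \<beta>"
  shows "linear (\<lambda>v. ((v \<lrcorner> \<alpha>) \<and>\<^sub>\<Lambda> \<beta>) vs)" "linear (\<lambda>v. (\<alpha> \<and>\<^sub>\<Lambda> (v \<lrcorner> \<beta>)) vs)"
proof -
  have 1: "(v + w) \<lrcorner> \<gamma> = (\<lambda>vs. (v \<lrcorner> \<gamma>) vs + (w \<lrcorner> \<gamma>) vs)" "(c *\<^sub>R v) \<lrcorner> \<gamma> = (\<lambda>vs. c * (v \<lrcorner> \<gamma>) vs)"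
    if "is_covector k \<gamma>" for v w c k \<gamma>
    using linear_add[OF covector_linear[OF that, of "[]"]] linear_cmul[OF covector_linear[OF that, of "[]"]]
    by (auto simp: int_prod_def)
  show "linear (\<lambda>v. ((v \<lrcorner> \<alpha>) \<and>\<^sub>\<Lambda> \<beta>) vs)" "linear (\<lambda>v. (\<alpha> \<and>\<^sub>\<Lambda> (v \<lrcorner> \<beta>)) vs)"
    by (simp_all add: linear_iff 1[OF assms(1)] 1[OF assms(2)]
        wedge_add_left wedge_add_right wedge_scale_left wedge_scale_right)
qed

lemma covector_wedge:
  assumes "is_covector p \<alpha>" "is_covector q \<beta>"
  shows "is_covector (p + q) (\<alpha> \<and>\<^sub>\<Lambda> \<beta>)"
  using assms
proof (induction "p + q" arbitrary: p q \<alpha> \<beta>)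
  case 0
  then have pq: "p = 0" "q = 0" by auto
  have *: "(\<alpha> \<and>\<^sub>\<Lambda> \<beta>) (v # vs) = 0" for v vs
    using 0 pq by (simp add: wedge_Cons[of p] int_prod_0 wedge_zero_left wedge_zero_right)
  have **: "(\<alpha> \<and>\<^sub>\<Lambda> \<beta>) vs = 0" if "vs \<noteq> []" for vs
    using that * by (cases vs) auto
  show ?case unfolding pq
    by (rule is_covectorI) (auto simp: ** linear_iff, metis ** distinct.simps(1))
next
  case (Suc n)
  have 1: "is_covector n ((v \<lrcorner> \<alpha>) \<and>\<^sub>\<Lambda> \<beta>)" for v
  proof (cases p)
    case 0
    then show ?thesis using Suc.prems by (simp add: int_prod_0 wedge_zero_left[abs_def] covector_zero)
  next
    case (Suc p')
    then show ?thesis using Suc.hyps(1)[of p' q "v \<lrcorner> \<alpha>" \<beta>] Suc.hyps(2) Suc.prems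
        covector_int_prod[OF Suc.prems(1), of v] by simp
  qed
  have 2: "is_covector n (\<alpha> \<and>\<^sub>\<Lambda> (v \<lrcorner> \<beta>))" for v
  proof (cases q)
    case 0
    then show ?thesis using Suc.prems by (simp add: int_prod_0 wedge_zero_right[abs_def] covector_zero)
  next
    case (Suc q')
    then show ?thesis using Suc.hyps(1)[of p q' \<alpha> "v \<lrcorner> \<beta>"] Suc.hyps(2) Suc.prems
        covector_int_prod[OF Suc.prems(2), of v] by simp
  qed
  \<comment> \<open>Contracting twice with the same vector leaves two mixed terms of opposite sign.
    For \<open>p = 0\<close> truncated subtraction makes the signs equal, but then the contraction
    of \<alpha> is zero.\<close>
  have sq: "((v \<lrcorner> \<alpha>) \<and>\<^sub>\<Lambda> (v \<lrcorner> \<beta>)) ws * ((-1) ^ (p - 1) + (-1) ^ p) = 0" for v ws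
    by (cases p) (use Suc.prems in \<open>simp_all add: int_prod_0 wedge_zero_left\<close>)
  show ?case
  proof (rule covector_Cons)
    show "is_covector (p + q - 1) (v \<lrcorner> (\<alpha> \<and>\<^sub>\<Lambda> \<beta>))" for v
      using 1 2 Suc.hyps(2)[symmetric]
      by (simp add: int_prod_wedge[OF Suc.prems(1)] covector_add covector_scale)
    show "p + q > 0" using Suc.hyps(2) by linarith
    show "(\<alpha> \<and>\<^sub>\<Lambda> \<beta>) [] = 0"
      using Suc.hyps(2) covector_length[OF Suc.prems(1), of "[]"] covector_length[OF Suc.prems(2), of "[]"]
      by (cases p) (auto simp: wedge_Nil)
    show "linear (\<lambda>v. (\<alpha> \<and>\<^sub>\<Lambda> \<beta>) (v # ws))" for ws
      unfolding wedge_Cons[OF Suc.prems(1)]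
      using linear_wedge_int_prod[OF Suc.prems, of ws] by (simp add: linear_iff algebra_simps)
    show "(\<alpha> \<and>\<^sub>\<Lambda> \<beta>) (v # v # ws) = 0" for v ws
      using sq[of v ws]
      by (simp add: wedge_Cons[OF Suc.prems(1)] wedge_Cons[OF covector_int_prod[OF Suc.prems(1)]]
          int_prod_int_prod_0[OF Suc.prems(1)] int_prod_int_prod_0[OF Suc.prems(2)]
          wedge_zero_left wedge_zero_right algebra_simps)
  qed
qed

lemma wedge_commute:
  assumes "is_covector p \<alpha>" "is_covector q \<beta>"
  shows "(\<alpha> \<and>\<^sub>\<Lambda> \<beta>) vs = (-1) ^ (p * q) * (\<beta> \<and>\<^sub>\<Lambda> \<alpha>) vs"
  using assms
proof (induction vs arbitrary: p q \<alpha> \<beta>)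
  case Nil
  show ?case
  proof (cases "p = 0 \<and> q = 0")
    case False
    then have "\<alpha> [] * \<beta> [] = 0"
      using covector_length[OF Nil(1), of "[]"] covector_length[OF Nil(2), of "[]"] by auto
    then show ?thesis by (simp add: wedge_Nil mult.commute)
  qed (simp add: wedge_Nil)
next
  case (Cons v vs)
  have 1: "((v \<lrcorner> \<alpha>) \<and>\<^sub>\<Lambda> \<beta>) vs = (-1) ^ (p * q + q) * (\<beta> \<and>\<^sub>\<Lambda> (v \<lrcorner> \<alpha>)) vs"
  proof (cases p)
    case 0
    then show ?thesis using Cons.prems by (simp add: int_prod_0 wedge_zero_left wedge_zero_right)
  next
    case (Suc p')
    then show ?thesis
      using Cons.IH[OF covector_int_prod[OF Cons.prems(1), of v] Cons.prems(2)]
      by (simp add: power_add mult_ac flip: power_mult_distrib)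
  qed
  have 2: "(\<alpha> \<and>\<^sub>\<Lambda> (v \<lrcorner> \<beta>)) vs = (-1) ^ (p * q + p) * ((v \<lrcorner> \<beta>) \<and>\<^sub>\<Lambda> \<alpha>) vs"
  proof (cases q)
    case 0
    then show ?thesis using Cons.prems by (simp add: int_prod_0 wedge_zero_left wedge_zero_right)
  next
    case (Suc q')
    then show ?thesis
      using Cons.IH[OF Cons.prems(1) covector_int_prod[OF Cons.prems(2), of v]]
      by (simp add: power_add mult_ac flip: power_mult_distrib)
  qed
  show ?case
    by (simp add: wedge_Cons[OF Cons.prems(1)] wedge_Cons[OF Cons.prems(2)] 1 2 power_add
        algebra_simps flip: power_mult_distrib)
qed

text \<open>\<open>shuf p vs\<close> lists the ways to split \<open>vs\<close> into a subsequence of length \<open>p\<close> and the remaining one,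
  each with the sign of the corresponding shuffle. Evaluating wedge products on a frame through it
  only produces values on increasing lists of frame vectors.\<close>

fun shuf :: "nat \<Rightarrow> 'a list \<Rightarrow> (real \<times> 'a list \<times> 'a list) list" where
  "shuf 0 vs = [(1, [], vs)]"
| "shuf (Suc p) [] = []"
| "shuf (Suc p) (v # vs) = map (\<lambda>(s, a, b). (s, v # a, b)) (shuf p vs) @
     map (\<lambda>(s, a, b). ((-1) ^ Suc p * s, a, v # b)) (shuf (Suc p) vs)"

lemma wedge_0:
  assumes "is_covector 0 \<alpha>"
  shows "(\<alpha> \<and>\<^sub>\<Lambda> \<beta>) vs = \<alpha> [] * \<beta> vs"
  by (induction vs arbitrary: \<beta>)
    (simp_all add: wedge_Nil wedge_Cons[OF assms] int_prod_0[OF assms] wedge_zero_left, simp add: int_prod_def)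

lemma wedge_shuf:
  assumes "is_covector p \<alpha>"
  shows "(\<alpha> \<and>\<^sub>\<Lambda> \<beta>) vs = (\<Sum>(s, a, b)\<leftarrow>shuf p vs. s * \<alpha> a * \<beta> b)"
  using assms
proof (induction p vs arbitrary: \<alpha> \<beta> rule: shuf.induct)
  case (1 vs)
  then show ?case by (simp add: wedge_0)
next
  case (2 p)
  then show ?case by (simp add: wedge_Nil covector_length)
next
  case (3 p v vs)
  have "is_covector p (v \<lrcorner> \<alpha>)" using covector_int_prod[OF 3(3)] by simp
  then show ?case
    using 3(1)[of "v \<lrcorner> \<alpha>" \<beta>] 3(2)[OF 3(3), of "v \<lrcorner> \<beta>"]
    by (simp add: wedge_Cons[OF 3(3)] o_def split_def int_prod_def[of v \<alpha>, abs_def] int_prod_def[of v _ "snd (snd _)"]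
        uminus_sum_list_map mult_ac flip: sum_list_const_mult)
qed

lemma shuf_map: "shuf p (map f vs) = map (\<lambda>(s, a, b). (s, map f a, map f b)) (shuf p vs)"
  by (induction p vs rule: shuf.induct) (auto simp: o_def split_def)

text \<open>Any covector detects the sign stored by \<open>shuf\<close>, which avoids permutation
  signs altogether. The prefix \<open>c\<close> serves the induction, which moves the heads of the
  list into it.\<close>

lemma shuf_sign:
  assumes "is_covector k \<gamma>" "(s, a, b) \<in> set (shuf p K)"
  shows "\<gamma> (c @ a @ b) = s * \<gamma> (c @ K)"
  using assms(2)
proof (induction p K arbitrary: s a b c rule: shuf.induct)
  case (1 vs)
  then show ?case by simp
next
  case (2 p)
  then show ?case by simp
next
  case (3 p v vs)
  from 3(3) consider (l) a' where "a = v # a'" "(s, a', b) \<in> set (shuf p vs)"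
    | (r) s' b' where "s = (-1) ^ Suc p * s'" "b = v # b'" "(s', a, b') \<in> set (shuf (Suc p) vs)"
    by auto
  then show ?case
  proof cases
    case l
    then show ?thesis using 3(1)[OF l(2), of "c @ [v]"] by simp
  next
    case r
    have "length a' = q" if "(s, a', b) \<in> set (shuf q K)" for s a' b q and K :: "(real^7) list"
      using that by (induction q K arbitrary: s a' b rule: shuf.induct) auto
    then have la: "length a = Suc p" using r(3) by blast
    have "\<gamma> (c @ a @ v # b') = (-1) ^ Suc p * \<gamma> (c @ v # a @ b')"
      using covector_move[OF assms(1), of "c @ a" v b'] covector_move[OF assms(1), of "c" v "a @ b'"] la
      by (simp add: power_add mult_ac flip: power_mult_distrib)
    then show ?thesis using 3(2)[OF r(3), of "c @ [v]"] r by simp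
  qed
qed

section \<open>Orthonormal frames and the Hodge star\<close>

lemma sum_lists_Suc:
  assumes "finite X"
  shows "(\<Sum>A\<in>{A. length A = Suc k \<and> set A \<subseteq> X}. f A) =
    (\<Sum>x\<in>X. \<Sum>A\<in>{A. length A = k \<and> set A \<subseteq> X}. f (x # A))"
proof -
  have fin: "finite {A. length A = k \<and> set A \<subseteq> X}"
    using finite_lists_length_eq[OF assms, of k] by (simp add: conj_commute)
  have "{A. length A = Suc k \<and> set A \<subseteq> X} =
      (\<lambda>(x, A). x # A) ` (X \<times> {A. length A = k \<and> set A \<subseteq> X})"
    by (force simp: length_Suc_conv)
  then show ?thesis
    by (simp add: sum.cartesian_product sum.reindex inj_on_def split_def)
qed

lemma bij_betw_of_nat_7: "bij_betw of_nat {..<7} (UNIV :: 7 set)"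
proof -
  have "inj_on (of_nat :: nat \<Rightarrow> 7) {..<7}"
  proof (rule inj_onI)
    fix x y :: nat assume *: "x \<in> {..<7}" "y \<in> {..<7}" "(of_nat x :: 7) = of_nat y"
    have "x = 0 \<or> x = 1 \<or> x = 2 \<or> x = 3 \<or> x = 4 \<or> x = 5 \<or> x = 6"
      "y = 0 \<or> y = 1 \<or> y = 2 \<or> y = 3 \<or> y = 4 \<or> y = 5 \<or> y = 6" using * by auto
    then show "x = y" using *(3) by (elim disjE) simp_all
  qed
  moreover from this have "of_nat ` {..<7} = (UNIV :: 7 set)"
    by (intro card_subset_eq) (auto simp: card_image)
  ultimately show ?thesis by (simp add: bij_betw_def)
qed

lemma sum_UNIV_7: "(\<Sum>i\<in>(UNIV :: 7 set). f i) = (\<Sum>n<7. f (of_nat n))"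
  by (rule sum.reindex_bij_betw[OF bij_betw_of_nat_7, symmetric])

definition std_vec :: "nat \<Rightarrow> real^7" where
  "std_vec n = axis (of_nat n) 1"

lemma std_vec_expand: "v = (\<Sum>n<7. (v $ of_nat n) *\<^sub>R std_vec n)"
  using basis_expansion[of v]
  by (simp add: sum_UNIV_7 std_vec_def scalar_mult_eq_scaleR)

lemma covector_expand:
  assumes "is_covector k \<omega>" "v = (\<Sum>n\<in>I. c n *\<^sub>R E n)"
  shows "\<omega> (us @ v # ws) = (\<Sum>n\<in>I. c n * \<omega> (us @ E n # ws))"
  unfolding assms(2)
  using linear_sum[OF covector_linear[OF assms(1), of us ws], of "\<lambda>n. c n *\<^sub>R E n" I]
  by (simp add: linear_cmul[OF covector_linear[OF assms(1)]])

text \<open>A rearrangement costs both factors the same sign, so signs never have to be computed in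
  products of this kind.\<close>

lemma covector_mult_mset:
  assumes "is_covector k \<alpha>" "is_covector k \<beta>" "mset xs = mset ys"
  shows "\<alpha> xs * \<beta> xs = \<alpha> ys * \<beta> ys"
  using assms
proof (induction xs arbitrary: ys k \<alpha> \<beta>)
  case (Cons x xs)
  then have "x \<in> set ys" by (metis list.set_intros(1) mset_eq_setD)
  then obtain a b where ys: "ys = a @ x # b" by (meson split_list)
  then have "mset xs = mset (a @ b)" using Cons.prems(3) by simp
  from Cons.IH[OF covector_int_prod[OF Cons.prems(1), of x] covector_int_prod[OF Cons.prems(2), of x] this]
  show ?case
    using covector_move[OF Cons.prems(1), of a x b] covector_move[OF Cons.prems(2), of a x b]
    by (simp add: ys int_prod_def mult_ac flip: power_mult_distrib)
qed simp

lemma covector_sorted: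
  assumes "is_covector k \<alpha>" "is_covector k \<beta>" "distinct A"
  shows "\<alpha> (map E A) * \<beta> (map E A) =
    \<alpha> (map E (sorted_list_of_set (set A))) * \<beta> (map E (sorted_list_of_set (set A)))"
proof (rule covector_mult_mset[OF assms(1,2)])
  show "mset (map E A) = mset (map E (sorted_list_of_set (set A)))"
    using assms(3) by (simp add: sorted_list_of_set_sort_remdups distinct_remdups_id)
qed

lemma covector_eq_0:
  assumes "is_covector k \<omega>" and E: "\<And>v. \<exists>c. v = (\<Sum>n\<in>I. c n *\<^sub>R E n)"
    and "\<And>A. length A = k \<Longrightarrow> set A \<subseteq> I \<Longrightarrow> \<omega> (map E A) = 0"
  shows "\<omega> vs = 0"
  using assms(1,3)
proof (induction k arbitrary: \<omega> vs)
  case 0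
  then show ?case using covector_length[OF 0(1), of vs] by (cases "vs = []") auto
next
  case (Suc k)
  show ?case
  proof (cases vs)
    case Nil
    then show ?thesis using covector_length[OF Suc(2)] by simp
  next
    case (Cons v ws)
    obtain c where c: "v = (\<Sum>n\<in>I. c n *\<^sub>R E n)" using E by blast
    have "(E n \<lrcorner> \<omega>) ws = 0" if "n \<in> I" for n
    proof (rule Suc.IH)
      show "is_covector k (E n \<lrcorner> \<omega>)" using covector_int_prod[OF Suc(2), of "E n"] by simp
      show "(E n \<lrcorner> \<omega>) (map E A) = 0" if "length A = k" "set A \<subseteq> I" for A
        using Suc(3)[of "n # A"] that \<open>n \<in> I\<close> by (simp add: int_prod_def)
    qed
    then show ?thesis
      using covector_expand[OF Suc(2) c, of "[]" ws] by (simp add: Cons int_prod_def)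
  qed
qed

lemma covector_eq_0_sorted:
  assumes "is_covector k \<omega>" and "finite I" and E: "\<And>v. \<exists>c. v = (\<Sum>n\<in>I. c n *\<^sub>R E n)"
    and 0: "\<And>T. T \<subseteq> I \<Longrightarrow> card T = k \<Longrightarrow> \<omega> (map E (sorted_list_of_set T)) = 0"
  shows "\<omega> vs = 0"
proof (rule covector_eq_0[OF assms(1) E])
  fix A assume A: "length A = k" "set A \<subseteq> I"
  show "\<omega> (map E A) = 0"
  proof (cases "distinct A")
    case True
    then have "card (set A) = k" using A by (simp add: distinct_card)
    \<comment> \<open>Sorting the list changes the value by a sign, which disappears in the
      square.\<close>
    from 0[OF A(2) this] show ?thesis
      using covector_sorted[OF assms(1,1) True, of E] by simp
  qed (use covector_not_distinct[OF assms(1), of "map E A"] in \<open>simp add: distinct_map\<close>)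
qed

lemma covector_7_eq_0:
  assumes "is_covector 7 \<omega>" and "\<And>v. \<exists>c. v = (\<Sum>n<7. c n *\<^sub>R E n)" and "\<omega> (map E [0..<7]) = 0"
  shows "\<omega> vs = 0"
proof (rule covector_eq_0_sorted[OF assms(1) _ assms(2)])
  fix T :: "nat set" assume "T \<subseteq> {..<7}" "card T = 7"
  then have "T = {..<7}" by (intro card_subset_eq) auto
  moreover have "sorted_list_of_set {..<7::nat} = [0..<7]"
    by (metis atLeast_upt sorted_list_of_set_range atLeast0LessThan)
  ultimately show "\<omega> (map E (sorted_list_of_set T)) = 0" using assms(3) by simp
qed auto

section \<open>Shuffles of an increasing list as subsets of a frame\<close>

lemma shuf_props:
  assumes "(s, a, b) \<in> set (shuf p K)"
  shows "length a = p \<and> mset a + mset b = mset K \<and> s * s = 1 \<and>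
    (sorted_wrt (<) K \<longrightarrow> sorted_wrt (<) a \<and> sorted_wrt (<) b)"
  using assms
proof (induction p K arbitrary: s a b rule: shuf.induct)
  case (3 p v vs)
  from 3(3) consider (l) a' where "a = v # a'" "(s, a', b) \<in> set (shuf p vs)"
    | (r) s' b' where "s = (-1) ^ Suc p * s'" "b = v # b'" "(s', a, b') \<in> set (shuf (Suc p) vs)"
    by auto
  then show ?case
  proof cases
    case l
    from 3(1)[OF l(2)] have IH: "length a' = p" "mset a' + mset b = mset vs" "s * s = 1"
      "sorted_wrt (<) vs \<Longrightarrow> sorted_wrt (<) a'" "sorted_wrt (<) vs \<Longrightarrow> sorted_wrt (<) b" by auto
    from IH(2) have "set a' \<subseteq> set vs" by (metis mset_subset_eq_add_left set_mset_mono set_mset_mset)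
    then show ?thesis using IH l(1) by auto
  next
    case r
    from 3(2)[OF r(3)] have IH: "length a = Suc p" "mset a + mset b' = mset vs" "s' * s' = 1"
      "sorted_wrt (<) vs \<Longrightarrow> sorted_wrt (<) a" "sorted_wrt (<) vs \<Longrightarrow> sorted_wrt (<) b'" by auto
    from IH(2) have "set b' \<subseteq> set vs" by (metis mset_subset_eq_add_right set_mset_mono set_mset_mset)
    moreover have "s * s = 1" using IH(3) r(1)
      by (simp add: mult_ac flip: mult.assoc[of "(-1) ^ p" "(-1) ^ p"] power_mult_distrib)
    ultimately show ?thesis using IH r(2) by auto
  qed
qed auto

text \<open>Bridge between two forms of the same sum: subsets suit the argument about the Hodge
  star, while the list form can be evaluated by rewriting.\<close>

lemma sum_list_shuf:
  fixes K :: "nat list"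
  assumes "sorted_wrt (<) K"
  shows "(\<Sum>(s, a, b)\<leftarrow>shuf p K. F a) = (\<Sum>T | T \<subseteq> set K \<and> card T = p. F (sorted_list_of_set T))"
  using assms
proof (induction p K arbitrary: F rule: shuf.induct)
  case (1 vs)
  have "{T. T \<subseteq> set vs \<and> card T = 0} = {{}}" using finite_subset[of _ "set vs"] by auto
  then show ?case by simp
next
  case (2 p)
  have "{T :: nat set. T \<subseteq> set [] \<and> card T = Suc p} = {}" by auto
  then have "(\<Sum>T | T \<subseteq> set [] \<and> card T = Suc p. F (sorted_list_of_set T)) = 0"
    by (simp only: sum.empty)
  then show ?case by simp
next
  case (3 p v vs)
  let ?P = "\<lambda>q. {T. T \<subseteq> set vs \<and> card T = q}"
  have v: "v \<notin> set vs" "\<forall>x\<in>set vs. v < x" "sorted_wrt (<) vs" using 3(3) by auto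
  have fin: "finite T" "v \<notin> T" if "T \<subseteq> set vs" for T using that v finite_subset by auto
  have eq: "{T. T \<subseteq> set (v # vs) \<and> card T = Suc p} = insert v ` ?P p \<union> ?P (Suc p)"
  proof (intro equalityI subsetI)
    fix T assume T: "T \<in> {T. T \<subseteq> set (v # vs) \<and> card T = Suc p}"
    then have "finite T" using finite_subset[of T "set (v # vs)"] by auto
    show "T \<in> insert v ` ?P p \<union> ?P (Suc p)"
    proof (cases "v \<in> T")
      case True
      then have "T = insert v (T - {v})" "T - {v} \<in> ?P p" using T \<open>finite T\<close> by auto
      then show ?thesis by blast
    qed (use T in auto)
  qed (use fin in auto)
  have inj: "inj_on (insert v) (?P p)"
    using v(1) by (intro inj_onI) (metis (mono_tags, lifting) insert_ident mem_Collect_eq subset_iff)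
  have srt: "sorted_list_of_set (insert v T) = v # sorted_list_of_set T" if "T \<subseteq> set vs" for T
    using that fin[OF that] v(2)
    by (simp add: sorted_list_of_set.sorted_key_list_of_set_insert insort_is_Cons less_imp_le subset_iff)
  have "(\<Sum>T\<in>insert v ` ?P p \<union> ?P (Suc p). F (sorted_list_of_set T)) =
      (\<Sum>T\<in>insert v ` ?P p. F (sorted_list_of_set T)) + (\<Sum>T\<in>?P (Suc p). F (sorted_list_of_set T))"
    using v by (intro sum.union_disjoint) auto
  also have "(\<Sum>T\<in>insert v ` ?P p. F (sorted_list_of_set T)) = (\<Sum>T\<in>?P p. F (v # sorted_list_of_set T))"
    unfolding sum.reindex[OF inj] o_def by (rule sum.cong[OF refl]) (simp add: srt)
  finally show ?case
    using 3(1)[OF v(3), of "\<lambda>a. F (v # a)"] 3(2)[OF v(3), of F]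
    by (simp only: eq) (simp add: o_def split_def)
qed

text \<open>The factor \<open>vol (map E [0..<7])\<close> absorbs the sign of each shuffle: their
  product is \<open>vol\<close> on the reordered frame, and no explicit sign remains.\<close>

lemma wedge_frame:
  fixes E :: "nat \<Rightarrow> real^7"
  assumes \<alpha>: "is_covector p \<alpha>" and vol: "is_covector 7 vol"
  shows "vol (map E [0..<7]) * (\<alpha> \<and>\<^sub>\<Lambda> \<beta>) (map E [0..<7]) =
    (\<Sum>T | T \<subseteq> {..<7} \<and> card T = p.
       vol (map E (sorted_list_of_set T) @ map E (sorted_list_of_set ({..<7} - T))) *
       \<alpha> (map E (sorted_list_of_set T)) * \<beta> (map E (sorted_list_of_set ({..<7} - T))))"
proof -
  let ?K = "[0..<7::nat]"
  have K: "sorted_wrt (<) ?K" "set ?K = {..<7}" by auto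
  have b: "b = sorted_list_of_set ({..<7} - set a)" if "(s, a, b) \<in> set (shuf p ?K)" for s a b
  proof -
    note pr = shuf_props[OF that]
    have ab: "mset a + mset b = mset ?K" "sorted_wrt (<) b" using pr K(1) by auto
    have "distinct (a @ b)" using ab(1) by (metis distinct_upt mset_append mset_eq_imp_distinct_iff)
    moreover have "set a \<union> set b = {..<7}" using ab(1) by (metis K(2) set_append set_mset_mset mset_append)
    ultimately have "set b = {..<7} - set a" by auto
    then show ?thesis using ab(2)
      by (metis List.finite_set sorted_list_of_set_unique strict_sorted_iff distinct_card)
  qed
  have a: "a = sorted_list_of_set (set a)" if "(s, a, b) \<in> set (shuf p ?K)" for s a b
    using shuf_props[OF that] K(1)
    by (metis List.finite_set sorted_list_of_set_unique strict_sorted_iff distinct_card)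
  have "vol (map E ?K) * (\<alpha> \<and>\<^sub>\<Lambda> \<beta>) (map E ?K) =
      (\<Sum>(s, a, b)\<leftarrow>shuf p ?K. s * vol (map E ?K) * \<alpha> (map E a) * \<beta> (map E b))"
    by (simp add: wedge_shuf[OF \<alpha>] shuf_map o_def split_def mult_ac flip: sum_list_const_mult)
  also have "\<dots> = (\<Sum>(s, a, b)\<leftarrow>shuf p ?K.
      vol (map E a @ map E (sorted_list_of_set ({..<7} - set a))) * \<alpha> (map E a) *
      \<beta> (map E (sorted_list_of_set ({..<7} - set a))))"
  proof (intro arg_cong[where f = sum_list] map_cong refl, clarify)
    fix s a b assume *: "(s, a, b) \<in> set (shuf p ?K)"
    then have "(s, map E a, map E b) \<in> set (shuf p (map E ?K))"
      by (force simp: shuf_map)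
    from shuf_sign[OF vol this, of "[]"] show "s * vol (map E ?K) * \<alpha> (map E a) * \<beta> (map E b) =
      vol (map E a @ map E (sorted_list_of_set ({..<7} - set a))) * \<alpha> (map E a) *
      \<beta> (map E (sorted_list_of_set ({..<7} - set a)))"
      using b[OF *] by simp
  qed
  also have "\<dots> = (\<Sum>T | T \<subseteq> {..<7} \<and> card T = p.
       vol (map E (sorted_list_of_set T) @ map E (sorted_list_of_set ({..<7} - T))) *
       \<alpha> (map E (sorted_list_of_set T)) * \<beta> (map E (sorted_list_of_set ({..<7} - T))))"
    by (subst sum_list_shuf[OF K(1)])
      (auto intro!: sum.cong simp: K(2) finite_subset[of _ "{..<7}"])
  finally show ?thesis .
qed

lemma vol_complement:
  fixes E :: "nat \<Rightarrow> real^7"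
  assumes vol: "is_covector 7 vol" and "T \<subseteq> {..<7}"
  shows "(vol (map E (sorted_list_of_set T) @ map E (sorted_list_of_set ({..<7} - T))))\<^sup>2 =
    (vol (map E [0..<7]))\<^sup>2"
proof -
  have "finite T" using assms(2) finite_subset by blast
  have "mset (sorted_list_of_set T @ sorted_list_of_set ({..<7} - T)) = mset [0..<7]"
    using assms(2) \<open>finite T\<close>
    by (subst set_eq_iff_mset_eq_distinct[symmetric]) (auto simp: atLeast0LessThan)
  then have "mset (map E (sorted_list_of_set T) @ map E (sorted_list_of_set ({..<7} - T))) = mset (map E [0..<7])"
    by (metis map_append mset_map)
  from covector_mult_mset[OF vol vol this] show ?thesis by (simp add: power2_eq_square)
qed

lemma matrix_inv_eq:
  fixes A B :: "'a::semiring_1^'n^'n"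
  assumes "A ** B = mat 1" "B ** A = mat 1"
  shows "matrix_inv A = B"
  unfolding matrix_inv_def
proof (rule some_equality)
  fix C assume "A ** C = mat 1 \<and> C ** A = mat 1"
  then show "C = B" using assms(1) by (metis matrix_mul_assoc matrix_mul_lid matrix_mul_rid)
qed (use assms in simp)

section \<open>Metrics with an orthonormal frame\<close>

locale metric_frame =
  fixes g :: metric and E :: "nat \<Rightarrow> real^7"
  assumes bilinear_g: "bilinear g"
    and orthonormal: "\<And>i j. i < 7 \<Longrightarrow> j < 7 \<Longrightarrow> g (E i) (E j) = (if i = j then 1 else 0)"
begin

definition idx :: "7 \<Rightarrow> nat" where "idx = inv_into {..<7} of_nat"

lemma idx_less: "idx i < 7" and of_nat_idx: "of_nat (idx i) = i"
  and idx_of_nat: "n < 7 \<Longrightarrow> idx (of_nat n) = n"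
  using bij_betw_of_nat_7 inv_into_into[of i of_nat "{..<7}"] f_inv_into_f[of i of_nat "{..<7}"]
    inv_into_f_f[of of_nat "{..<7}" n]
  by (auto simp: idx_def bij_betw_def)

lemma idx_eq: "idx i = idx j \<longleftrightarrow> i = j"
  by (metis of_nat_idx)

lemma g_expand: "g v w = (\<Sum>i\<in>UNIV. \<Sum>j\<in>UNIV. v $ i * (w $ j * g (axis i 1) (axis j 1)))"
proof -
  have "g v w = g (\<Sum>i\<in>UNIV. v $ i *\<^sub>R axis i 1) (\<Sum>j\<in>UNIV. w $ j *\<^sub>R axis j 1)"
    using basis_expansion[of v] basis_expansion[of w] by (simp add: scalar_mult_eq_scaleR)
  also have "\<dots> = (\<Sum>i\<in>UNIV. \<Sum>j\<in>UNIV. v $ i * (w $ j * g (axis i 1) (axis j 1)))"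
    by (simp add: bilinear_sum[OF bilinear_g] sum.cartesian_product bilinear_lmul[OF bilinear_g]
        bilinear_rmul[OF bilinear_g] split_def mult_ac)
  finally show ?thesis .
qed

abbreviation "G \<equiv> (\<chi> i j. g (axis i 1) (axis j 1)) :: real^7^7"
abbreviation "P \<equiv> (\<chi> i a. E (idx a) $ i) :: real^7^7"

text \<open>Orthonormality of the columns of \<open>P\<close> says that
  \<open>transpose P ** G ** P\<close> is the identity. For square matrices a left inverse is a
  right inverse, so \<open>P\<close> may be moved to the front; hence the inverse of
  \<open>G\<close> is \<open>P ** transpose P\<close>.\<close>

lemma PPG: "(P ** transpose P) ** G = mat 1"
proof -
  have "(transpose P ** G) ** P = mat 1"
  proof (simp only: vec_eq_iff, intro allI)
    fix a b
    have "((transpose P ** G) ** P) $ a $ b = g (E (idx a)) (E (idx b))"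
      unfolding g_expand[of "E (idx a)" "E (idx b)"]
      by (subst sum.swap) (simp add: matrix_matrix_mult_def transpose_def sum_distrib_left sum_distrib_right mult_ac)
    then show "((transpose P ** G) ** P) $ a $ b = mat 1 $ a $ b"
      by (simp add: orthonormal idx_less idx_eq mat_def)
  qed
  then have "P ** (transpose P ** G) = mat 1" by (rule matrix_left_right_inverse[THEN iffD1])
  then show ?thesis by (simp add: matrix_mul_assoc)
qed

lemma inverse_metric_mat: "inverse_metric g = P ** transpose P"
  unfolding inverse_metric_def
  using PPG matrix_left_right_inverse[of "P ** transpose P" G] by (intro matrix_inv_eq) auto

lemma inverse_metric_eq: "inverse_metric g $ i $ j = (\<Sum>n<7. E n $ i * E n $ j)"
  by (simp add: inverse_metric_mat matrix_matrix_mult_def transpose_def sum_UNIV_7 idx_of_nat)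

lemma frame_spans: "\<exists>c. v = (\<Sum>n<7. c n *\<^sub>R E n)"
proof
  let ?w = "(transpose P ** G) *v v"
  have "v = ((P ** transpose P) ** G) *v v" by (simp only: PPG matrix_vector_mul_lid)
  then have "v = P *v ?w" by (simp only: matrix_vector_mul_assoc matrix_mul_assoc)
  also have "\<dots> = (\<Sum>n<7. (?w $ of_nat n) *\<^sub>R E n)"
    unfolding vec_eq_iff matrix_vector_mult_def[of P] by (simp add: sum_UNIV_7 idx_of_nat mult.commute)
  finally show "v = (\<Sum>n<7. (?w $ of_nat n) *\<^sub>R E n)" .
qed

lemma expand: "v = (\<Sum>n<7. g v (E n) *\<^sub>R E n)"
proof -
  obtain c where c: "v = (\<Sum>n<7. c n *\<^sub>R E n)" using frame_spans by blast
  have "g v (E m) = c m" if "m < 7" for m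
    using that bilinear_g unfolding c
    by (simp add: bilinear_def linear_sum[of "\<lambda>x. g x (E m)"] linear_cmul[of "\<lambda>x. g x (E m)"]
        orthonormal if_distrib cong: if_cong)
  then show ?thesis using c by simp
qed

abbreviation "LL k \<equiv> {A :: nat list. length A = k \<and> set A \<subseteq> {..<7}}"

text \<open>Induction on the degree, contracting the first slot: the inverse metric is the sum of
  the products \<open>E n $ i * E n $ j\<close>, which turns the coordinate contraction into a frame
  contraction.\<close>

lemma inner_lists:
  assumes "is_covector k \<alpha>" "is_covector k \<beta>"
  shows "covector_inner g k \<alpha> \<beta> = (\<Sum>A\<in>LL k. \<alpha> (map E A) * \<beta> (map E A)) / fact k"
proof -
  let ?M = "inverse_metric g"
  have "(\<Sum>I\<in>{I :: 7 list. length I = k}. \<Sum>J\<in>{J :: 7 list. length J = k}.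
        (\<Prod>l<k. ?M $ (I ! l) $ (J ! l)) * \<alpha> (map (\<lambda>i. axis i 1) I) * \<beta> (map (\<lambda>j. axis j 1) J)) =
     (\<Sum>A\<in>LL k. \<alpha> (map E A) * \<beta> (map E A))"
    using assms
  proof (induction k arbitrary: \<alpha> \<beta>)
    case 0
    have "LL 0 = {[]}" by auto
    then show ?case by simp
  next
    case (Suc k)
    let ?S = "{I :: 7 list. length I = k}"
    let ?F = "\<lambda>\<alpha> \<beta>. \<Sum>A\<in>LL k. \<alpha> (map E A) * \<beta> (map E A)"
    note ls7 = sum_lists_Suc[of "UNIV :: 7 set", simplified]
    have "(\<Sum>I\<in>{I :: 7 list. length I = Suc k}. \<Sum>J\<in>{J :: 7 list. length J = Suc k}.
        (\<Prod>l<Suc k. ?M $ (I ! l) $ (J ! l)) * \<alpha> (map (\<lambda>i. axis i 1) I) * \<beta> (map (\<lambda>j. axis j 1) J)) =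
      (\<Sum>i\<in>UNIV. \<Sum>I\<in>?S. \<Sum>j\<in>UNIV. \<Sum>J\<in>?S. ?M $ i $ j * ((\<Prod>l<k. ?M $ (I ! l) $ (J ! l)) *
         (axis i 1 \<lrcorner> \<alpha>) (map (\<lambda>i. axis i 1) I) * (axis j 1 \<lrcorner> \<beta>) (map (\<lambda>j. axis j 1) J)))"
      unfolding ls7 prod.lessThan_Suc_shift by (simp add: int_prod_def mult_ac)
    also have "\<dots> = (\<Sum>i\<in>UNIV. \<Sum>j\<in>UNIV. ?M $ i $ j * (\<Sum>I\<in>?S. \<Sum>J\<in>?S. (\<Prod>l<k. ?M $ (I ! l) $ (J ! l)) *
         (axis i 1 \<lrcorner> \<alpha>) (map (\<lambda>i. axis i 1) I) * (axis j 1 \<lrcorner> \<beta>) (map (\<lambda>j. axis j 1) J)))"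
      by (subst sum.swap) (simp add: sum_distrib_left)
    also have "\<dots> = (\<Sum>i\<in>UNIV. \<Sum>j\<in>UNIV. ?M $ i $ j * ?F (axis i 1 \<lrcorner> \<alpha>) (axis j 1 \<lrcorner> \<beta>))"
      using covector_int_prod[OF Suc.prems(1)] covector_int_prod[OF Suc.prems(2)]
      by (subst Suc.IH) simp_all
    also have "\<dots> = (\<Sum>n<7. ?F (E n \<lrcorner> \<alpha>) (E n \<lrcorner> \<beta>))"
    proof -
      have e: "(E n \<lrcorner> \<gamma>) vs = (\<Sum>i\<in>UNIV. E n $ i * (axis i 1 \<lrcorner> \<gamma>) vs)" if "is_covector (Suc k) \<gamma>" for n \<gamma> vs
        using covector_expand[OF that, of "E n" "\<lambda>i. E n $ i" "\<lambda>i. axis i 1" UNIV "[]" vs]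
          basis_expansion[of "E n"] by (simp add: int_prod_def scalar_mult_eq_scaleR)
      have "(\<Sum>n<7. ?F (E n \<lrcorner> \<alpha>) (E n \<lrcorner> \<beta>)) =
         (\<Sum>n<7. \<Sum>A\<in>LL k. \<Sum>i\<in>UNIV. \<Sum>j\<in>UNIV. E n $ i * E n $ j * ((axis i 1 \<lrcorner> \<alpha>) (map E A) * (axis j 1 \<lrcorner> \<beta>) (map E A)))"
        by (simp add: e[OF Suc.prems(1)] e[OF Suc.prems(2)] sum_product mult_ac)
      also have "\<dots> = (\<Sum>i\<in>UNIV. \<Sum>j\<in>UNIV. \<Sum>n<7. \<Sum>A\<in>LL k. E n $ i * E n $ j * ((axis i 1 \<lrcorner> \<alpha>) (map E A) * (axis j 1 \<lrcorner> \<beta>) (map E A)))"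
        by (subst (2) sum.swap, subst sum.swap, subst (3) sum.swap, subst (2) sum.swap) simp
      finally show ?thesis
        by (simp add: inverse_metric_eq sum_distrib_right flip: sum_distrib_left)
    qed
    also have "\<dots> = (\<Sum>A\<in>LL (Suc k). \<alpha> (map E A) * \<beta> (map E A))"
      by (subst sum_lists_Suc) (simp_all add: int_prod_def)
    finally show ?case .
  qed
  then show ?thesis by (simp add: covector_inner_def)
qed

text \<open>Lists with repetitions contribute zero and the orderings of a given subset all
  contribute equally, so their number cancels the division by \<open>fact k\<close>.\<close>

lemma inner_frame:
  assumes "is_covector k \<alpha>" "is_covector k \<beta>"
  shows "covector_inner g k \<alpha> \<beta> = (\<Sum>T | T \<subseteq> {..<7} \<and> card T = k.
    \<alpha> (map E (sorted_list_of_set T)) * \<beta> (map E (sorted_list_of_set T)))"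
proof -
  let ?f = "\<lambda>A. \<alpha> (map E A) * \<beta> (map E A)"
  let ?T = "{T. T \<subseteq> {..<7} \<and> card T = k}"
  have fin: "finite T" if "T \<in> ?T" for T :: "nat set" using that finite_subset[of T "{..<7::nat}"] by auto
  have "(\<Sum>A\<in>LL k. ?f A) = (\<Sum>A\<in>(\<Union>T\<in>?T. permutations_of_set T). ?f A)"
  proof (rule sum.mono_neutral_right)
    show "finite (LL k)" using finite_lists_length_eq[of "{..<7::nat}" k] by (simp add: conj_commute)
    show "(\<Union>T\<in>?T. permutations_of_set T) \<subseteq> LL k"
      by (auto simp: permutations_of_set_def distinct_card)
    show "\<forall>A\<in>LL k - (\<Union>T\<in>?T. permutations_of_set T). ?f A = 0"
    proof
      fix A assume A: "A \<in> LL k - (\<Union>T\<in>?T. permutations_of_set T)"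
      then have "\<not> distinct A" by (auto simp: permutations_of_set_def distinct_card)
      then show "?f A = 0" using covector_not_distinct[OF assms(1), of "map E A"] by (simp add: distinct_map)
    qed
  qed
  also have "\<dots> = (\<Sum>T\<in>?T. \<Sum>A\<in>permutations_of_set T. ?f A)"
  proof (rule sum.UNION_disjoint)
    show "\<forall>T\<in>?T. \<forall>U\<in>?T. T \<noteq> U \<longrightarrow> permutations_of_set T \<inter> permutations_of_set U = {}"
      by (auto simp: permutations_of_set_def)
  qed simp_all
  also have "\<dots> = (\<Sum>T\<in>?T. \<Sum>A\<in>permutations_of_set T. ?f (sorted_list_of_set T))"
  proof (intro sum.cong refl)
    fix T :: "nat set" and A assume "A \<in> permutations_of_set T"
    then show "?f A = ?f (sorted_list_of_set T)"
      using covector_sorted[OF assms, of A E] by (auto simp: permutations_of_set_def)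
  qed
  also have "\<dots> = fact k * (\<Sum>T\<in>?T. ?f (sorted_list_of_set T))"
    unfolding sum_distrib_left
  proof (rule sum.cong[OF refl])
    fix T :: "nat set" assume "T \<in> ?T"
    then have "card (permutations_of_set T) = fact k" using fin[of T] by simp
    then show "(\<Sum>A\<in>permutations_of_set T. ?f (sorted_list_of_set T)) = fact k * ?f (sorted_list_of_set T)"
      by (simp only: sum_constant of_nat_fact)
  qed
  finally show ?thesis by (simp add: inner_lists[OF assms])
qed

lemma inner_7:
  assumes "is_covector 7 \<alpha>" "is_covector 7 \<beta>"
  shows "covector_inner g 7 \<alpha> \<beta> = \<alpha> (map E [0..<7]) * \<beta> (map E [0..<7])"
proof -
  have "{T. T \<subseteq> {..<7::nat} \<and> card T = 7} = {{..<7}}"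
    using card_subset_eq[of "{..<7::nat}"] by auto
  moreover have "sorted_list_of_set {..<7::nat} = [0..<7]"
    by (metis sorted_list_of_set_range atLeast0LessThan)
  ultimately show ?thesis by (simp only: inner_frame[OF assms]) simp
qed

lemma covector_append:
  assumes "is_covector k \<omega>" "length us \<le> k"
  shows "is_covector (k - length us) (\<lambda>ws. \<omega> (us @ ws))"
  using assms(2) covector_length[OF assms(1)] covector_not_distinct[OF assms(1)] covector_linear[OF assms(1), of "us @ _"]
  by (intro is_covectorI) auto

lemma covector_append_left:
  assumes "is_covector k \<omega>" "length us \<le> k"
  shows "is_covector (k - length us) (\<lambda>ws. \<omega> (ws @ us))"
  using assms(2) covector_length[OF assms(1)] covector_not_distinct[OF assms(1)] covector_linear[OF assms(1), of _ "_ @ us"]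
  by (intro is_covectorI) auto

lemma inner_nonneg: "is_covector k \<alpha> \<Longrightarrow> covector_inner g k \<alpha> \<alpha> \<ge> 0"
  by (simp add: inner_frame sum_nonneg)

lemma inner_eq_0:
  assumes "is_covector k \<alpha>" "covector_inner g k \<alpha> \<alpha> = 0"
  shows "\<alpha> vs = 0"
proof (rule covector_eq_0_sorted[OF assms(1) _ frame_spans])
  fix T :: "nat set" assume "T \<subseteq> {..<7}" "card T = k"
  then show "\<alpha> (map E (sorted_list_of_set T)) = 0"
    using assms(2) sum_nonneg_0[of "{T. T \<subseteq> {..<7} \<and> card T = k}"
        "\<lambda>T. \<alpha> (map E (sorted_list_of_set T)) * \<alpha> (map E (sorted_list_of_set T))" T]
    by (simp add: inner_frame[OF assms(1,1)])
qed auto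

text \<open>The explicit witness for the description in \<open>hodge\<close>: the metric pairing of
  \<open>\<beta>\<close> with the first \<open>k\<close> slots of \<open>vol\<close>.\<close>

definition hodge_ex :: "covector \<Rightarrow> nat \<Rightarrow> covector \<Rightarrow> covector" where
  "hodge_ex vol k \<beta> ws = (\<Sum>T | T \<subseteq> {..<7} \<and> card T = k.
     \<beta> (map E (sorted_list_of_set T)) * vol (map E (sorted_list_of_set T) @ ws))"

lemma hodge_ex_covector:
  assumes "is_covector 7 vol" "k \<le> 7"
  shows "is_covector (7 - k) (hodge_ex vol k \<beta>)"
  unfolding hodge_ex_def[abs_def]
proof (rule covector_sum)
  fix T :: "nat set" assume "T \<in> {T. T \<subseteq> {..<7} \<and> card T = k}"
  then show "is_covector (7 - k) (\<lambda>ws. \<beta> (map E (sorted_list_of_set T)) * vol (map E (sorted_list_of_set T) @ ws))"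
    using covector_append[OF assms(1), of "map E (sorted_list_of_set T)"] assms(2)
    by (intro covector_scale) auto
qed

lemma hodge_ex_wedge:
  assumes \<alpha>: "is_covector k \<alpha>" and \<beta>: "is_covector k \<beta>" and vol: "is_covector 7 vol"
    and k: "k \<le> 7" and v: "vol (map E [0..<7]) \<noteq> 0"
  shows "(\<alpha> \<and>\<^sub>\<Lambda> hodge_ex vol k \<beta>) vs = covector_inner g k \<alpha> \<beta> * vol vs"
proof -
  let ?e = "\<lambda>T. map E (sorted_list_of_set T)"
  let ?v = "vol (map E [0..<7])"
  \<comment> \<open>On the complement of \<open>T\<close> only the summand of \<open>T\<close>
    survives: any other subset of the same size meets the complement, so \<open>vol\<close> receives
    a repeated vector.\<close>
  have h: "hodge_ex vol k \<beta> (?e ({..<7} - T)) = \<beta> (?e T) * vol (?e T @ ?e ({..<7} - T))"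
    if T: "T \<subseteq> {..<7}" "card T = k" for T
  proof -
    have "vol (?e U @ ?e ({..<7} - T)) = 0" if U: "U \<subseteq> {..<7}" "card U = k" "U \<noteq> T" for U
    proof (rule covector_not_distinct[OF vol])
      have fin: "finite U" "finite T" using T U finite_subset[of _ "{..<7::nat}"] by auto
      have "\<not> U \<subseteq> T" using card_subset_eq[OF fin(2), of U] T U by auto
      then obtain x where "x \<in> U" "x \<in> {..<7} - T" using U by auto
      then show "\<not> distinct (?e U @ ?e ({..<7} - T))" using fin by auto
    qed
    then have "hodge_ex vol k \<beta> (?e ({..<7} - T)) =
       (\<Sum>U\<in>{T}. \<beta> (?e U) * vol (?e U @ ?e ({..<7} - T)))"
      unfolding hodge_ex_def using T by (intro sum.mono_neutral_right) auto
    then show ?thesis by simp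
  qed
  have "?v * (\<alpha> \<and>\<^sub>\<Lambda> hodge_ex vol k \<beta>) (map E [0..<7]) =
     (\<Sum>T | T \<subseteq> {..<7} \<and> card T = k. ?v\<^sup>2 * (\<alpha> (?e T) * \<beta> (?e T)))"
    unfolding wedge_frame[OF \<alpha> vol]
    by (intro sum.cong refl) (auto simp: h power2_eq_square vol_complement[OF vol, of _ E, unfolded power2_eq_square])
  also have "\<dots> = ?v * (covector_inner g k \<alpha> \<beta> * ?v)"
    by (simp add: inner_frame[OF \<alpha> \<beta>] power2_eq_square sum_distrib_left mult_ac)
  finally have *: "(\<alpha> \<and>\<^sub>\<Lambda> hodge_ex vol k \<beta>) (map E [0..<7]) = covector_inner g k \<alpha> \<beta> * ?v"
    using v by simp
  have "is_covector 7 (\<alpha> \<and>\<^sub>\<Lambda> hodge_ex vol k \<beta>)"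
    using covector_wedge[OF \<alpha> hodge_ex_covector[OF vol k, of \<beta>]] k by simp
  from covector_7_eq_0[OF covector_diff[OF this covector_scale[OF vol]] frame_spans,
      of "covector_inner g k \<alpha> \<beta>" vs]
  show ?thesis using * by simp
qed

lemma wedge_nondegenerate:
  assumes \<delta>: "is_covector (7 - k) \<delta>" and vol: "is_covector 7 vol" and k: "k \<le> 7"
    and v: "vol (map E [0..<7]) \<noteq> 0" and 0: "\<And>\<alpha>. is_covector k \<alpha> \<Longrightarrow> (\<alpha> \<and>\<^sub>\<Lambda> \<delta>) (map E [0..<7]) = 0"
  shows "\<delta> vs = 0"
proof (rule covector_eq_0_sorted[OF \<delta> _ frame_spans])
  fix U :: "nat set" assume U: "U \<subseteq> {..<7}" "card U = 7 - k"
  let ?e = "\<lambda>T. map E (sorted_list_of_set T)"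
  let ?T = "{..<7} - U"
  have fin: "finite U" using U finite_subset by blast
  have T: "?T \<subseteq> {..<7}" "card ?T = k" "{..<7} - ?T = U" using U k by (auto simp: card_Diff_subset fin)
  \<comment> \<open>Test covector dual to \<open>U\<close>: among frame lists of length
    \<open>k\<close> it sees only the complement of \<open>U\<close>, so it isolates the coefficient
    of \<delta> on \<open>U\<close>.\<close>
  define \<alpha> where "\<alpha> = (\<lambda>ws. vol (ws @ ?e U))"
  have \<alpha>: "is_covector k \<alpha>"
    unfolding \<alpha>_def using covector_append_left[OF vol, of "?e U"] U k by simp
  have "\<alpha> (?e S) = 0" if S: "S \<subseteq> {..<7}" "card S = k" "S \<noteq> ?T" for S
    unfolding \<alpha>_def
  proof (rule covector_not_distinct[OF vol])
    have "finite S" using S finite_subset by blast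
    have "\<not> S \<subseteq> ?T" using card_subset_eq[of ?T S] S T by auto
    then obtain x where "x \<in> S" "x \<in> U" using S by auto
    then show "\<not> distinct (?e S @ ?e U)" using fin \<open>finite S\<close> by auto
  qed
  then have "vol (map E [0..<7]) * (\<alpha> \<and>\<^sub>\<Lambda> \<delta>) (map E [0..<7]) =
     (\<Sum>T\<in>{?T}. vol (?e T @ ?e ({..<7} - T)) * \<alpha> (?e T) * \<delta> (?e ({..<7} - T)))"
    unfolding wedge_frame[OF \<alpha> vol] using T by (intro sum.mono_neutral_right) auto
  then have "0 = (vol (?e ?T @ ?e U))\<^sup>2 * \<delta> (?e U)"
    using 0[OF \<alpha>] by (simp only: T(3)) (simp add: \<alpha>_def power2_eq_square T(3))
  moreover have "(vol (?e ?T @ ?e U))\<^sup>2 \<noteq> 0"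
    using v vol_complement[OF vol T(1), of E] by (simp only: T(3)) simp
  ultimately show "\<delta> (?e U) = 0" by (metis mult_eq_0_iff)
qed auto

lemma hodge_eq_ex:
  assumes \<beta>: "is_covector k \<beta>" and vol: "is_covector 7 vol"
    and k: "k \<le> 7" and v: "vol (map E [0..<7]) \<noteq> 0"
  shows "hodge g vol k \<beta> = hodge_ex vol k \<beta>"
  unfolding hodge_def
proof (rule the_equality, intro conjI allI impI ext)
  show "is_covector (7 - k) (hodge_ex vol k \<beta>)" by (rule hodge_ex_covector[OF vol k])
  show "(\<alpha> \<and>\<^sub>\<Lambda> hodge_ex vol k \<beta>) vs = covector_inner g k \<alpha> \<beta> * vol vs" if "is_covector k \<alpha>" for \<alpha> vs
    by (rule hodge_ex_wedge[OF that \<beta> vol k v])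
  fix \<gamma> assume \<gamma>: "is_covector (7 - k) \<gamma> \<and>
     (\<forall>\<alpha>. is_covector k \<alpha> \<longrightarrow> \<alpha> \<and>\<^sub>\<Lambda> \<gamma> = (\<lambda>vs. covector_inner g k \<alpha> \<beta> * vol vs))"
  have "\<gamma> vs - hodge_ex vol k \<beta> vs = 0" for vs
    by (rule wedge_nondegenerate[OF covector_diff vol k v])
      (use \<gamma> hodge_ex_covector[OF vol k] hodge_ex_wedge[OF _ \<beta> vol k v] in \<open>auto simp: wedge_diff_right\<close>)
  then show "\<gamma> = hodge_ex vol k \<beta>" by (auto simp: fun_eq_iff)
qed

lemma hodge_covector:
  assumes "is_covector k \<beta>" "is_covector 7 vol" "k \<le> 7" "vol (map E [0..<7]) \<noteq> 0"
  shows "is_covector (7 - k) (hodge g vol k \<beta>)"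
  using hodge_ex_covector[OF assms(2,3)] hodge_eq_ex[OF assms] by simp

lemma wedge_hodge:
  assumes "is_covector k \<alpha>" "is_covector k \<beta>" "is_covector 7 vol" "k \<le> 7" "vol (map E [0..<7]) \<noteq> 0"
  shows "(\<alpha> \<and>\<^sub>\<Lambda> hodge g vol k \<beta>) vs = covector_inner g k \<alpha> \<beta> * vol vs"
  using hodge_ex_wedge[OF assms] hodge_eq_ex[OF assms(2-)] by simp

text \<open>A frame-free formula for the star. Its dependence on the point goes only through the
  inverse metric, \<open>vol\<close> and the form, which is what makes it differentiable in
  coordinates.\<close>

lemma hodge_inner:
  assumes "is_covector k \<beta>" "is_covector 7 vol" "k \<le> 7" "vol (map E [0..<7]) \<noteq> 0"
  shows "hodge g vol k \<beta> ws = covector_inner g k \<beta> (\<lambda>as. vol (as @ ws))"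
proof (cases "length ws = 7 - k")
  case True
  then have "is_covector k (\<lambda>as. vol (as @ ws))"
    using covector_append_left[OF assms(2), of ws] assms(3) by simp
  then show ?thesis
    by (simp add: hodge_eq_ex[OF assms] hodge_ex_def inner_frame[OF assms(1)])
next
  case False
  then have *: "vol (as @ ws) = 0" if "length as = k" for as
    using that assms(3) by (intro covector_length[OF assms(2)]) auto
  then have "covector_inner g k \<beta> (\<lambda>as. vol (as @ ws)) = 0"
    by (simp add: covector_inner_def)
  then show ?thesis using covector_length[OF hodge_covector[OF assms] False] by simp
qed

text \<open>The star in a form that can be tabulated: complements and signs are read off from
  \<open>shuf\<close>.\<close>

lemma hodge_shuf:
  assumes \<beta>: "is_covector k \<beta>" and vol: "is_covector 7 vol"
    and k: "k \<le> 7" and v: "vol (map E [0..<7]) \<noteq> 0"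
    and sh: "(s, a, b) \<in> set (shuf k [0..<7])"
  shows "hodge g vol k \<beta> (map E b) = s * \<beta> (map E a) * vol (map E [0..<7])"
proof -
  let ?e = "\<lambda>T. map E (sorted_list_of_set T)"
  note pr = shuf_props[OF sh]
  have K: "sorted_wrt (<) [0..<7::nat]" by simp
  have a: "a = sorted_list_of_set (set a)"
    using pr K by (metis List.finite_set sorted_list_of_set_unique strict_sorted_iff distinct_card)
  have ab: "mset a + mset b = mset [0..<7]" "length a = k" using pr by auto
  have "distinct (a @ b)" using ab(1) by (metis distinct_upt mset_append mset_eq_imp_distinct_iff)
  have "set a \<union> set b = {..<7}" using ab(1)
    by (metis atLeast_upt set_append set_mset_mset mset_append)
  have z: "vol (?e U @ map E b) = 0" if U: "U \<subseteq> {..<7}" "card U = k" "U \<noteq> set a" for U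
  proof (rule covector_not_distinct[OF vol])
    have fin: "finite U" using U finite_subset by blast
    have "\<not> U \<subseteq> set a" using card_subset_eq[of "set a" U] U ab(2) \<open>distinct (a @ b)\<close>
      by (auto simp: distinct_card)
    then obtain x where "x \<in> U" "x \<in> set b" using U \<open>set a \<union> set b = {..<7}\<close> by auto
    then show "\<not> distinct (?e U @ map E b)" using fin by auto
  qed
  have "hodge g vol k \<beta> (map E b) = (\<Sum>U\<in>{set a}. \<beta> (?e U) * vol (?e U @ map E b))"
    unfolding hodge_eq_ex[OF \<beta> vol k v] hodge_ex_def
    using z \<open>set a \<union> set b = {..<7}\<close> ab(2) \<open>distinct (a @ b)\<close>
    by (intro sum.mono_neutral_right) (auto simp: distinct_card)
  moreover have "(s, map E a, map E b) \<in> set (shuf k (map E [0..<7]))"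
    using sh by (force simp: shuf_map)
  ultimately show ?thesis using shuf_sign[OF vol, of s "map E a" "map E b" k "map E [0..<7]" "[]"] a
    by simp
qed

lemma inner_shuf:
  assumes "is_covector k \<alpha>" "is_covector k \<beta>"
  shows "covector_inner g k \<alpha> \<beta> = (\<Sum>(s, a, b)\<leftarrow>shuf k [0..<7]. \<alpha> (map E a) * \<beta> (map E a))"
  using inner_frame[OF assms]
  by (subst sum_list_shuf[where F = "\<lambda>a. \<alpha> (map E a) * \<beta> (map E a)"]) (auto simp: atLeast0LessThan)

lemma covector_eq_0_shuf:
  assumes "is_covector k \<omega>" and "\<forall>(s, a, b)\<in>set (shuf k [0..<7]). \<omega> (map E a) = 0"
  shows "\<omega> vs = 0"
proof (rule covector_eq_0_sorted[OF assms(1) _ frame_spans])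
  fix T :: "nat set" assume T: "T \<subseteq> {..<7}" "card T = k"
  \<comment> \<open>\<open>sum_list_shuf\<close> compares sums only, so the pointwise statement is
    recovered from a vanishing sum of absolute values.\<close>
  have "(\<Sum>T | T \<subseteq> set [0..<7] \<and> card T = k. \<bar>\<omega> (map E (sorted_list_of_set T))\<bar>) =
      (\<Sum>(s, a, b)\<leftarrow>shuf k [0..<7]. \<bar>\<omega> (map E a)\<bar>)"
    by (rule sum_list_shuf[where F = "\<lambda>a. \<bar>\<omega> (map E a)\<bar>", symmetric]) simp
  also have "\<dots> = (\<Sum>x\<leftarrow>shuf k [0..<7::nat]. 0)"
    using assms(2) by (intro arg_cong[where f = sum_list] map_cong) auto
  finally have "(\<Sum>T | T \<subseteq> {..<7} \<and> card T = k. \<bar>\<omega> (map E (sorted_list_of_set T))\<bar>) = 0"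
    by (simp add: atLeast0LessThan)
  then show "\<omega> (map E (sorted_list_of_set T)) = 0"
    using T by (subst (asm) sum_nonneg_eq_0_iff) auto
qed auto

lemma contract_frame:
  assumes "is_covector 1 \<alpha>" "is_covector k \<omega>"
  shows "contract g \<alpha> \<omega> vs = (\<Sum>n<7. \<alpha> [E n] * \<omega> (E n # vs))"
proof -
  have e: "\<gamma> (E n # vs) = (\<Sum>i\<in>UNIV. E n $ i * \<gamma> (axis i 1 # vs))" if "is_covector q \<gamma>" for n \<gamma> q vs
    using covector_expand[OF that, of "E n" "\<lambda>i. E n $ i" "\<lambda>i. axis i 1" UNIV "[]" vs]
      basis_expansion[of "E n"] by (simp add: scalar_mult_eq_scaleR)
  have "(\<Sum>n<7. \<alpha> [E n] * \<omega> (E n # vs)) =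
    (\<Sum>n<7. \<Sum>i\<in>UNIV. \<Sum>j\<in>UNIV. E n $ i * E n $ j * (\<alpha> [axis i 1] * \<omega> (axis j 1 # vs)))"
    by (simp add: e[OF assms(1)] e[OF assms(2)] sum_product mult_ac)
  also have "\<dots> = (\<Sum>i\<in>UNIV. \<Sum>j\<in>UNIV. \<Sum>n<7. E n $ i * E n $ j * (\<alpha> [axis i 1] * \<omega> (axis j 1 # vs)))"
    by (subst sum.swap, subst (2) sum.swap) simp
  finally show ?thesis
    by (simp add: contract_def inverse_metric_eq int_prod_def sum_distrib_right sum_distrib_left mult_ac)
qed

end

section \<open>The algebra of a \<open>G\<^sub>2\<close>-structure at a point\<close>

lemma shuf_numeral [simp]:
  "shuf (numeral n) [] = []"
  "shuf (numeral n) (v # vs) = map (\<lambda>(s, a, b). (s, v # a, b)) (shuf (pred_numeral n) vs) @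
     map (\<lambda>(s, a, b). ((-1) ^ numeral n * s, a, v # b)) (shuf (numeral n) vs)"
  by (simp_all add: numeral_eq_Suc)

lemma shuf_1 [simp]:
  "shuf 1 [] = []"
  "shuf 1 (v # vs) = (1, [v], vs) # map (\<lambda>(s, a, b). (- s, a, v # b)) (shuf 1 vs)"
  by (simp_all add: One_nat_def)

lemma upt_7: "[0..<7] = [0, 1, 2, 3, 4, 5, 6]"
  by (simp add: upt_rec)

lemma sum_7: "(\<Sum>n<7. f n) = f 0 + f 1 + f 2 + f 3 + f 4 + f 5 + f (6::nat)"
  by (simp add: numeral_eq_Suc)

lemma covector_dual_basis: "is_covector 1 (dual_basis i)"
proof (rule is_covectorI)
  show "linear (\<lambda>v. dual_basis i (us @ v # ws))" for us ws
    by (auto simp: dual_basis_def linear_iff)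
  show "dual_basis i vs = 0" if "\<not> distinct vs" for vs
    using that by (auto simp: dual_basis_def length_Suc_conv)
qed (auto simp: dual_basis_def)

lemma int_prod_dual_basis: "v \<lrcorner> dual_basis i = (\<lambda>vs. if vs = [] then v $ i else 0)"
  by (auto simp: int_prod_def dual_basis_def)

lemma wedge_unit_left: "((\<lambda>vs. if vs = [] then c else 0) \<and>\<^sub>\<Lambda> \<beta>) vs = c * \<beta> vs"
proof -
  have "is_covector 0 (\<lambda>vs. if vs = [] then c else 0)"
    by (rule is_covectorI) (auto simp: linear_iff)
  then show ?thesis by (simp add: wedge_0)
qed

lemma dual_basis_wedge_Cons:
  "(dual_basis i \<and>\<^sub>\<Lambda> \<beta>) (v # vs) = v $ i * \<beta> vs - (dual_basis i \<and>\<^sub>\<Lambda> (v \<lrcorner> \<beta>)) vs"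
  by (simp add: wedge_Cons[OF covector_dual_basis] int_prod_dual_basis wedge_unit_left)

lemma e3_eval: "e3 i j k [u, v, w] =
   u $ i * (v $ j * w $ k - w $ j * v $ k) - v $ i * (u $ j * w $ k - w $ j * u $ k)
     + w $ i * (u $ j * v $ k - v $ j * u $ k)"
proof -
  have 2: "(dual_basis i \<and>\<^sub>\<Lambda> dual_basis j) [v, w] = v $ i * w $ j - w $ i * v $ j" for i j v w
    by (simp add: dual_basis_wedge_Cons wedge_Nil int_prod_def dual_basis_def)
  have 3: "(dual_basis i \<and>\<^sub>\<Lambda> \<beta>) [u, v, w] = u $ i * \<beta> [v, w] - v $ i * \<beta> [u, w] + w $ i * \<beta> [u, v]" for \<beta>
    by (simp add: dual_basis_wedge_Cons wedge_Nil int_prod_def dual_basis_def)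
  show ?thesis by (simp add: e3_def 2 3)
qed

text \<open>The 35 increasing triples in lexicographic order. The label 7 of the model form is the
  index 0, so 127, 347, 567 appear as 012, 034, 056; moving the label to the front is a cyclic
  permutation of three and costs no sign.\<close>

lemma phi0_std:
  "map (\<lambda>(s, a, b). phi0 (map std_vec a)) (shuf 3 [0..<7]) =
    [1, 0, 0, 0, 0, 0, 0, 0, 0, 1, 0, 0, 0, 0, 1, 0, 0, 0, 0, 0, 1, 0, 0, -1, 0, 0, 0, -1, -1, 0, 0, 0, 0, 0, 0]"
  by (simp add: upt_7 phi0_def e3_eval std_vec_def axis_def)

text \<open>An adapted frame before a volume form is fixed: the volume form will be constructed from
  identities proved here and is added in \<open>g2_frame\<close>.\<close>

locale g2_basis = metric_frame g E for g E +
  fixes \<phi> :: covector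
  assumes metric_g: "is_metric g"
    and covector_\<phi>: "is_covector 3 \<phi>"
    and \<phi>_std: "\<And>a. length a = 3 \<Longrightarrow> set a \<subseteq> {..<7} \<Longrightarrow> \<phi> (map E a) = phi0 (map std_vec a)"
begin

lemma \<phi>_values: "map (\<lambda>(s, a, b). \<phi> (map E a)) (shuf 3 [0..<7]) =
    [1, 0, 0, 0, 0, 0, 0, 0, 0, 1, 0, 0, 0, 0, 1, 0, 0, 0, 0, 0, 1, 0, 0, -1, 0, 0, 0, -1, -1, 0, 0, 0, 0, 0, 0]"
  unfolding phi0_std[symmetric]
proof (intro map_cong refl, clarify)
  fix s :: real and a b assume "(s, a, b) \<in> set (shuf 3 [0..<7])"
  from shuf_props[OF this] have "length a = 3" "mset a + mset b = mset [0..<7]" by auto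
  moreover from this(2) have "set a \<subseteq> {..<7}"
    by (metis atLeast_upt mset_subset_eq_add_left set_mset_mono set_mset_mset)
  ultimately show "\<phi> (map E a) = phi0 (map std_vec a)" by (intro \<phi>_std)
qed

lemmas \<phi>_table = \<phi>_values[simplified upt_7, simplified]

text \<open>Rewrite rules for a bubble sort. With numeral indices the guards decide every swap, so
  simplification reaches the increasing triples of the table and cannot loop.\<close>

lemma sort3:
  assumes "is_covector 3 \<alpha>"
  shows "\<alpha> [E i, E i, E k] = 0" "\<alpha> [E i, E k, E k] = 0" "\<alpha> [E k, E i, E k] = 0"
    "i > j \<Longrightarrow> \<alpha> [E i, E j, E k] = - \<alpha> [E j, E i, E k]"
    "j > k \<Longrightarrow> \<alpha> [E i, E j, E k] = - \<alpha> [E i, E k, E j]"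
  using covector_swap[OF assms, of "[]" "E i" "E j" "[E k]"] covector_swap[OF assms, of "[E i]" "E j" "E k" "[]"]
  by (auto intro!: covector_not_distinct[OF assms])

lemma sort4:
  assumes "is_covector 4 \<alpha>"
  shows "\<alpha> [E i, E i, E k, E l] = 0" "\<alpha> [E k, E i, E i, E l] = 0" "\<alpha> [E k, E l, E i, E i] = 0"
    "i > j \<Longrightarrow> \<alpha> [E i, E j, E k, E l] = - \<alpha> [E j, E i, E k, E l]"
    "j > k \<Longrightarrow> \<alpha> [E i, E j, E k, E l] = - \<alpha> [E i, E k, E j, E l]"
    "k > l \<Longrightarrow> \<alpha> [E i, E j, E k, E l] = - \<alpha> [E i, E j, E l, E k]"
  using covector_swap[OF assms, of "[]" "E i" "E j" "[E k, E l]"] covector_swap[OF assms, of "[E i]" "E j" "E k" "[E l]"]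
    covector_swap[OF assms, of "[E i, E j]" "E k" "E l" "[]"]
  by (auto intro!: covector_not_distinct[OF assms])

text \<open>The relation that ties \<phi> to its metric, computed on the frame. Bilinearity extends
  it to all vectors, and its value at \<open>i = j = 0\<close> normalises the volume form in
  \<open>g2_point\<close>.\<close>

lemma metric_relation_frame:
  assumes "i < 7" "j < 7"
  shows "((E i \<lrcorner> \<phi>) \<and>\<^sub>\<Lambda> (E j \<lrcorner> \<phi>) \<and>\<^sub>\<Lambda> \<phi>) (map E [0..<7]) = (if i = j then 6 else 0)"
proof -
  note 2 = covector_int_prod[OF covector_\<phi>, simplified]
  have "i = 0 \<or> i = 1 \<or> i = 2 \<or> i = 3 \<or> i = 4 \<or> i = 5 \<or> i = 6"
    "j = 0 \<or> j = 1 \<or> j = 2 \<or> j = 3 \<or> j = 4 \<or> j = 5 \<or> j = 6" using assms by auto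
  then show ?thesis
    by (elim disjE; simp only:; simp add: wedge_shuf[OF 2] upt_7 int_prod_def \<phi>_table sort3[OF covector_\<phi>])
qed

end

locale g2_frame = g2_basis g E \<phi> for g E \<phi> +
  fixes vol :: covector
  assumes covector_vol: "is_covector 7 vol"
    and vol_frame: "vol (map E [0..<7]) = 1"
begin

lemma vol_nz: "vol (map E [0..<7]) \<noteq> 0"
  by (simp add: vol_frame)

definition "\<psi> = hodge g vol 3 \<phi>"

lemma covector_\<psi>: "is_covector 4 \<psi>"
  using hodge_covector[OF covector_\<phi> covector_vol _ vol_nz] by (simp add: \<psi>_def)

lemma hodge_values:
  assumes "is_covector k \<beta>" "k \<le> 7"
  shows "\<forall>(s, a, b)\<in>set (shuf k [0..<7]). hodge g vol k \<beta> (map E b) = s * \<beta> (map E a)"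
  using hodge_shuf[OF assms(1) covector_vol assms(2) vol_nz] by (auto simp: vol_frame)

lemmas \<psi>_table = hodge_values[OF covector_\<phi>, folded \<psi>_def, unfolded upt_7, simplified, simplified \<phi>_table, simplified]

text \<open>Top-degree forms are one-dimensional, which reduces identities between 7-forms to one
  number.\<close>

lemma top_form_eq:
  assumes "is_covector 7 \<omega>"
  shows "\<omega> vs = \<omega> (map E [0..<7]) * vol vs"
  using covector_7_eq_0[OF covector_diff[OF assms covector_scale[OF covector_vol]] frame_spans,
      of "\<omega> (map E [0..<7])" vs] by (simp add: vol_frame)

lemma metric_relation: "((X \<lrcorner> \<phi>) \<and>\<^sub>\<Lambda> (Y \<lrcorner> \<phi>) \<and>\<^sub>\<Lambda> \<phi>) vs = 6 * g X Y * vol vs"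
proof -
  note 2 = covector_int_prod[OF covector_\<phi>, simplified]
  have 7: "is_covector 7 ((X \<lrcorner> \<phi>) \<and>\<^sub>\<Lambda> (Y \<lrcorner> \<phi>) \<and>\<^sub>\<Lambda> \<phi>)" for X Y
    using covector_wedge[OF 2 covector_wedge[OF 2 covector_\<phi>]] by simp
  define b where "b X Y = ((X \<lrcorner> \<phi>) \<and>\<^sub>\<Lambda> (Y \<lrcorner> \<phi>) \<and>\<^sub>\<Lambda> \<phi>) (map E [0..<7])" for X Y
  have i: "(v + w) \<lrcorner> \<phi> = (\<lambda>vs. (v \<lrcorner> \<phi>) vs + (w \<lrcorner> \<phi>) vs)" "(c *\<^sub>R v) \<lrcorner> \<phi> = (\<lambda>vs. c * (v \<lrcorner> \<phi>) vs)" for v w c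
    using linear_add[OF covector_linear[OF covector_\<phi>, of "[]"]] linear_cmul[OF covector_linear[OF covector_\<phi>, of "[]"]]
    by (auto simp: int_prod_def)
  have b: "bilinear b"
    unfolding b_def[abs_def]
    by (auto simp: bilinear_def linear_iff i wedge_add_left wedge_add_right wedge_scale_left
        wedge_scale_right wedge_add_left[abs_def] wedge_scale_left[abs_def])
  have "b (\<Sum>n<7. g X (E n) *\<^sub>R E n) (\<Sum>m<7. g Y (E m) *\<^sub>R E m) =
      (\<Sum>(n, m)\<in>{..<7} \<times> {..<7}. g X (E n) * (g Y (E m) * b (E n) (E m)))"
    by (simp only: bilinear_sum[OF b] bilinear_lmul[OF b] bilinear_rmul[OF b] real_scaleR_def)
      (simp add: mult_ac)
  also have "\<dots> = (\<Sum>n<7. \<Sum>m<7. g X (E n) * (g Y (E m) * (if n = m then 6 else 0)))"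
    by (simp add: metric_relation_frame b_def flip: sum.cartesian_product)
  also have "\<dots> = (\<Sum>n<7. 6 * (g X (E n) * g Y (E n)))"
    by (simp add: if_distrib mult_ac cong: if_cong)
  also have "\<dots> = 6 * g X Y"
  proof -
    have lin: "linear (\<lambda>x. g x Y)" using bilinear_g by (simp add: bilinear_def)
    have "g X Y = g (\<Sum>n<7. g X (E n) *\<^sub>R E n) Y" using expand[of X] by simp
    also have "\<dots> = (\<Sum>n<7. g X (E n) * g (E n) Y)"
      by (simp only: linear_sum[OF lin] linear_cmul[OF lin] real_scaleR_def)
    finally show ?thesis using metric_g by (simp add: is_metric_def sum_distrib_left)
  qed
  finally have "b X Y = 6 * g X Y"
    using expand[of X] expand[of Y] by simp
  then show ?thesis using top_form_eq[OF 7, of X Y vs] by (simp add: b_def)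
qed

text \<open>Exactly seven coefficients of the model form are nonzero, each of absolute value
  one.\<close>

lemma inner_\<phi>_\<phi>: "covector_inner g 3 \<phi> \<phi> = 7"
  by (simp add: inner_shuf[OF covector_\<phi> covector_\<phi>] upt_7 \<phi>_table)

lemma \<phi>_wedge_\<psi>: "(\<phi> \<and>\<^sub>\<Lambda> \<psi>) vs = 7 * vol vs"
  using wedge_hodge[OF covector_\<phi> covector_\<phi> covector_vol _ vol_nz] by (simp add: \<psi>_def inner_\<phi>_\<phi>)

lemma \<phi>_wedge_\<phi>: "(\<phi> \<and>\<^sub>\<Lambda> \<phi>) vs = 0"
  using wedge_commute[OF covector_\<phi> covector_\<phi>, of vs] by simp

context
  fixes a :: covector
  assumes a: "is_covector 1 a"
begin

lemma covector_a\<phi>: "is_covector 4 (a \<and>\<^sub>\<Lambda> \<phi>)"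
  using covector_wedge[OF a covector_\<phi>] by simp

lemma covector_contract: "is_covector 3 (contract g a \<psi>)"
  unfolding contract_frame[OF a covector_\<psi>, abs_def]
  using covector_int_prod[OF covector_\<psi>] by (intro covector_sum covector_scale) (simp add: int_prod_def[abs_def])

lemmas contract_eval = contract_frame[OF a covector_\<psi>] sum_7 \<psi>_table sort4[OF covector_\<psi>]

lemma inner_contract_\<phi>: "covector_inner g 3 (contract g a \<psi>) \<phi> = 0"
  by (simp add: inner_shuf[OF covector_contract covector_\<phi>] upt_7 \<phi>_table contract_eval)

lemma contract_wedge_\<psi>: "(contract g a \<psi> \<and>\<^sub>\<Lambda> \<psi>) vs = 0"
  using wedge_hodge[OF covector_contract covector_\<phi> covector_vol _ vol_nz]
  by (simp add: inner_contract_\<phi> flip: \<psi>_def)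

lemmas hodge_1_table = hodge_values[OF a, simplified, unfolded upt_7, simplified]

text \<open>Origin of the factor 4 between \<open>H \<and>\<^sub>\<Lambda> \<phi>\<close> and the
  star of the differential of the scalar. It is checked on the seven increasing lists of six frame
  vectors.\<close>

lemma contract_wedge_\<phi>: "(contract g a \<psi> \<and>\<^sub>\<Lambda> \<phi>) vs = 4 * hodge g vol 1 a vs"
proof -
  have "is_covector 6 (contract g a \<psi> \<and>\<^sub>\<Lambda> \<phi>)"
    using covector_wedge[OF covector_contract covector_\<phi>] by simp
  moreover have "is_covector 6 (hodge g vol 1 a)"
    using hodge_covector[OF a covector_vol _ vol_nz] by simp
  ultimately have "is_covector 6 (\<lambda>vs. (contract g a \<psi> \<and>\<^sub>\<Lambda> \<phi>) vs - 4 * hodge g vol 1 a vs)"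
    by (intro covector_diff covector_scale)
  then have "(contract g a \<psi> \<and>\<^sub>\<Lambda> \<phi>) vs - 4 * hodge g vol 1 a vs = 0"
    by (rule covector_eq_0_shuf)
      (simp add: upt_7 wedge_shuf[OF covector_contract] \<phi>_table contract_eval hodge_1_table)
  then show ?thesis by simp
qed

lemma inner_1: "covector_inner g 1 a a =
   (a [E 0])\<^sup>2 + (a [E 1])\<^sup>2 + (a [E 2])\<^sup>2 + (a [E 3])\<^sup>2 + (a [E 4])\<^sup>2 + (a [E 5])\<^sup>2 + (a [E 6])\<^sup>2"
  by (simp add: inner_shuf[OF a a] upt_7 power2_eq_square del: One_nat_def)

text \<open>The value agrees with the preceding identity: moving \<open>a\<close> past a 3-form
  changes the sign, and wedging \<open>a\<close> with its own star gives its squared norm. The proof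
  evaluates the tables directly.\<close>

lemma contract_wedge_a\<phi>:
  "(contract g a \<psi> \<and>\<^sub>\<Lambda> a \<and>\<^sub>\<Lambda> \<phi>) vs = - 4 * covector_inner g 1 a a * vol vs"
proof -
  have "is_covector 7 (contract g a \<psi> \<and>\<^sub>\<Lambda> a \<and>\<^sub>\<Lambda> \<phi>)"
    using covector_wedge[OF covector_contract covector_a\<phi>] by simp
  from top_form_eq[OF this, of vs] show ?thesis
    by (simp add: upt_7 wedge_shuf[OF covector_contract] wedge_shuf[OF a] \<phi>_table contract_eval
        inner_1[unfolded One_nat_def] power2_eq_square algebra_simps)
qed

lemma \<phi>_wedge_a\<phi>: "(\<phi> \<and>\<^sub>\<Lambda> a \<and>\<^sub>\<Lambda> \<phi>) vs = 0"
proof -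
  have "is_covector 7 (\<phi> \<and>\<^sub>\<Lambda> a \<and>\<^sub>\<Lambda> \<phi>)"
    using covector_wedge[OF covector_\<phi> covector_a\<phi>] by simp
  from top_form_eq[OF this, of vs] show ?thesis
    by (simp add: upt_7 wedge_shuf[OF covector_\<phi>] wedge_shuf[OF a] \<phi>_table)
qed

end

section \<open>Three-forms of the type of \<tau>3\<close>

context
  fixes t :: covector
  assumes t: "is_covector 3 t" and t\<phi>: "\<And>vs. (t \<and>\<^sub>\<Lambda> \<phi>) vs = 0" and t\<psi>: "\<And>vs. (t \<and>\<^sub>\<Lambda> \<psi>) vs = 0"
begin

lemma inner_\<phi>_t: "covector_inner g 3 \<phi> t = 0"
proof -
  have "covector_inner g 3 t \<phi> = 0"
    using wedge_hodge[OF t covector_\<phi> covector_vol _ vol_nz, of "map E [0..<7]"] t\<psi>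
    by (simp add: vol_frame flip: \<psi>_def)
  then show ?thesis
    by (simp add: inner_frame[OF t covector_\<phi>] inner_frame[OF covector_\<phi> t] mult.commute)
qed

text \<open>The seven components of \<open>t \<and>\<^sub>\<Lambda> \<phi> = 0\<close>, each solved
  for a coefficient that occurs on no right-hand side, so that they can be used as terminating
  rewrite rules.\<close>

lemma t_relations:
  shows "t [E 1, E 3, E 6] = - t [E 1, E 4, E 5] - t [E 2, E 3, E 5] + t [E 2, E 4, E 6]"
    "t [E 0, E 3, E 6] = - t [E 0, E 4, E 5] - t [E 2, E 3, E 4] - t [E 2, E 5, E 6]"
    "t [E 0, E 3, E 5] = t [E 0, E 4, E 6] + t [E 1, E 3, E 4] + t [E 1, E 5, E 6]"
    "t [E 0, E 1, E 6] = - t [E 0, E 2, E 5] + t [E 1, E 2, E 4] + t [E 4, E 5, E 6]"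
    "t [E 0, E 1, E 5] = t [E 0, E 2, E 6] - t [E 1, E 2, E 3] - t [E 3, E 5, E 6]"
    "t [E 0, E 1, E 4] = - t [E 0, E 2, E 3] - t [E 1, E 2, E 6] - t [E 3, E 4, E 6]"
    "t [E 0, E 1, E 3] = t [E 0, E 2, E 4] + t [E 1, E 2, E 5] + t [E 3, E 4, E 5]"
  using t\<phi>[of "map E [1, 2, 3, 4, 5, 6]"] t\<phi>[of "map E [0, 2, 3, 4, 5, 6]"]
    t\<phi>[of "map E [0, 1, 3, 4, 5, 6]"] t\<phi>[of "map E [0, 1, 2, 4, 5, 6]"]
    t\<phi>[of "map E [0, 1, 2, 3, 5, 6]"] t\<phi>[of "map E [0, 1, 2, 3, 4, 6]"]
    t\<phi>[of "map E [0, 1, 2, 3, 4, 5]"]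
  by (simp_all add: wedge_shuf[OF t] \<phi>_table)

text \<open>Contractions of \<psi> span the 7-dimensional summand of the 3-forms, and
  \<open>t \<and>\<^sub>\<Lambda> \<phi> = 0\<close> says that \<open>t\<close> has no part there.
  In coefficients this is a substitution of \<open>t_relations\<close>.\<close>

lemma inner_contract_t:
  assumes a: "is_covector 1 a"
  shows "covector_inner g 3 (contract g a \<psi>) t = 0"
  by (simp add: inner_shuf[OF covector_contract[OF a] t] upt_7 contract_eval[OF a])
    (simp add: t_relations[unfolded One_nat_def] algebra_simps)

text \<open>Up to sign this is \<open>a\<close> wedged with
  \<open>t \<and>\<^sub>\<Lambda> \<phi> = 0\<close>. It removes a cross term between \<tau>3 and
  \<tau>1.\<close>

lemma t_wedge_a\<phi>:
  assumes a: "is_covector 1 a"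
  shows "(t \<and>\<^sub>\<Lambda> a \<and>\<^sub>\<Lambda> \<phi>) vs = 0"
proof -
  have "is_covector 7 (t \<and>\<^sub>\<Lambda> a \<and>\<^sub>\<Lambda> \<phi>)"
    using covector_wedge[OF t covector_a\<phi>[OF a]] by simp
  moreover have "(t \<and>\<^sub>\<Lambda> a \<and>\<^sub>\<Lambda> \<phi>) (map E [0..<7]) = 0"
    by (simp add: upt_7 wedge_shuf[OF t] wedge_shuf[OF a] \<phi>_table)
      (simp add: t_relations[unfolded One_nat_def] algebra_simps)
  ultimately show ?thesis using top_form_eq[of "t \<and>\<^sub>\<Lambda> a \<and>\<^sub>\<Lambda> \<phi>" vs] by simp
qed

end

text \<open>Independence of the \<tau>1 and \<tau>2 parts of d\<psi>. The 21 components in degree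
  five and the 7 in degree six form a linear system for the 7 + 21 coefficients of \<open>b\<close>
  and \<open>w\<close>, and linear arithmetic eliminates all of them.\<close>

lemma torsion_5_eq_0:
  assumes b: "is_covector 1 b" and w: "is_covector 2 w"
    and 5: "\<And>vs. 4 * (b \<and>\<^sub>\<Lambda> \<psi>) vs + (w \<and>\<^sub>\<Lambda> \<phi>) vs = 0" and 6: "\<And>vs. (w \<and>\<^sub>\<Lambda> \<psi>) vs = 0"
  shows "b vs = 0" "w vs = 0"
proof -
  have 5: "\<forall>(s, a, c)\<in>set (shuf 5 [0..<7]). 4 * (b \<and>\<^sub>\<Lambda> \<psi>) (map E a) + (w \<and>\<^sub>\<Lambda> \<phi>) (map E a) = 0"
    using 5 by auto
  have 6: "\<forall>(s, a, c)\<in>set (shuf 6 [0..<7]). (w \<and>\<^sub>\<Lambda> \<psi>) (map E a) = 0"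
    using 6 by auto
  note eqs = 5[unfolded upt_7, simplified wedge_shuf[OF b] wedge_shuf[OF w], simplified, simplified \<phi>_table \<psi>_table, simplified]
    6[unfolded upt_7, simplified wedge_shuf[OF w], simplified, simplified \<psi>_table, simplified]
  have "\<forall>(s, a, c)\<in>set (shuf 1 [0..<7]). b (map E a) = 0"
    by (simp add: upt_7; intro conjI; use eqs in linarith)
  then show "b vs = 0" by (rule covector_eq_0_shuf[OF b])
  have "\<forall>(s, a, c)\<in>set (shuf 2 [0..<7]). w (map E a) = 0"
    by (simp add: upt_7; intro conjI; use eqs in linarith)
  then show "w vs = 0" by (rule covector_eq_0_shuf[OF w])
qed

end

section \<open>The metric and volume form determined by \<phi>\<close>

context g2_frame
begin

lemma g2_determines: "g2_determines \<phi> g vol"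
  unfolding g2_determines_def
proof (intro conjI allI)
  show "is_metric g" by (rule metric_g)
  show "((X \<lrcorner> \<phi>) \<and>\<^sub>\<Lambda> (Y \<lrcorner> \<phi>) \<and>\<^sub>\<Lambda> \<phi>) vs = 6 * g X Y * vol vs" for X Y vs
    by (rule metric_relation)
  show "is_volume_of g vol"
    unfolding is_volume_of_def
  proof (intro conjI allI impI)
    show "is_covector 7 vol" by (rule covector_vol)
    fix vs assume vs: "length vs = 7 \<and> (\<forall>i<7. \<forall>j<7. g (vs ! i) (vs ! j) = (if i = j then 1 else 0))"
    interpret F: metric_frame g "(!) vs"
      by unfold_locales (use bilinear_g vs in auto)
    have "map ((!) vs) [0..<7] = vs" using vs by (metis map_nth)
    \<comment> \<open>Both sides are the squared norm of \<open>vol\<close>, computed in two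
      orthonormal frames of the same metric.\<close>
    then have "vol vs * vol vs = vol (map E [0..<7]) * vol (map E [0..<7])"
      using F.inner_7[OF covector_vol covector_vol] inner_7[OF covector_vol covector_vol] by simp
    then have "(vol vs)\<^sup>2 = 1" by (simp add: vol_frame power2_eq_square)
    then show "\<bar>vol vs\<bar> = 1" by (simp add: abs_square_eq_1)
  qed
qed

lemma covector_scale_arguments:
  assumes "is_covector k \<omega>"
  shows "\<omega> (us @ map ((*\<^sub>R) c) vs) = c ^ length vs * \<omega> (us @ vs)"
proof (induction vs arbitrary: us)
  case (Cons v vs)
  show ?case
    using Cons.IH[of "us @ [c *\<^sub>R v]"] linear_cmul[OF covector_linear[OF assms, of us vs], of c v] by simp
qed simp

text \<open>Rescaling \<open>g\<close> by \<open>\<lambda>\<close> must rescale the volume by \<open>1/\<lambda>\<close> in this relation but by \<open>\<lambda>\<close> to the power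
  \<open>7/2\<close> as a volume form, so \<open>\<lambda> = 1\<close>.\<close>

lemma g2_determines_unique:
  assumes "g2_determines \<phi> g' vol'"
  shows "g' = g \<and> vol' = vol"
proof -
  have m: "is_metric g'" and v: "is_volume_of g' vol'"
    and r: "((X \<lrcorner> \<phi>) \<and>\<^sub>\<Lambda> (Y \<lrcorner> \<phi>) \<and>\<^sub>\<Lambda> \<phi>) vs = 6 * g' X Y * vol' vs" for X Y vs
    using assms by (auto simp: g2_determines_def)
  define c where "c = vol' (map E [0..<7])"
  have gg: "g X Y = g' X Y * c" for X Y
    using r[of X Y "map E [0..<7]"] metric_relation[of X Y "map E [0..<7]"] by (simp add: vol_frame c_def)
  have g00: "g (E 0) (E 0) = 1" using orthonormal by simp
  then have "E 0 \<noteq> 0" using bilinear_g bilinear_lzero[OF bilinear_g] by auto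
  then have "g' (E 0) (E 0) > 0" using m by (auto simp: is_metric_def)
  then have c: "c > 0" using gg[of "E 0" "E 0"] g00 by (metis zero_less_mult_pos zero_less_one)
  have b': "bilinear g'" using m by (simp add: is_metric_def)
  \<comment> \<open>Since \<open>g = c * g'\<close>, stretching the frame by \<open>sqrt c\<close>
    makes it orthonormal for \<open>g'\<close>.\<close>
  let ?vs = "map ((*\<^sub>R) (sqrt c)) (map E [0..<7])"
  have "g' (?vs ! i) (?vs ! j) = (if i = j then 1 else 0)" if "i < 7" "j < 7" for i j
    using that gg[of "E i" "E j"] orthonormal[OF that] c
    by (simp add: bilinear_lmul[OF b'] bilinear_rmul[OF b'] mult_ac flip: mult.assoc[of "sqrt c" "sqrt c"])
  then have "\<bar>vol' ?vs\<bar> = 1" using v by (auto simp: is_volume_of_def)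
  moreover have "vol' ?vs = sqrt c ^ 7 * c"
    using v covector_scale_arguments[of 7 vol' "[]" "sqrt c" "map E [0..<7]"]
    by (simp add: is_volume_of_def c_def)
  ultimately have *: "sqrt c ^ 7 * c = 1" using c by simp
  \<comment> \<open>Seven factors come from the stretched arguments, two more from \<open>c\<close>
    itself.\<close>
  have "sqrt c ^ 9 = sqrt c ^ 7 * sqrt c ^ 2" by (simp only: power_add[symmetric]) simp
  then have "sqrt c ^ 9 = 1 ^ 9" using * c by simp
  then have "sqrt c = 1" using c by (intro power_eq_imp_eq_base[of "sqrt c" 9 1]) auto
  then have "c = 1" by simp
  then have "g' = g" using gg by (auto simp: fun_eq_iff)
  moreover have "vol' vs = vol vs" for vs
    using r[of "E 0" "E 0" vs] metric_relation[of "E 0" "E 0" vs] g00 \<open>g' = g\<close> by simp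
  ultimately show ?thesis by auto
qed

lemma g2_metric_eq: "g2_metric \<phi> = g" and g2_vol_eq: "g2_vol \<phi> = vol"
  unfolding g2_metric_def g2_vol_def
  using g2_determines g2_determines_unique by (blast intro: the_equality)+

text \<open>Pointwise model of the main computation: \<open>a\<close>, \<open>t\<close>,
  \<open>t0\<close> are the values of \<tau>1, \<tau>3, \<tau>0, and \<open>D\<close> is the value
  that the torsion equation prescribes for d\<phi>.\<close>

context
  fixes a t H D :: covector and t0 :: real
  assumes a: "is_covector 1 a" and t: "is_covector 3 t"
    and t\<phi>: "\<And>vs. (t \<and>\<^sub>\<Lambda> \<phi>) vs = 0" and t\<psi>: "\<And>vs. (t \<and>\<^sub>\<Lambda> \<psi>) vs = 0"
  defines "H \<equiv> \<lambda>vs. 1/6 * (t0 * \<phi> vs) - contract g a \<psi> vs - t vs"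
    and "D \<equiv> \<lambda>vs. t0 * \<psi> vs + 3 * (a \<and>\<^sub>\<Lambda> \<phi>) vs + hodge g vol 3 t vs"
begin

lemma covector_H: "is_covector 3 H"
  unfolding H_def by (intro covector_diff covector_scale covector_\<phi> covector_contract a t)

lemma covector_D: "is_covector 4 D"
  unfolding D_def using hodge_covector[OF t covector_vol _ vol_nz]
  by (intro covector_add covector_scale covector_\<psi> covector_a\<phi> a) simp

lemmas wedge_linear = wedge_add_left wedge_add_right wedge_scale_left wedge_scale_right
  wedge_diff_left wedge_diff_right

lemma H_wedge_\<phi>: "(H \<and>\<^sub>\<Lambda> \<phi>) vs = - 4 * hodge g vol 1 a vs"
  unfolding H_def wedge_linear using contract_wedge_\<phi>[OF a, of vs] t\<phi> \<phi>_wedge_\<phi> by simp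

lemma \<phi>_wedge_D: "(\<phi> \<and>\<^sub>\<Lambda> D) vs = 7 * t0 * vol vs"
  unfolding D_def wedge_linear
  using \<phi>_wedge_\<psi> \<phi>_wedge_a\<phi>[OF a] wedge_hodge[OF covector_\<phi> t covector_vol _ vol_nz]
    inner_\<phi>_t[OF t t\<phi> t\<psi>] by simp

text \<open>Of the nine products only the three between matching types survive:
  \<open>1/6 * 7\<close> from the scalar part, \<open>3 * 4\<close> from \<tau>1, and the squared
  norm of \<tau>3 with a minus sign.\<close>

lemma H_wedge_D: "(H \<and>\<^sub>\<Lambda> D) vs =
   (7/6 * t0\<^sup>2 + 12 * covector_inner g 1 a a - covector_inner g 3 t t) * vol vs"
  unfolding H_def D_def wedge_linear
  using \<phi>_wedge_\<psi>[of vs] \<phi>_wedge_a\<phi>[OF a, of vs] wedge_hodge[OF covector_\<phi> t covector_vol _ vol_nz, of vs]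
    inner_\<phi>_t[OF t t\<phi> t\<psi>] contract_wedge_\<psi>[OF a, of vs] contract_wedge_a\<phi>[OF a, of vs]
    wedge_hodge[OF covector_contract[OF a] t covector_vol _ vol_nz, of vs] inner_contract_t[OF t t\<phi> t\<psi> a]
    t\<psi> t_wedge_a\<phi>[OF t t\<phi> t\<psi> a, of vs] wedge_hodge[OF t t covector_vol _ vol_nz, of vs]
  by (simp add: power2_eq_square algebra_simps)

end

lemma hodge_7: "hodge g vol 7 (\<lambda>vs. c * vol vs) [] = c"
  using hodge_inner[OF covector_scale[OF covector_vol] covector_vol _ vol_nz, of c "[]"]
    inner_7[OF covector_scale[OF covector_vol] covector_vol, of c]
  by (simp add: vol_frame)

end

text \<open>The metric is the Euclidean one pulled back along \<open>L\<close>, and the frame is the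
  preimage of the standard basis. Uniqueness then identifies this metric and its volume form with
  \<open>g2_metric\<close> and \<open>g2_vol\<close>.\<close>

lemma g2_point:
  assumes L: "linear L" "bij L" "\<And>vs. \<phi> vs = phi0 (map L vs)" and cov: "is_covector 3 \<phi>"
  obtains E where "g2_frame (g2_metric \<phi>) E \<phi> (g2_vol \<phi>)"
proof -
  define E where "E n = inv L (std_vec n)" for n
  have LE: "L (E n) = std_vec n" for n
    using L(2) by (simp add: E_def bij_is_surj surj_f_inv_f)
  define g where "g X Y = L X \<bullet> L Y" for X Y
  interpret g2_basis g E \<phi>
  proof
    show b: "bilinear g"
      unfolding g_def bilinear_def using L(1)
      by (auto intro!: linearI simp: linear_add linear_cmul inner_add_left inner_add_right)
    show "g (E i) (E j) = (if i = j then 1 else 0)" if "i < 7" "j < 7" for i j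
    proof -
      have "(of_nat i :: 7) = of_nat j \<longleftrightarrow> i = j"
        using that bij_betw_of_nat_7 by (auto simp: bij_betw_def inj_on_def)
      then show ?thesis by (simp add: g_def LE std_vec_def inner_axis_axis)
    qed
    have "L X \<noteq> 0" if "X \<noteq> 0" for X
      using that L(1,2) by (metis bij_is_inj injD linear_0)
    then show "is_metric g"
      using b by (auto simp: is_metric_def g_def inner_commute)
    show "is_covector 3 \<phi>" by (rule cov)
    show "\<phi> (map E a) = phi0 (map std_vec a)" for a
      by (simp add: L(3) LE o_def)
  qed
  \<comment> \<open>Reading the volume form off the metric relation at \<open>E 0\<close> fixes its
    sign by \<phi> rather than by the orientation of the coordinates.\<close>
  define vol where "vol vs = 1/6 * ((E 0 \<lrcorner> \<phi>) \<and>\<^sub>\<Lambda> (E 0 \<lrcorner> \<phi>) \<and>\<^sub>\<Lambda> \<phi>) vs" for vs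
  interpret g2_frame g E \<phi> vol
  proof
    have "is_covector 7 ((E 0 \<lrcorner> \<phi>) \<and>\<^sub>\<Lambda> (E 0 \<lrcorner> \<phi>) \<and>\<^sub>\<Lambda> \<phi>)"
      using covector_wedge[OF covector_int_prod[OF cov, of "E 0"] covector_wedge[OF covector_int_prod[OF cov, of "E 0"] cov]]
      by simp
    then show "is_covector 7 vol"
      unfolding vol_def[abs_def] by (rule covector_scale)
    show "vol (map E [0..<7]) = 1"
      using metric_relation_frame[of 0 0] by (simp add: vol_def)
  qed
  have "g2_frame (g2_metric \<phi>) E \<phi> (g2_vol \<phi>)"
    unfolding g2_metric_eq g2_vol_eq by (rule g2_frame_axioms)
  then show ?thesis by (rule that)
qed

section \<open>The exterior derivative in coordinates\<close>

text \<open>The formula of \<open>ext_d\<close> inside a single chart, so that the calculus below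
  does not mention the manifold.\<close>

definition form_d :: "(real^7 \<Rightarrow> covector) \<Rightarrow> real^7 \<Rightarrow> covector" where
  "form_d \<omega> u vs = (\<Sum>i<length vs. (-1) ^ i *
     frechet_derivative (\<lambda>y. \<omega> y (take i vs @ drop (Suc i) vs)) (at u) (vs ! i))"

lemma ext_d_form_d: "ext_d \<omega> c u = form_d (\<omega> c) u"
  by (rule ext) (simp add: ext_d_def form_d_def)

lemma form_d_Nil: "form_d \<omega> u [] = 0"
  by (simp add: form_d_def)

text \<open>Cartan's formula for a constant vector field. Together with the contraction rule for
  wedge products it drives inductions on the list of arguments.\<close>

lemma form_d_Cons:
  "form_d \<omega> u (v # vs) = frechet_derivative (\<lambda>y. \<omega> y vs) (at u) v - form_d (\<lambda>y. v \<lrcorner> \<omega> y) u vs"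
  by (simp add: form_d_def sum.lessThan_Suc_shift int_prod_def sum_negf del: sum.lessThan_Suc)

lemma frechet_derivative_cong:
  assumes "open S" "u \<in> S" "\<And>y. y \<in> S \<Longrightarrow> f y = g y"
  shows "frechet_derivative f (at u) = frechet_derivative g (at u)"
proof -
  have "(f has_derivative D) (at u) \<longleftrightarrow> (g has_derivative D) (at u)" for D
    using has_derivative_transform_within_open[OF _ assms(1,2)] assms(3) by metis
  then show ?thesis by (simp add: frechet_derivative_def)
qed

lemma form_d_cong:
  assumes "open S" "u \<in> S" "\<And>y. y \<in> S \<Longrightarrow> \<omega> y = \<omega>' y"
  shows "form_d \<omega> u = form_d \<omega>' u"
  unfolding form_d_def[abs_def] using assms(3)
  by (intro ext sum.cong refl arg_cong2[where f = "(*)"] fun_cong[OF frechet_derivative_cong[OF assms(1,2)]]) simp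

lemma form_d_length:
  assumes "open S" "u \<in> S" "\<And>y vs. y \<in> S \<Longrightarrow> length vs \<noteq> p \<Longrightarrow> \<omega> y vs = 0" "length vs \<noteq> Suc p"
  shows "form_d \<omega> u vs = 0"
proof -
  have "frechet_derivative (\<lambda>y. \<omega> y (take i vs @ drop (Suc i) vs)) (at u) = (\<lambda>_. 0)" if "i < length vs" for i
    using that assms frechet_derivative_cong[OF assms(1,2), of "\<lambda>y. \<omega> y (take i vs @ drop (Suc i) vs)" "\<lambda>_. 0"]
    by (simp add: frechet_derivative_const)
  then show ?thesis by (simp add: form_d_def)
qed

lemma frechet_derivative_eq: "(f has_derivative f') (at x) \<Longrightarrow> frechet_derivative f (at x) v = f' v"
  using frechet_derivative_at by metis

lemma form_d_add:
  assumes "\<And>vs. (\<lambda>y. \<alpha> y vs) differentiable (at u)" "\<And>vs. (\<lambda>y. \<beta> y vs) differentiable (at u)"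
  shows "form_d (\<lambda>y vs. \<alpha> y vs + \<beta> y vs) u vs = form_d \<alpha> u vs + form_d \<beta> u vs"
  unfolding form_d_def
  by (simp add: distrib_left sum.distrib
      frechet_derivative_eq[OF has_derivative_add[OF assms(1)[unfolded frechet_derivative_works] assms(2)[unfolded frechet_derivative_works]]])

lemma form_d_cmult:
  assumes "\<And>vs. (\<lambda>y. \<alpha> y vs) differentiable (at u)"
  shows "form_d (\<lambda>y vs. c * \<alpha> y vs) u vs = c * form_d \<alpha> u vs"
  unfolding form_d_def
  by (simp add: sum_distrib_left mult_ac
      frechet_derivative_eq[OF has_derivative_mult_right[OF assms[unfolded frechet_derivative_works]]])

lemma has_derivative_wedge:
  assumes "\<And>vs. ((\<lambda>y. \<alpha> y vs) has_derivative (\<lambda>v. \<alpha>' v vs)) (at u)"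
    "\<And>vs. ((\<lambda>y. \<beta> y vs) has_derivative (\<lambda>v. \<beta>' v vs)) (at u)"
  shows "((\<lambda>y. (\<alpha> y \<and>\<^sub>\<Lambda> \<beta> y) vs) has_derivative
    (\<lambda>v. (\<alpha>' v \<and>\<^sub>\<Lambda> \<beta> u) vs + (\<alpha> u \<and>\<^sub>\<Lambda> \<beta>' v) vs)) (at u)"
  unfolding wedge_def
  by (rule derivative_eq_intros assms refl)+ (simp add: sum.distrib algebra_simps)

lemma differentiable_wedge:
  assumes "\<And>vs. (\<lambda>y. \<alpha> y vs) differentiable (at u)" "\<And>vs. (\<lambda>y. \<beta> y vs) differentiable (at u)"
  shows "(\<lambda>y. (\<alpha> y \<and>\<^sub>\<Lambda> \<beta> y) vs) differentiable (at u)"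
  using has_derivative_wedge[of \<alpha> "\<lambda>v vs. frechet_derivative (\<lambda>y. \<alpha> y vs) (at u) v" u
      \<beta> "\<lambda>v vs. frechet_derivative (\<lambda>y. \<beta> y vs) (at u) v" vs] assms
  by (auto simp: differentiable_def[of "\<lambda>y. (\<alpha> y \<and>\<^sub>\<Lambda> \<beta> y) vs"] frechet_derivative_works)

text \<open>The Leibniz rule follows by contracting both sides with the first argument and using it
  for the two pairs in which one factor is contracted.\<close>

lemma form_d_wedge:
  assumes "open S" "u \<in> S" "\<And>y vs. y \<in> S \<Longrightarrow> length vs \<noteq> p \<Longrightarrow> \<alpha> y vs = 0"
    "\<And>vs. (\<lambda>y. \<alpha> y vs) differentiable (at u)" "\<And>vs. (\<lambda>y. \<beta> y vs) differentiable (at u)"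
  shows "form_d (\<lambda>y. \<alpha> y \<and>\<^sub>\<Lambda> \<beta> y) u vs =
    (form_d \<alpha> u \<and>\<^sub>\<Lambda> \<beta> u) vs + (-1) ^ p * (\<alpha> u \<and>\<^sub>\<Lambda> form_d \<beta> u) vs"
  using assms(3-)
proof (induction vs arbitrary: p \<alpha> \<beta>)
  case Nil
  then show ?case by (simp add: form_d_Nil wedge_Nil)
next
  case (Cons v vs)
  note deg = Cons.prems(1) and da = Cons.prems(2) and db = Cons.prems(3)
  let ?D = "\<lambda>\<omega> vs. frechet_derivative (\<lambda>y. \<omega> y vs) (at u) v"
  let ?va = "\<lambda>y. v \<lrcorner> \<alpha> y" and ?vb = "\<lambda>y. v \<lrcorner> \<beta> y"
  have dva: "(\<lambda>y. (v \<lrcorner> \<alpha> y) ws) differentiable (at u)" and dvb: "(\<lambda>y. (v \<lrcorner> \<beta> y) ws) differentiable (at u)" for ws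
    using da[of "v # ws"] db[of "v # ws"] by (simp_all add: int_prod_def)
  have vdeg: "(v \<lrcorner> \<alpha> y) ws = 0" if "y \<in> S" "length ws \<noteq> p - 1" for y ws
    using deg[OF that(1), of "v # ws"] that(2) by (cases p) (auto simp: int_prod_def)
  have ip: "v \<lrcorner> (\<alpha> y \<and>\<^sub>\<Lambda> \<beta> y) =
      (\<lambda>ws. (?va y \<and>\<^sub>\<Lambda> \<beta> y) ws + (-1) ^ p * (\<alpha> y \<and>\<^sub>\<Lambda> ?vb y) ws)" if "y \<in> S" for y
    using deg[OF that] by (auto simp: int_prod_def[of v "\<alpha> y \<and>\<^sub>\<Lambda> \<beta> y"] wedge_Cons_homogeneous[of p])
  have ipd: "v \<lrcorner> form_d \<omega> u = (\<lambda>ws. ?D \<omega> ws - form_d (\<lambda>y. v \<lrcorner> \<omega> y) u ws)" for \<omega>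
    by (rule ext) (simp add: int_prod_def[of v "form_d \<omega> u"] form_d_Cons)
  have "?D (\<lambda>y. \<alpha> y \<and>\<^sub>\<Lambda> \<beta> y) vs = (?D \<alpha> \<and>\<^sub>\<Lambda> \<beta> u) vs + (\<alpha> u \<and>\<^sub>\<Lambda> ?D \<beta>) vs"
    by (rule frechet_derivative_eq, rule has_derivative_wedge)
      (use da db frechet_derivative_works in blast)+
  moreover have "form_d (\<lambda>y. v \<lrcorner> (\<alpha> y \<and>\<^sub>\<Lambda> \<beta> y)) u vs =
      form_d (\<lambda>y. ?va y \<and>\<^sub>\<Lambda> \<beta> y) u vs + (-1) ^ p * form_d (\<lambda>y. \<alpha> y \<and>\<^sub>\<Lambda> ?vb y) u vs"
  proof -
    have "form_d (\<lambda>y. v \<lrcorner> (\<alpha> y \<and>\<^sub>\<Lambda> \<beta> y)) u = form_d (\<lambda>y ws. (?va y \<and>\<^sub>\<Lambda> \<beta> y) ws + (-1) ^ p * (\<alpha> y \<and>\<^sub>\<Lambda> ?vb y) ws) u"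
      by (rule form_d_cong[OF assms(1,2) ip])
    then show ?thesis
      by (simp add: form_d_add form_d_cmult differentiable_wedge da db dva dvb)
  qed
  \<comment> \<open>In degree 0 the exponent \<open>p - 1\<close> fails to flip the sign, but both
    sides vanish.\<close>
  moreover have "(-1) ^ (p - 1) * (?va u \<and>\<^sub>\<Lambda> form_d \<beta> u) vs = - ((-1) ^ p * (?va u \<and>\<^sub>\<Lambda> form_d \<beta> u) vs)"
  proof (cases p)
    case 0
    then have "v \<lrcorner> \<alpha> u = (\<lambda>_. 0)" using deg[OF assms(2)] by (auto simp: int_prod_def)
    then show ?thesis by (simp add: wedge_zero_left)
  qed simp
  ultimately show ?case
    using Cons.IH[OF vdeg dva db] Cons.IH[OF deg da dvb] assms(2) form_d_length[OF assms(1,2) deg]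
    by (simp add: form_d_Cons wedge_Cons_homogeneous[of "Suc p" "form_d \<alpha> u"]
        wedge_Cons_homogeneous[of p "\<alpha> u"] deg ipd wedge_diff_left wedge_diff_right algebra_simps
        flip: power_mult_distrib)
qed

text \<open>Functions as 0-covectors, so that the product rule for a function times a form is the
  Leibniz rule in degree 0.\<close>

definition fun_covector :: "real \<Rightarrow> covector" where
  "fun_covector r vs = (if vs = [] then r else 0)"

lemma fun_covector_wedge: "(fun_covector r \<and>\<^sub>\<Lambda> \<beta>) vs = r * \<beta> vs"
  using wedge_unit_left[of r \<beta> vs] by (simp add: fun_covector_def[abs_def])

lemma form_d_fun_covector:
  "form_d (\<lambda>y. fun_covector (F y)) u vs = (if length vs = 1 then frechet_derivative F (at u) (hd vs) else 0)"
proof (cases "length vs = 1")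
  case True
  then obtain v where "vs = [v]" by (auto simp: length_Suc_conv)
  then show ?thesis by (simp add: form_d_def fun_covector_def)
next
  case False
  then show ?thesis
    using form_d_length[of UNIV u 0 "\<lambda>y. fun_covector (F y)" vs] by (simp add: fun_covector_def)
qed

lemma covector_form_d_fun_covector:
  assumes "F differentiable (at u)"
  shows "is_covector 1 (form_d (\<lambda>y. fun_covector (F y)) u)"
proof (rule is_covectorI)
  have "linear (frechet_derivative F (at u))" by (rule linear_frechet_derivative[OF assms])
  then show "linear (\<lambda>v. form_d (\<lambda>y. fun_covector (F y)) u (us @ v # ws))" for us ws
    by (cases "us = [] \<and> ws = []") (auto simp: form_d_fun_covector linear_iff)
  show "form_d (\<lambda>y. fun_covector (F y)) u vs = 0" if "\<not> distinct vs" for vs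
    using that by (auto simp: form_d_fun_covector length_Suc_conv)
qed (simp add: form_d_fun_covector)

lemma form_d_fun_mult:
  assumes "F differentiable (at u)" "\<And>vs. (\<lambda>y. \<beta> y vs) differentiable (at u)"
  shows "form_d (\<lambda>y vs. F y * \<beta> y vs) u vs =
    (form_d (\<lambda>y. fun_covector (F y)) u \<and>\<^sub>\<Lambda> \<beta> u) vs + F u * form_d \<beta> u vs"
proof -
  have "(\<lambda>y. fun_covector (F y) vs) differentiable (at u)" for vs
    using assms(1) by (cases "vs = []") (simp_all add: fun_covector_def)
  moreover have "fun_covector r \<and>\<^sub>\<Lambda> \<gamma> = (\<lambda>vs. r * \<gamma> vs)" for r \<gamma>
    by (rule ext) (rule fun_covector_wedge)
  ultimately show ?thesis
    using form_d_wedge[of UNIV u 0 "\<lambda>y. fun_covector (F y)" \<beta> vs] assms(2)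
    by (simp add: fun_covector_def)
qed

section \<open>Regularity of the metric and the Laplacian in coordinates\<close>

text \<open>The equations differentiate \<psi>, \<open>H\<close> and the star of the differential
  only once, so one continuous derivative of the metric is enough.\<close>

abbreviation C1 :: "(real^7) set \<Rightarrow> (real^7 \<Rightarrow> real) \<Rightarrow> bool" where
  "C1 S f \<equiv> C_on (Suc 0) S f"

lemma C1I:
  assumes "\<And>x. x \<in> S \<Longrightarrow> (f has_derivative f' x) (at x)" "\<And>v. continuous_on S (\<lambda>x. f' x v)"
  shows "C1 S f"
proof -
  have "continuous_on S (\<lambda>x. frechet_derivative f (at x) v) \<longleftrightarrow> continuous_on S (\<lambda>x. f' x v)" for v
    by (intro continuous_on_cong refl frechet_derivative_eq assms)
  then show ?thesis using assms by (auto simp: differentiable_def)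
qed

lemma C1_has_derivative: "C1 S f \<Longrightarrow> x \<in> S \<Longrightarrow> (f has_derivative frechet_derivative f (at x)) (at x)"
  by (simp add: frechet_derivative_works)

lemma C1_differentiable: "C1 S f \<Longrightarrow> x \<in> S \<Longrightarrow> f differentiable (at x)"
  by simp

lemma C1_continuous_derivative: "C1 S f \<Longrightarrow> continuous_on S (\<lambda>x. frechet_derivative f (at x) v)"
  by simp

lemma C1_continuous: "C1 S f \<Longrightarrow> continuous_on S f"
  by (auto intro!: continuous_at_imp_continuous_on differentiable_imp_continuous_within)

lemma smooth_on_C1: "smooth_on S f \<Longrightarrow> C1 S f"
  by (simp only: smooth_on_def)

lemma smooth_on_derivative_C1: "smooth_on S f \<Longrightarrow> C1 S (\<lambda>x. frechet_derivative f (at x) v)"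
  unfolding smooth_on_def by (drule spec[of _ "Suc (Suc 0)"]) (simp only: C_on.simps(2)[of "Suc 0"])

lemma C1_cong:
  assumes "C1 S f" "open S" "\<And>x. x \<in> S \<Longrightarrow> f x = g x"
  shows "C1 S g"
proof (rule C1I)
  show "(g has_derivative frechet_derivative f (at x)) (at x)" if "x \<in> S" for x
    by (rule has_derivative_transform_within_open[OF C1_has_derivative[OF assms(1) that] assms(2) that assms(3)])
qed (rule C1_continuous_derivative[OF assms(1)])

lemma C1_const: "C1 S (\<lambda>_. c)"
  by (rule C1I[where f' = "\<lambda>_ _. 0"]) auto

lemma C1_add: "C1 S f \<Longrightarrow> C1 S g \<Longrightarrow> C1 S (\<lambda>x. f x + g x)"
  by (rule C1I[OF has_derivative_add[OF C1_has_derivative C1_has_derivative]], assumption+)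
    (intro continuous_on_add C1_continuous_derivative; assumption)

lemma C1_mult: "C1 S f \<Longrightarrow> C1 S g \<Longrightarrow> C1 S (\<lambda>x. f x * g x)"
  by (rule C1I[OF has_derivative_mult[OF C1_has_derivative C1_has_derivative]], assumption+,
      intro continuous_on_add continuous_on_mult; (rule C1_continuous_derivative C1_continuous, assumption))

lemma C1_sum: "(\<And>i. i \<in> I \<Longrightarrow> C1 S (f i)) \<Longrightarrow> C1 S (\<lambda>x. \<Sum>i\<in>I. f i x)"
  by (induction I rule: infinite_finite_induct) (auto intro!: C1_const C1_add simp del: C_on.simps)

lemma C1_prod: "(\<And>i. i \<in> I \<Longrightarrow> C1 S (f i)) \<Longrightarrow> C1 S (\<lambda>x. \<Prod>i\<in>I. f i x)"
  by (induction I rule: infinite_finite_induct) (auto intro!: C1_const C1_mult simp del: C_on.simps)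

lemma C1_compose:
  assumes "C1 S f" "\<And>x. x \<in> S \<Longrightarrow> (r has_real_derivative r' (f x)) (at (f x))" "continuous_on S (\<lambda>x. r' (f x))"
  shows "C1 S (\<lambda>x. r (f x))"
proof (rule C1I)
  show "((\<lambda>x. r (f x)) has_derivative (\<lambda>v. r' (f x) * frechet_derivative f (at x) v)) (at x)" if "x \<in> S" for x
    using has_derivative_compose[OF C1_has_derivative[OF assms(1) that] assms(2)[OF that, unfolded has_field_derivative_def]] .
qed (intro continuous_intros assms(3) C1_continuous_derivative[OF assms(1)])

lemma C1_inverse:
  assumes "C1 S f" "\<And>x. x \<in> S \<Longrightarrow> f x \<noteq> 0"
  shows "C1 S (\<lambda>x. inverse (f x))"
proof (rule C1_compose[OF assms(1), where r' = "\<lambda>y. - (inverse y ^ Suc (Suc 0))"])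
  show "continuous_on S (\<lambda>x. - (inverse (f x) ^ Suc (Suc 0)))"
    using assms by (intro continuous_intros C1_continuous) auto
qed (use DERIV_inverse assms(2) in blast)

text \<open>An odd root is differentiable on both sides of zero. This matters because the volume
  factor obtained from it may be negative in a chart.\<close>

lemma C1_root3:
  assumes "C1 S f" "\<And>x. x \<in> S \<Longrightarrow> f x \<noteq> 0"
  shows "C1 S (\<lambda>x. root 3 (f x))"
proof (rule C1_compose[OF assms(1), where r' = "\<lambda>y. inverse (real 3 * root 3 y ^ (3 - Suc 0))"])
  show "(root 3 has_real_derivative inverse (real 3 * root 3 (f x) ^ (3 - Suc 0))) (at (f x))" if "x \<in> S" for x
    by (rule DERIV_odd_real_root) (use assms(2) that in auto)
  show "continuous_on S (\<lambda>x. inverse (real 3 * root 3 (f x) ^ (3 - Suc 0)))"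
    using assms by (intro continuous_intros C1_continuous) auto
qed

lemma C1_diff: "C1 S f \<Longrightarrow> C1 S g \<Longrightarrow> C1 S (\<lambda>x. f x - g x)"
  using C1_add[of S f "\<lambda>x. -1 * g x"] C1_mult[OF C1_const[of S "-1"], of g] by (simp del: C_on.simps)

lemma C1_wedge:
  assumes "\<And>vs. C1 S (\<lambda>x. \<alpha> x vs)" "\<And>vs. C1 S (\<lambda>x. \<beta> x vs)"
  shows "C1 S (\<lambda>x. (\<alpha> x \<and>\<^sub>\<Lambda> \<beta> x) vs)"
  unfolding wedge_def by (intro C1_sum C1_mult C1_const assms)

lemma C1_det:
  fixes M :: "real^7 \<Rightarrow> real^7^7"
  assumes "\<And>i j. C1 S (\<lambda>x. M x $ i $ j)"
  shows "C1 S (\<lambda>x. det (M x))"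
  unfolding det_def by (intro C1_sum C1_mult C1_prod C1_const assms)

text \<open>Cramer's rule: every entry of the inverse is a quotient of determinants, which are
  polynomials in the entries.\<close>

lemma C1_matrix_inv:
  fixes M :: "real^7 \<Rightarrow> real^7^7"
  assumes "\<And>i j. C1 S (\<lambda>x. M x $ i $ j)" "\<And>x. x \<in> S \<Longrightarrow> det (M x) \<noteq> 0" "open S"
  shows "C1 S (\<lambda>x. matrix_inv (M x) $ k $ l)"
proof (rule C1_cong[OF _ assms(3)])
  let ?N = "\<lambda>x. (\<chi> i j. if j = k then (axis l 1 :: real^7) $ i else M x $ i $ j) :: real^7^7"
  have "C1 S (\<lambda>x. ?N x $ i $ j)" for i j
    by (cases "j = k") (use assms(1) C1_const in \<open>simp_all del: C_on.simps\<close>)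
  then show "C1 S (\<lambda>x. det (?N x) * inverse (det (M x)))"
    by (intro C1_mult C1_inverse C1_det assms(1,2))
  show "det (?N x) * inverse (det (M x)) = matrix_inv (M x) $ k $ l" if x: "x \<in> S" for x
  proof -
    obtain B where B: "M x ** B = mat 1" "B ** M x = mat 1"
      using assms(2)[OF x] by (auto simp: invertible_det_nz[symmetric] invertible_def)
    then have inv: "matrix_inv (M x) = B" by (rule matrix_inv_eq)
    have "M x *v (B *v axis l 1) = axis l 1" using B by (simp add: matrix_vector_mul_assoc)
    then have "B *v axis l 1 = (\<chi> k. det (\<chi> i j. if j = k then (axis l 1 :: real^7) $ i else M x $ i $ j) / det (M x))"
      by (rule cramer[OF assms(2)[OF x], THEN iffD1])
    then have "(B *v axis l 1) $ k = det (?N x) / det (M x)" by simp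
    moreover have "(B *v axis l 1) $ k = B $ k $ l"
      by (simp add: matrix_vector_mult_def axis_def if_distrib cong: if_cong)
    ultimately show ?thesis by (simp add: inv divide_inverse)
  qed
qed

abbreviation std_list :: "(real^7) list" where
  "std_list \<equiv> map std_vec [0..<7]"

lemma std_vec_spans: "\<exists>c. v = (\<Sum>n<7. c n *\<^sub>R std_vec n)"
  by (rule exI) (rule std_vec_expand)

lemma covector_7_proportional:
  assumes "is_covector 7 \<alpha>" "is_covector 7 \<beta>" "\<beta> std_list = 1"
  shows "\<alpha> xs = \<alpha> std_list * \<beta> xs"
proof -
  from covector_7_eq_0[OF covector_diff[OF assms(1) covector_scale[OF assms(2)]] std_vec_spans, of "\<alpha> std_list" xs]
  show ?thesis using assms(3) by simp
qed

lemma inner_1_std: "covector_inner g 1 \<alpha> \<beta> =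
   (\<Sum>i\<in>UNIV. \<Sum>j\<in>UNIV. inverse_metric g $ i $ j * \<alpha> [axis i 1] * \<beta> [axis j 1])"
proof -
  have "{I :: 7 list. length I = 1} = (\<lambda>i. [i]) ` UNIV" by (auto simp: length_Suc_conv)
  then show ?thesis
    unfolding covector_inner_def by (simp add: sum.reindex inj_on_def lessThan_Suc)
qed

context metric_frame
begin

lemma inverse_metric_gram: "G ** inverse_metric g = mat 1" "inverse_metric g ** G = mat 1"
  using PPG matrix_left_right_inverse[of "P ** transpose P" G] by (auto simp: inverse_metric_mat)

end

section \<open>A G2-structure on an open set of coordinates\<close>

locale g2_domain =
  fixes S :: "(real^7) set" and \<phi> :: "real^7 \<Rightarrow> covector"
  assumes open_S: "open S"
    and covector_\<phi>: "\<And>u. u \<in> S \<Longrightarrow> is_covector 3 (\<phi> u)"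
    and C1_\<phi>: "\<And>vs. C1 S (\<lambda>u. \<phi> u vs)"
    and model: "\<And>u. u \<in> S \<Longrightarrow> \<exists>L. linear L \<and> bij L \<and> (\<forall>vs. \<phi> u vs = phi0 (map L vs))"
begin

abbreviation "gm u \<equiv> g2_metric (\<phi> u)"
abbreviation "vl u \<equiv> g2_vol (\<phi> u)"

lemma frame: "u \<in> S \<Longrightarrow> \<exists>E. g2_frame (gm u) E (\<phi> u) (vl u)"
  using model covector_\<phi> g2_point by metis

text \<open>In coordinates \<open>\<phi>\<close> gives directly only the product of the metric with the volume factor \<open>v\<close>. The
  factor itself is recovered from \<open>|\<phi>|\<^sup>2 = 7\<close>, which is cubic in the inverse metric.\<close>

definition vol_metric :: "real^7 \<Rightarrow> real^7^7" where
  "vol_metric u = (\<chi> i j. 1/6 * ((axis i 1 \<lrcorner> \<phi> u) \<and>\<^sub>\<Lambda> (axis j 1 \<lrcorner> \<phi> u) \<and>\<^sub>\<Lambda> \<phi> u) std_list)"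

definition phi_square :: "real^7 \<Rightarrow> real" where
  "phi_square u = (\<Sum>I\<in>{I :: 7 list. length I = 3}. \<Sum>J\<in>{J :: 7 list. length J = 3}.
        (\<Prod>l<3. matrix_inv (vol_metric u) $ (I ! l) $ (J ! l)) *
        \<phi> u (map (\<lambda>i. axis i 1) I) * \<phi> u (map (\<lambda>j. axis j 1) J)) / fact 3"

lemma vol_metric_facts:
  assumes "u \<in> S"
  shows "vl u std_list \<noteq> 0" "det (vol_metric u) \<noteq> 0"
    "inverse_metric (gm u) = vl u std_list *\<^sub>R matrix_inv (vol_metric u)" "(vl u std_list) ^ 3 * phi_square u = 7"
proof -
  obtain E where "g2_frame (gm u) E (\<phi> u) (vl u)" using frame[OF assms] by blast
  then interpret g2_frame "gm u" E "\<phi> u" "vl u" .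
  let ?v = "vl u std_list"
  from covector_7_eq_0[OF covector_vol std_vec_spans] show v: "?v \<noteq> 0" using vol_frame by fastforce
  have vol_metric: "vol_metric u = ?v *\<^sub>R G"
    by (simp add: vol_metric_def vec_eq_iff metric_relation)
  have "matrix_inv (vol_metric u) = (1 / ?v) *\<^sub>R inverse_metric (gm u)"
    using inverse_metric_gram v
    by (intro matrix_inv_eq) (simp_all add: vol_metric matrix_scalar_ac scalar_matrix_assoc flip: scalar_mult_eq_scaleR)
  then show inv: "inverse_metric (gm u) = ?v *\<^sub>R matrix_inv (vol_metric u)" using v by simp
  have "vol_metric u ** ((1 / ?v) *\<^sub>R inverse_metric (gm u)) = mat 1"
    using inverse_metric_gram v by (simp add: vol_metric matrix_scalar_ac scalar_matrix_assoc flip: scalar_mult_eq_scaleR)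
  then show "det (vol_metric u) \<noteq> 0"
    unfolding invertible_det_nz[symmetric] invertible_right_inverse by blast
  \<comment> \<open>The squared norm of a 3-form contains three inverse metrics, each contributing
    one factor \<open>?v\<close>.\<close>
  show "?v ^ 3 * phi_square u = 7"
    using inner_\<phi>_\<phi> unfolding covector_inner_def inv phi_square_def
    by (simp add: prod.distrib mult.assoc flip: sum_distrib_left)
qed

lemma C1_vol_metric: "C1 S (\<lambda>u. vol_metric u $ i $ j)"
  unfolding vol_metric_def vec_lambda_beta
  by (rule C1_mult[OF C1_const], rule C1_wedge[OF _ C1_wedge]) (simp_all only: int_prod_def C1_\<phi>)

lemma C1_phi_square: "C1 S phi_square"
  unfolding phi_square_def[abs_def] divide_inverse
  by (intro C1_mult C1_sum C1_prod C1_\<phi> C1_const C1_matrix_inv C1_vol_metric vol_metric_facts(2) open_S)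

lemma C1_vl_std: "C1 S (\<lambda>u. vl u std_list)"
proof (rule C1_cong[OF _ open_S])
  have nz: "phi_square u \<noteq> 0" if "u \<in> S" for u using vol_metric_facts(4)[OF that] by auto
  show "C1 S (\<lambda>u. root 3 (7 * inverse (phi_square u)))"
    by (intro C1_root3 C1_mult C1_const C1_inverse C1_phi_square nz) (use nz in auto)
  show "root 3 (7 * inverse (phi_square u)) = vl u std_list" if "u \<in> S" for u
  proof -
    have "7 * inverse (phi_square u) = (vl u std_list) ^ 3"
      using vol_metric_facts(4)[OF that] nz[OF that] by (simp add: field_simps)
    then show ?thesis by (simp add: odd_real_root_power_cancel)
  qed
qed

lemma C1_inverse_metric: "C1 S (\<lambda>u. inverse_metric (gm u) $ i $ j)"
proof (rule C1_cong[OF _ open_S])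
  show "C1 S (\<lambda>u. vl u std_list * matrix_inv (vol_metric u) $ i $ j)"
    by (intro C1_mult C1_vl_std C1_matrix_inv C1_vol_metric vol_metric_facts open_S)
qed (simp add: vol_metric_facts)

text \<open>The volume form depends on the point through one scalar only. The constant
  \<open>\<omega>\<close> is the coordinate determinant, obtained by normalising the volume form at
  an arbitrary point.\<close>

lemma vl_const: "\<exists>\<omega>. is_covector 7 \<omega> \<and> \<omega> std_list = 1 \<and> (\<forall>y\<in>S. \<forall>xs. vl y xs = vl y std_list * \<omega> xs)"
  if ne: "S \<noteq> {}"
proof -
  have cov: "is_covector 7 (vl y)" if y: "y \<in> S" for y
  proof -
    obtain E where "g2_frame (gm y) E (\<phi> y) (vl y)" using frame[OF y] by blast
    then interpret g2_frame "gm y" E "\<phi> y" "vl y" .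
    show ?thesis by (rule covector_vol)
  qed
  obtain u where u: "u \<in> S" using ne by blast
  define \<omega> where "\<omega> xs = (1 / vl u std_list) * vl u xs" for xs
  have "is_covector 7 \<omega>" unfolding \<omega>_def[abs_def] by (intro covector_scale cov u)
  moreover have "\<omega> std_list = 1" using vol_metric_facts(1)[OF u] by (simp add: \<omega>_def)
  ultimately show ?thesis using covector_7_proportional[OF cov] by blast
qed

lemma C1_vl: "C1 S (\<lambda>u. vl u xs)"
proof (cases "S = {}")
  case False
  then obtain \<omega> where \<omega>: "\<forall>y\<in>S. \<forall>xs. vl y xs = vl y std_list * \<omega> xs" using vl_const by blast
  show ?thesis
    by (rule C1_cong[OF C1_mult[OF C1_vl_std C1_const[of _ "\<omega> xs"]] open_S]) (use \<omega> in metis)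
qed simp

lemma C1_inner:
  assumes "\<And>vs. C1 S (\<lambda>u. \<alpha> u vs)" "\<And>vs. C1 S (\<lambda>u. \<beta> u vs)"
  shows "C1 S (\<lambda>u. covector_inner (gm u) k (\<alpha> u) (\<beta> u))"
  unfolding covector_inner_def divide_inverse
  by (intro C1_mult C1_sum C1_prod C1_const C1_inverse_metric assms)

lemma C1_contract:
  assumes "\<And>vs. C1 S (\<lambda>u. \<alpha> u vs)" "\<And>vs. C1 S (\<lambda>u. \<beta> u vs)"
  shows "C1 S (\<lambda>u. contract (gm u) (\<alpha> u) (\<beta> u) vs)"
  unfolding contract_def int_prod_def
  by (intro C1_mult C1_sum C1_inverse_metric assms)

lemma hodge_eq_inner:
  assumes "u \<in> S" "is_covector k \<beta>" "k \<le> 7"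
  shows "hodge (gm u) (vl u) k \<beta> ws = covector_inner (gm u) k \<beta> (\<lambda>as. vl u (as @ ws))"
proof -
  obtain E where "g2_frame (gm u) E (\<phi> u) (vl u)" using frame[OF assms(1)] by blast
  then interpret g2_frame "gm u" E "\<phi> u" "vl u" .
  show ?thesis by (rule hodge_inner[OF assms(2) covector_vol assms(3) vol_nz])
qed

lemma C1_hodge:
  assumes "\<And>u. u \<in> S \<Longrightarrow> is_covector k (\<beta> u)" "\<And>vs. C1 S (\<lambda>u. \<beta> u vs)" "k \<le> 7"
  shows "C1 S (\<lambda>u. hodge (gm u) (vl u) k (\<beta> u) ws)"
proof (rule C1_cong[OF _ open_S])
  show "C1 S (\<lambda>u. covector_inner (gm u) k (\<beta> u) (\<lambda>as. vl u (as @ ws)))"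
    by (intro C1_inner assms(2) C1_vl)
qed (simp add: hodge_eq_inner assms)

text \<open>First-order coefficients of the Laplace-Beltrami operator,
  \<open>(1/v) * \<Sum>k. d_k (v * g^ik)\<close>. Here \<open>v\<close>, the volume form on the
  standard basis, equals the square root of the metric determinant up to a sign that
  cancels.\<close>

definition drift :: "real^7 \<Rightarrow> real^7" where
  "drift u = (\<chi> i. (\<Sum>k\<in>UNIV. frechet_derivative (\<lambda>y. vl y std_list * inverse_metric (gm y) $ i $ k) (at u) (axis k 1))
      / vl u std_list)"

lemma continuous_on_drift: "continuous_on S drift"
  unfolding drift_def[abs_def]
  by (intro continuous_intros C1_continuous[OF C1_vl_std] vol_metric_facts ballI
      C1_continuous_derivative C1_mult C1_vl_std C1_inverse_metric)

text \<open>The divergence form of the Laplacian, expanded by the product rule into a trace of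
  second derivatives and the drift. The frame is frozen at \<open>u\<close>, so its vectors are
  never differentiated.\<close>

lemma d_star_d_coordinates:
  assumes u: "u \<in> S" and F: "C1 S F" "\<And>v. C1 S (\<lambda>x. frechet_derivative F (at x) v)"
    and E: "g2_frame (gm u) E (\<phi> u) (vl u)"
  shows "form_d (\<lambda>y. hodge (gm y) (vl y) 1 (form_d (\<lambda>z. fun_covector (F z)) y)) u std_list =
    vl u std_list * ((\<Sum>n<7. frechet_derivative (\<lambda>y. frechet_derivative F (at y) (E n)) (at u) (E n)) +
      frechet_derivative F (at u) (drift u))"
proof -
  interpret g2_frame "gm u" E "\<phi> u" "vl u" by (rule E)
  let ?h = "\<lambda>y. hodge (gm y) (vl y) 1 (form_d (\<lambda>z. fun_covector (F z)) y)"
  let ?D = "\<lambda>y v. frechet_derivative F (at y) v"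
  let ?m = "\<lambda>y i k. vl y std_list * inverse_metric (gm y) $ i $ k"
  let ?w = "\<lambda>k. take k std_list @ drop (Suc k) std_list"
  obtain \<omega> where \<omega>: "is_covector 7 \<omega>" "\<omega> std_list = 1" "\<And>y xs. y \<in> S \<Longrightarrow> vl y xs = vl y std_list * \<omega> xs"
    using vl_const u by blast
  have lin: "linear (?D y)" if "y \<in> S" for y
    by (rule linear_frechet_derivative[OF C1_differentiable[OF F(1) that]])
  have \<omega>w: "\<omega> (axis j 1 # ?w k) = (if j = of_nat k then (-1) ^ k else 0)" if "k < 7" for j k
  proof (cases "j = of_nat k")
    case True
    have "std_list = take k std_list @ std_vec k # drop (Suc k) std_list"
      using that id_take_nth_drop[of k std_list] by simp
    then have "1 = (-1) ^ k * \<omega> (std_vec k # ?w k)"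
      using covector_move[OF \<omega>(1), of "take k std_list" "std_vec k" "drop (Suc k) std_list"] \<omega>(2) that by simp
    then have "(-1) ^ k * 1 = (-1) ^ k * ((-1) ^ k * \<omega> (std_vec k # ?w k))" by simp
    then show ?thesis using True by (simp add: std_vec_def flip: mult.assoc power_mult_distrib)
  next
    case False
    obtain n where n: "n < 7" "j = of_nat n"
      using bij_betw_of_nat_7 by (metis UNIV_I bij_betw_imp_surj_on imageE lessThan_iff)
    have "n < k \<or> Suc k \<le> n" using False n(2) by (cases n k rule: linorder_cases) auto
    moreover have "std_vec n \<in> set (take k std_list)" if "n < k"
      using that \<open>k < 7\<close> by (force simp: in_set_conv_nth)
    moreover have "std_vec n \<in> set (drop (Suc k) std_list)" if "Suc k \<le> n"
      using that n(1) by (force simp: drop_map)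
    ultimately have "std_vec n \<in> set (?w k)" by auto
    then show ?thesis using False n(2) covector_not_distinct[OF \<omega>(1), of "axis j 1 # ?w k"]
      by (simp add: std_vec_def)
  qed
  \<comment> \<open>The sign \<open>(-1) ^ k\<close> of this component of the star cancels the one
    in the exterior derivative, leaving a plain divergence.\<close>
  have h: "?h y (?w k) = (-1) ^ k * (\<Sum>i\<in>UNIV. ?m y i (of_nat k) * ?D y (axis i 1))"
    if "y \<in> S" "k < 7" for y k
  proof -
    have "?h y (?w k) = (\<Sum>i\<in>UNIV. \<Sum>j\<in>UNIV. inverse_metric (gm y) $ i $ j * ?D y (axis i 1) * vl y (axis j 1 # ?w k))"
      using that covector_form_d_fun_covector[OF C1_differentiable[OF F(1) that(1)]]
      by (simp add: hodge_eq_inner inner_1_std form_d_fun_covector del: One_nat_def)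
    also have "\<dots> = (\<Sum>i\<in>UNIV. inverse_metric (gm y) $ i $ of_nat k * ?D y (axis i 1) * (vl y std_list * (-1) ^ k))"
      unfolding \<omega>(3)[OF that(1), of "_ # _"] \<omega>w[OF that(2)] by (simp add: if_distrib cong: if_cong)
    finally show ?thesis by (simp add: sum_distrib_left mult_ac)
  qed
  have "form_d ?h u std_list = (\<Sum>k<7. (-1) ^ k * frechet_derivative (\<lambda>y. ?h y (?w k)) (at u) (std_vec k))"
    by (simp add: form_d_def)
  also have "\<dots> = (\<Sum>k<7. \<Sum>i\<in>UNIV. frechet_derivative (\<lambda>y. ?m y i (of_nat k)) (at u) (std_vec k) * ?D u (axis i 1) +
      ?m u i (of_nat k) * frechet_derivative (\<lambda>y. ?D y (axis i 1)) (at u) (std_vec k))"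
  proof (intro sum.cong refl)
    fix k :: nat assume k: "k \<in> {..<7}"
    have m1: "C1 S (\<lambda>y. ?m y i (of_nat k))" for i by (intro C1_mult C1_vl_std C1_inverse_metric)
    have "((\<lambda>y. (-1) ^ k * (\<Sum>i\<in>UNIV. ?m y i (of_nat k) * ?D y (axis i 1))) has_derivative
       (\<lambda>v. (-1) ^ k * (\<Sum>i\<in>UNIV. ?m u i (of_nat k) * frechet_derivative (\<lambda>y. ?D y (axis i 1)) (at u) v +
          frechet_derivative (\<lambda>y. ?m y i (of_nat k)) (at u) v * ?D u (axis i 1)))) (at u)"
      by (intro has_derivative_mult_right has_derivative_sum has_derivative_mult
          C1_has_derivative[OF m1 u] C1_has_derivative[OF F(2) u])
    from frechet_derivative_eq[OF this] frechet_derivative_cong[OF open_S u, of "\<lambda>y. ?h y (?w k)"] h k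
    show "(-1) ^ k * frechet_derivative (\<lambda>y. ?h y (?w k)) (at u) (std_vec k) =
       (\<Sum>i\<in>UNIV. frechet_derivative (\<lambda>y. ?m y i (of_nat k)) (at u) (std_vec k) * ?D u (axis i 1) +
      ?m u i (of_nat k) * frechet_derivative (\<lambda>y. ?D y (axis i 1)) (at u) (std_vec k))"
      by (simp add: add.commute flip: mult.assoc power_mult_distrib)
  qed
  also have "\<dots> = (\<Sum>k\<in>UNIV. \<Sum>i\<in>UNIV. frechet_derivative (\<lambda>y. ?m y i k) (at u) (axis k 1) * ?D u (axis i 1) +
      ?m u i k * frechet_derivative (\<lambda>y. ?D y (axis i 1)) (at u) (axis k 1))"
    by (simp add: sum_UNIV_7[of "\<lambda>k. \<Sum>i\<in>UNIV. _ i k"] std_vec_def)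
  also have "\<dots> = (\<Sum>i\<in>UNIV. (\<Sum>k\<in>UNIV. frechet_derivative (\<lambda>y. ?m y i k) (at u) (axis k 1)) * ?D u (axis i 1)) +
      vl u std_list * (\<Sum>i\<in>UNIV. \<Sum>k\<in>UNIV. inverse_metric (gm u) $ i $ k * frechet_derivative (\<lambda>y. ?D y (axis i 1)) (at u) (axis k 1))"
    by (subst sum.swap) (simp add: sum.distrib sum_distrib_left sum_distrib_right mult_ac)
  also have "(\<Sum>i\<in>UNIV. (\<Sum>k\<in>UNIV. frechet_derivative (\<lambda>y. ?m y i k) (at u) (axis k 1)) * ?D u (axis i 1)) =
      vl u std_list * ?D u (drift u)"
  proof -
    have "?D u v = (\<Sum>i\<in>UNIV. v $ i * ?D u (axis i 1))" for v
      using linear_sum[OF lin[OF u], of "\<lambda>i. v $ i *\<^sub>R axis i 1" UNIV] basis_expansion[of v]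
      by (simp add: linear_cmul[OF lin[OF u]] scalar_mult_eq_scaleR)
    from this[of "drift u"] show ?thesis using vol_metric_facts(1)[OF u]
      by (simp add: drift_def sum_distrib_left)
  qed
  \<comment> \<open>Writing the inverse metric as a sum over the frame turns the coordinate trace
    into second derivatives along frame vectors, the form used by the minimum principle.\<close>
  also have "(\<Sum>i\<in>UNIV. \<Sum>k\<in>UNIV. inverse_metric (gm u) $ i $ k * frechet_derivative (\<lambda>y. ?D y (axis i 1)) (at u) (axis k 1)) =
      (\<Sum>n<7. frechet_derivative (\<lambda>y. ?D y (E n)) (at u) (E n))"
  proof -
    have "frechet_derivative (\<lambda>y. ?D y v) (at u) w =
        (\<Sum>i\<in>UNIV. \<Sum>k\<in>UNIV. v $ i * w $ k * frechet_derivative (\<lambda>y. ?D y (axis i 1)) (at u) (axis k 1))" for v w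
    proof -
      have "?D y v = (\<Sum>i\<in>UNIV. v $ i * ?D y (axis i 1))" if "y \<in> S" for y
        using linear_sum[OF lin[OF that], of "\<lambda>i. v $ i *\<^sub>R axis i 1" UNIV] basis_expansion[of v]
        by (simp add: linear_cmul[OF lin[OF that]] scalar_mult_eq_scaleR)
      then have "frechet_derivative (\<lambda>y. ?D y v) (at u) = frechet_derivative (\<lambda>y. \<Sum>i\<in>UNIV. v $ i * ?D y (axis i 1)) (at u)"
        by (rule frechet_derivative_cong[OF open_S u])
      moreover have "((\<lambda>y. \<Sum>i\<in>UNIV. v $ i * ?D y (axis i 1)) has_derivative
          (\<lambda>w. \<Sum>i\<in>UNIV. v $ i * frechet_derivative (\<lambda>y. ?D y (axis i 1)) (at u) w)) (at u)"
        by (intro has_derivative_sum has_derivative_mult_right C1_has_derivative[OF F(2) u])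
      ultimately have "frechet_derivative (\<lambda>y. ?D y v) (at u) w =
          (\<Sum>i\<in>UNIV. v $ i * frechet_derivative (\<lambda>y. ?D y (axis i 1)) (at u) w)"
        by (simp add: frechet_derivative_eq)
      moreover have "frechet_derivative (\<lambda>y. ?D y (axis i 1)) (at u) w =
          (\<Sum>k\<in>UNIV. w $ k * frechet_derivative (\<lambda>y. ?D y (axis i 1)) (at u) (axis k 1))" for i
      proof -
        have l: "linear (frechet_derivative (\<lambda>y. ?D y (axis i 1)) (at u))"
          by (rule linear_frechet_derivative[OF C1_differentiable[OF F(2) u]])
        show ?thesis
          using linear_sum[OF l, of "\<lambda>i. w $ i *\<^sub>R axis i 1" UNIV] basis_expansion[of w]
          by (simp add: linear_cmul[OF l] scalar_mult_eq_scaleR)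
      qed
      ultimately show ?thesis by (simp add: sum_distrib_left mult_ac)
    qed
    note this[of "E _" "E _"]
    then have "(\<Sum>n<7. frechet_derivative (\<lambda>y. ?D y (E n)) (at u) (E n)) =
       (\<Sum>n<7. \<Sum>i\<in>UNIV. \<Sum>k\<in>UNIV. E n $ i * E n $ k * frechet_derivative (\<lambda>y. ?D y (axis i 1)) (at u) (axis k 1))"
      by simp
    also have "\<dots> = (\<Sum>i\<in>UNIV. \<Sum>k\<in>UNIV. \<Sum>n<7. E n $ i * E n $ k * frechet_derivative (\<lambda>y. ?D y (axis i 1)) (at u) (axis k 1))"
      by (subst sum.swap, subst (2) sum.swap) simp
    finally show ?thesis by (simp add: inverse_metric_eq sum_distrib_right)
  qed
  finally show ?thesis by (simp add: distrib_left)
qed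

end

section \<open>The strong maximum principle\<close>

text \<open>A negative second derivative would make \<open>g'\<close> negative just to the right of
  0, and the mean value theorem would push \<open>g\<close> below its minimum.\<close>

lemma second_derivative_test:
  fixes g g' :: "real \<Rightarrow> real"
  assumes "d > 0" and g: "\<And>t. \<bar>t\<bar> < d \<Longrightarrow> (g has_real_derivative g' t) (at t)"
    and s: "(g' has_real_derivative s) (at 0)" and min: "\<And>t. \<bar>t\<bar> < d \<Longrightarrow> g 0 \<le> g t"
  shows "g' 0 = 0" "s \<ge> 0"
proof -
  show 0: "g' 0 = 0"
    using DERIV_local_min[OF g[of 0] \<open>d > 0\<close>] min \<open>d > 0\<close> by simp
  show "s \<ge> 0"
  proof (rule ccontr)
    assume "\<not> s \<ge> 0"
    then obtain e where e: "e > 0" "\<And>h. 0 < h \<Longrightarrow> h < e \<Longrightarrow> g' h < 0"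
      using DERIV_neg_dec_right[OF s] 0 by auto
    define h where "h = min d e / 2"
    have h: "0 < h" "h < d" "h < e" using e \<open>d > 0\<close> by (auto simp: h_def)
    have "\<exists>z>0. z < h \<and> g h - g 0 = (h - 0) * g' z"
      by (rule MVT2) (use h in \<open>auto intro!: g\<close>)
    then obtain z where "0 < z" "z < h" "g h - g 0 = h * g' z" by auto
    moreover have "h * g' z < 0" using e(2)[of z] \<open>0 < z\<close> \<open>z < h\<close> h by (simp add: mult_pos_neg)
    ultimately show False using min[of h] h by simp
  qed
qed

text \<open>The ball with diameter from \<open>q\<close> to \<open>y\<close> touches the sphere
  about \<open>q\<close> through \<open>y\<close> from inside, at \<open>y\<close> alone. This
  provides a touching ball with a single contact point.\<close>

lemma tangent_ball:
  fixes q y x :: "'a::real_inner"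
  assumes "dist ((1/2) *\<^sub>R (q + y)) x \<le> dist q y / 2" "x \<noteq> y"
  shows "dist q x < dist q y"
proof (rule ccontr)
  define w s where "w = (1/2) *\<^sub>R (y - q)" and "s = x - (1/2) *\<^sub>R (q + y)"
  assume "\<not> dist q x < dist q y"
  have e: "x - q = w + s" "y - q = 2 *\<^sub>R w" "y - x = w - s"
    by (auto simp: w_def s_def algebra_simps) (simp_all add: scaleR_left_distrib[symmetric] flip: scaleR_2)
  have "norm s \<le> norm w" using assms(1)
    by (simp add: s_def w_def dist_norm norm_minus_commute)
  then have 1: "s \<bullet> s \<le> w \<bullet> w" by (simp add: norm_le)
  have "norm (2 *\<^sub>R w) \<le> norm (w + s)"
    using \<open>\<not> dist q x < dist q y\<close> e by (metis dist_commute dist_norm not_le)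
  then have "4 * (w \<bullet> w) \<le> w \<bullet> w + 2 * (w \<bullet> s) + s \<bullet> s"
    by (simp add: norm_le inner_add_left inner_add_right inner_commute del: norm_scaleR)
  then have "(w - s) \<bullet> (w - s) \<le> 0"
    using 1 by (simp add: inner_diff_left inner_diff_right inner_commute)
  then have "w - s = 0" by (metis inner_eq_zero_iff inner_ge_zero order_antisym)
  then show False using e(3) assms(2) by simp
qed

lemma has_real_derivative_along_line:
  fixes F :: "'a::real_normed_vector \<Rightarrow> real"
  assumes "F differentiable (at (z + t *\<^sub>R v))"
  shows "((\<lambda>t. F (z + t *\<^sub>R v)) has_real_derivative frechet_derivative F (at (z + t *\<^sub>R v)) v) (at t)"
proof -
  let ?D = "frechet_derivative F (at (z + t *\<^sub>R v))"
  have "((\<lambda>t. z + t *\<^sub>R v) has_derivative (\<lambda>s. s *\<^sub>R v)) (at t)"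
    by (auto intro!: derivative_eq_intros)
  from has_derivative_compose[OF this assms[unfolded frechet_derivative_works]]
  have "((\<lambda>t. F (z + t *\<^sub>R v)) has_derivative (\<lambda>s. ?D (s *\<^sub>R v))) (at t)" .
  moreover have "(\<lambda>s. ?D (s *\<^sub>R v)) = (*) (?D v)"
    by (rule ext) (simp add: linear_cmul[OF linear_frechet_derivative[OF assms]])
  ultimately show ?thesis by (simp add: has_field_derivative_def)
qed

text \<open>The comparison function of Hopf's argument is \<open>exp (- \<alpha> |x - q|\<^sup>2)\<close>, on a small ball around a
  boundary point \<open>y\<close> of the set where \<open>F > m\<close>; subtracting a small multiple of it moves the minimum
  into the interior.\<close>

lemma strong_minimum_principle_local:
  fixes F :: "'a::euclidean_space \<Rightarrow> real" and E :: "'a \<Rightarrow> nat \<Rightarrow> 'a" and b :: "'a \<Rightarrow> 'a"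
  assumes "open S"
    and F1: "\<And>x. x \<in> S \<Longrightarrow> F differentiable (at x)"
    and F2: "\<And>x v. x \<in> S \<Longrightarrow> (\<lambda>y. frechet_derivative F (at y) v) differentiable (at x)"
    and a: "\<And>i j. i \<in> Basis \<Longrightarrow> j \<in> Basis \<Longrightarrow> continuous_on S (\<lambda>x. \<Sum>n<N. (E x n \<bullet> i) * (E x n \<bullet> j))"
    and b: "continuous_on S b"
    and elliptic: "\<And>x \<xi>. x \<in> S \<Longrightarrow> \<xi> \<noteq> 0 \<Longrightarrow> \<exists>n<N. E x n \<bullet> \<xi> \<noteq> 0"
    and super: "\<And>x. x \<in> S \<Longrightarrow> (\<Sum>n<N. frechet_derivative (\<lambda>y. frechet_derivative F (at y) (E x n)) (at x) (E x n)) +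
       frechet_derivative F (at x) (b x) \<le> 0"
    and m: "\<And>x. x \<in> S \<Longrightarrow> m \<le> F x" and "F p = m" and "cball p (2 * r) \<subseteq> S" and q: "dist p q < r"
  shows "F q = m"
proof (rule ccontr)
  assume "F q \<noteq> m"
  have contF: "continuous_on S F"
    by (intro continuous_at_imp_continuous_on ballI differentiable_imp_continuous_within F1)
  have "r > 0" using q zero_le_dist[of p q] by linarith
  \<comment> \<open>The radius \<open>2 * r\<close> leaves room: the ball about \<open>q\<close>
    reaching to the nearest point of \<open>K\<close> has radius below \<open>r\<close>, so it stays
    inside this larger ball.\<close>
  define K where "K = {x \<in> cball p (2 * r). F x = m}"
  have "closedin (top_of_set (cball p (2 * r))) K"
    unfolding K_def using continuous_closedin_preimage_constant[OF continuous_on_subset[OF contF \<open>cball p (2 * r) \<subseteq> S\<close>]]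
    by simp
  then have "compact K" using closedin_compact compact_cball by blast
  moreover have "p \<in> K" using \<open>F p = m\<close> \<open>r > 0\<close> by (simp add: K_def)
  moreover have "continuous_on K (dist q)" by (intro continuous_intros)
  ultimately obtain y where y: "y \<in> K" "\<And>x. x \<in> K \<Longrightarrow> dist q y \<le> dist q x"
    using continuous_attains_inf[of K "dist q"] by auto
  define \<rho> where "\<rho> = dist q y"
  have "\<rho> < r" using y(2)[OF \<open>p \<in> K\<close>] q by (simp add: \<rho>_def dist_commute)
  have "q \<in> S" using q \<open>cball p (2 * r) \<subseteq> S\<close> \<open>r > 0\<close> by (auto simp: subset_iff)
  have "\<rho> > 0" using y(1) \<open>F q \<noteq> m\<close> by (auto simp: \<rho>_def K_def)
  have Fgt: "F x > m" if "dist q x < \<rho>" for x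
  proof -
    have "dist p x \<le> dist p q + dist q x" by (rule dist_triangle)
    then have "x \<in> cball p (2 * r)" using that q \<open>\<rho> < r\<close> by simp
    moreover have "x \<notin> K" using y(2)[of x] that by (auto simp: \<rho>_def)
    ultimately show ?thesis using m[of x] \<open>cball p (2 * r) \<subseteq> S\<close> by (auto simp: K_def order_less_le)
  qed
  have "y \<in> S" using y(1) \<open>cball p (2 * r) \<subseteq> S\<close> by (auto simp: K_def)
  have "F y = m" using y(1) by (simp add: K_def)
  \<comment> \<open>Halving the ball keeps \<open>F > m\<close> on its whole boundary except at
    \<open>y\<close>.\<close>
  define c where "c = (1/2) *\<^sub>R (q + y)"
  have cy: "dist c y = \<rho> / 2"
  proof -
    have "c - y = (1/2) *\<^sub>R (q - y)" by (simp add: c_def algebra_simps flip: scaleR_left_distrib)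
    then show ?thesis by (simp add: \<rho>_def dist_norm)
  qed
  have ball: "F x > m" if "dist c x \<le> \<rho> / 2" "x \<noteq> y" for x
    using tangent_ball[of q y x] that Fgt[of x] by (simp add: c_def \<rho>_def)
  obtain \<delta>0 where "\<delta>0 > 0" "cball y \<delta>0 \<subseteq> S"
    using \<open>open S\<close> \<open>y \<in> S\<close> open_contains_cball by blast
  \<comment> \<open>Being smaller than \<open>\<rho> / 2\<close>, the radius keeps the centre
    \<open>c\<close> away, where the gradient of the comparison function vanishes.\<close>
  define \<delta> where "\<delta> = min \<delta>0 (\<rho> / 4)"
  have \<delta>: "\<delta> > 0" "cball y \<delta> \<subseteq> S" "\<delta> < \<rho> / 2"
    using \<open>\<delta>0 > 0\<close> \<open>cball y \<delta>0 \<subseteq> S\<close> \<open>\<rho> > 0\<close> by (auto simp: \<delta>_def)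
  let ?B = "cball y \<delta>"
  have Bne: "?B \<noteq> {}" using \<delta> by simp
  have cB: "c \<notin> ?B" using cy \<delta> by (simp add: dist_commute)
  \<comment> \<open>Applied to \<open>exp (- \<alpha> * |x - c|^2)\<close>, the operator yields the
    same exponential times \<open>4 * \<alpha>\<^sup>2 * A x - 2 * \<alpha> * T x\<close>.\<close>
  define A where "A x = (\<Sum>n<N. (E x n \<bullet> (x - c))\<^sup>2)" for x
  define T where "T x = (\<Sum>n<N. E x n \<bullet> E x n) + b x \<bullet> (x - c)" for x
  \<comment> \<open>The frame itself may jump from point to point, so continuity has to be drawn
    from the sums of products of its components.\<close>
  have A_eq: "A x = (\<Sum>i\<in>Basis. \<Sum>j\<in>Basis. ((x - c) \<bullet> i) * ((x - c) \<bullet> j) * (\<Sum>n<N. (E x n \<bullet> i) * (E x n \<bullet> j)))" for x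
  proof -
    have "A x = (\<Sum>n<N. \<Sum>i\<in>Basis. \<Sum>j\<in>Basis. ((x - c) \<bullet> i) * ((x - c) \<bullet> j) * ((E x n \<bullet> i) * (E x n \<bullet> j)))"
      unfolding A_def power2_eq_square euclidean_inner[of "E x _" "x - c"] sum_product by (simp add: mult_ac)
    also have "\<dots> = (\<Sum>i\<in>Basis. \<Sum>j\<in>Basis. \<Sum>n<N. ((x - c) \<bullet> i) * ((x - c) \<bullet> j) * ((E x n \<bullet> i) * (E x n \<bullet> j)))"
      by (subst sum.swap, rule sum.cong[OF refl], subst sum.swap, simp)
    finally show ?thesis by (simp add: sum_distrib_left)
  qed
  have contA: "continuous_on ?B A"
    unfolding A_eq[abs_def]
    by (intro continuous_intros continuous_on_subset[OF a \<delta>(2)])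
  have T_eq: "T x = (\<Sum>i\<in>Basis. \<Sum>n<N. (E x n \<bullet> i) * (E x n \<bullet> i)) + b x \<bullet> (x - c)" for x
    unfolding T_def euclidean_inner[of "E x _" "E x _"] by (subst sum.swap) simp
  have contT: "continuous_on ?B T"
    unfolding T_eq[abs_def]
    by (intro continuous_intros continuous_on_subset[OF a \<delta>(2)] continuous_on_subset[OF b \<delta>(2)])
  obtain x1 where x1: "x1 \<in> ?B" "\<And>x. x \<in> ?B \<Longrightarrow> A x1 \<le> A x"
    using continuous_attains_inf[OF compact_cball Bne contA] by blast
  obtain x2 where x2: "x2 \<in> ?B" "\<And>x. x \<in> ?B \<Longrightarrow> T x \<le> T x2"
    using continuous_attains_sup[OF compact_cball Bne contT] by blast
  have Apos: "A x1 > 0"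
  proof -
    have "x1 - c \<noteq> 0" using x1(1) cB by auto
    then obtain n where "n < N" "E x1 n \<bullet> (x1 - c) \<noteq> 0" using elliptic[of x1] x1(1) \<delta>(2) by blast
    then show ?thesis unfolding A_def by (intro sum_pos2[of _ n]) auto
  qed
  \<comment> \<open>Large enough for the quadratic term in \<alpha> to dominate on the whole ball:
    \<open>\<alpha> * A x\<close> is at least \<open>\<bar>T x2\<bar> + 1\<close> there.\<close>
  define \<alpha> where "\<alpha> = (\<bar>T x2\<bar> + 1) / A x1"
  have "\<alpha> > 0" using Apos by (simp add: \<alpha>_def add_pos_pos)
  have key: "4 * \<alpha>\<^sup>2 * A x - 2 * \<alpha> * T x > 0" if "x \<in> ?B" for x
  proof -
    have "\<alpha> * A x1 = \<bar>T x2\<bar> + 1" using Apos by (simp add: \<alpha>_def)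
    moreover have "\<alpha> * A x1 \<le> \<alpha> * A x" using x1(2)[OF that] \<open>\<alpha> > 0\<close> by simp
    ultimately have "2 * (\<alpha> * A x) - T x > 0" using x2(2)[OF that] by linarith
    then have "2 * \<alpha> * (2 * (\<alpha> * A x) - T x) > 0" using \<open>\<alpha> > 0\<close> by simp
    then show ?thesis by (simp add: power2_eq_square algebra_simps)
  qed
  \<comment> \<open>The subtracted constant makes \<open>h\<close> vanish on the sphere about
    \<open>c\<close> through \<open>y\<close>, so that it is negative outside.\<close>
  define h where "h x = exp (- \<alpha> * ((x - c) \<bullet> (x - c))) - exp (- \<alpha> * (\<rho> / 2)\<^sup>2)" for x
  have sq: "(x - c) \<bullet> (x - c) = (dist c x)\<^sup>2" for x
    by (metis dist_commute dist_norm power2_norm_eq_inner)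
  have h1: "h x < 1" for x
  proof -
    have "exp (- \<alpha> * ((x - c) \<bullet> (x - c))) \<le> 1" using \<open>\<alpha> > 0\<close> by simp
    then show ?thesis using exp_gt_zero[of "- \<alpha> * (\<rho> / 2)\<^sup>2"] unfolding h_def by linarith
  qed
  have hneg: "h x < 0" if "dist c x > \<rho> / 2" for x
    using that \<open>\<alpha> > 0\<close> \<open>\<rho> > 0\<close> unfolding h_def sq by (simp add: power_strict_mono)
  have hy: "h y = 0" unfolding h_def sq cy by simp
  \<comment> \<open>This part of the sphere about \<open>y\<close> is compact and avoids
    \<open>y\<close>, the only point of the half-size ball with \<open>F = m\<close>; hence a
    uniform gap.\<close>
  have "\<exists>\<epsilon>>0. \<forall>x\<in>sphere y \<delta> \<inter> cball c (\<rho> / 2). F x \<ge> m + \<epsilon>"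
  proof (cases "sphere y \<delta> \<inter> cball c (\<rho> / 2) = {}")
    case False
    have "continuous_on (sphere y \<delta> \<inter> cball c (\<rho> / 2)) F"
      using \<delta>(2) by (intro continuous_on_subset[OF contF]) auto
    with False have "\<exists>x0\<in>sphere y \<delta> \<inter> cball c (\<rho> / 2). \<forall>x\<in>sphere y \<delta> \<inter> cball c (\<rho> / 2). F x0 \<le> F x"
      by (intro continuous_attains_inf) auto
    then obtain x0 where x0: "x0 \<in> sphere y \<delta> \<inter> cball c (\<rho> / 2)"
      "\<And>x. x \<in> sphere y \<delta> \<inter> cball c (\<rho> / 2) \<Longrightarrow> F x0 \<le> F x"
      by blast
    have "F x0 > m" using ball[of x0] x0(1) \<delta>(1) by auto
    then show ?thesis using x0(2) by (intro exI[of _ "F x0 - m"]) auto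
  qed (use zero_less_one in blast)
  then obtain \<epsilon> where \<epsilon>: "\<epsilon> > 0" "\<And>x. x \<in> sphere y \<delta> \<Longrightarrow> dist c x \<le> \<rho> / 2 \<Longrightarrow> F x \<ge> m + \<epsilon>"
    by auto
  define w where "w x = F x - \<epsilon> * h x" for x
  have "continuous_on ?B w"
    unfolding w_def h_def by (intro continuous_intros continuous_on_subset[OF contF \<delta>(2)])
  then obtain z where z: "z \<in> ?B" "\<And>x. x \<in> ?B \<Longrightarrow> w z \<le> w x"
    using continuous_attains_inf[OF compact_cball Bne] by blast
  have "w z \<le> m" using z(2)[of y] \<delta>(1) by (simp add: w_def hy \<open>F y = m\<close>)
  have "z \<in> S" using z(1) \<delta>(2) by blast
  \<comment> \<open>On the boundary \<open>w\<close> exceeds \<open>m\<close>: inside the half-size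
    ball by the gap \<epsilon> and \<open>h < 1\<close>, outside it because \<open>h\<close> is
    negative there.\<close>
  have "dist y z \<noteq> \<delta>"
  proof
    assume s: "dist y z = \<delta>"
    show False
    proof (cases "dist c z \<le> \<rho> / 2")
      case True
      then have "F z \<ge> m + \<epsilon>" using \<epsilon>(2) s by simp
      moreover have "\<epsilon> * h z < \<epsilon>" using h1[of z] \<epsilon>(1) by simp
      ultimately show False using \<open>w z \<le> m\<close> by (simp add: w_def)
    next
      case False
      then have "\<epsilon> * h z < 0" using hneg[of z] \<epsilon>(1) by (simp add: mult_pos_neg)
      then show False using m[OF \<open>z \<in> S\<close>] \<open>w z \<le> m\<close> by (simp add: w_def)
    qed
  qed
  then have "dist y z < \<delta>" using z(1) by simp
  define e where "e = exp (- \<alpha> * ((z - c) \<bullet> (z - c)))"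
  have "e > 0" by (simp add: e_def)
  \<comment> \<open>Restricting \<open>w\<close> to lines through its interior minimum compares the
    derivatives of \<open>F\<close> with those of \<open>\<epsilon> * h\<close> by the one-variable
    test.\<close>
  have line: "frechet_derivative F (at z) v = - 2 * \<alpha> * \<epsilon> * e * ((z - c) \<bullet> v) \<and>
      frechet_derivative (\<lambda>y. frechet_derivative F (at y) v) (at z) v \<ge>
        \<epsilon> * e * (4 * \<alpha>\<^sup>2 * ((z - c) \<bullet> v)\<^sup>2 - 2 * \<alpha> * (v \<bullet> v))" for v
  proof -
    \<comment> \<open>Parameters below this bound keep the line inside the ball; the added 1 covers
      \<open>v = 0\<close>.\<close>
    define d where "d = (\<delta> - dist y z) / (norm v + 1)"
    have nv: "norm v + 1 > 0" using norm_ge_zero[of v] by linarith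
    have "d > 0" using \<open>dist y z < \<delta>\<close> nv by (simp add: d_def)
    have inB: "z + t *\<^sub>R v \<in> ?B" if "\<bar>t\<bar> < d" for t
    proof -
      have "norm (t *\<^sub>R v) \<le> \<bar>t\<bar> * (norm v + 1)" by (simp add: distrib_left)
      also have "\<dots> \<le> d * (norm v + 1)" using that nv by (intro mult_right_mono) auto
      also have "\<dots> = \<delta> - dist y z" using nv by (simp add: d_def)
      finally show ?thesis using dist_triangle[of y "z + t *\<^sub>R v" z] by (simp add: dist_norm)
    qed
    define ee where "ee t = exp (- \<alpha> * ((z + t *\<^sub>R v - c) \<bullet> (z + t *\<^sub>R v - c)))" for t
    define g' where "g' t = frechet_derivative F (at (z + t *\<^sub>R v)) v
        - \<epsilon> * (- 2 * \<alpha> * ((z - c) \<bullet> v + t * (v \<bullet> v)) * ee t)" for t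
    have dee: "(ee has_real_derivative - 2 * \<alpha> * ((z - c) \<bullet> v + t * (v \<bullet> v)) * ee t) (at t)" for t
    proof -
      have "((\<lambda>t. - \<alpha> * ((z - c) \<bullet> (z - c) + 2 * t * ((z - c) \<bullet> v) + t * t * (v \<bullet> v)))
          has_real_derivative - 2 * \<alpha> * ((z - c) \<bullet> v + t * (v \<bullet> v))) (at t)"
        by (auto intro!: derivative_eq_intros simp: algebra_simps)
      moreover have "(\<lambda>t. - \<alpha> * ((z - c) \<bullet> (z - c) + 2 * t * ((z - c) \<bullet> v) + t * t * (v \<bullet> v))) =
          (\<lambda>t. - \<alpha> * ((z + t *\<^sub>R v - c) \<bullet> (z + t *\<^sub>R v - c)))"
        by (auto simp: algebra_simps inner_add_left inner_add_right inner_diff_left inner_diff_right inner_commute)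
      ultimately have "((\<lambda>t. - \<alpha> * ((z + t *\<^sub>R v - c) \<bullet> (z + t *\<^sub>R v - c)))
          has_real_derivative - 2 * \<alpha> * ((z - c) \<bullet> v + t * (v \<bullet> v))) (at t)" by simp
      from DERIV_fun_exp[OF this] show ?thesis by (simp add: ee_def[abs_def] mult.commute)
    qed
    have g: "((\<lambda>t. w (z + t *\<^sub>R v)) has_real_derivative g' t) (at t)" if "\<bar>t\<bar> < d" for t
    proof -
      have "F differentiable (at (z + t *\<^sub>R v))" using inB[OF that] \<delta>(2) F1 by blast
      from has_real_derivative_along_line[OF this] show ?thesis
        unfolding w_def h_def g'_def ee_def[symmetric]
        by (auto intro!: derivative_eq_intros dee)
    qed
    have "(\<lambda>y. frechet_derivative F (at y) v) differentiable (at (z + 0 *\<^sub>R v))"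
      using F2[OF \<open>z \<in> S\<close>] by simp
    from has_real_derivative_along_line[OF this]
    have "(g' has_real_derivative frechet_derivative (\<lambda>y. frechet_derivative F (at y) v) (at z) v
        - \<epsilon> * (- 2 * \<alpha> * (v \<bullet> v) * e + (- 2 * \<alpha> * ((z - c) \<bullet> v)) * (- 2 * \<alpha> * ((z - c) \<bullet> v) * e))) (at 0)"
      unfolding g'_def
      by (auto intro!: derivative_eq_intros dee) (simp add: ee_def e_def algebra_simps)
    from second_derivative_test[OF \<open>d > 0\<close> g this] z(2)[OF inB]
    have "g' 0 = 0" "frechet_derivative (\<lambda>y. frechet_derivative F (at y) v) (at z) v
        - \<epsilon> * (- 2 * \<alpha> * (v \<bullet> v) * e + (- 2 * \<alpha> * ((z - c) \<bullet> v)) * (- 2 * \<alpha> * ((z - c) \<bullet> v) * e)) \<ge> 0"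
      by auto
    then show ?thesis
      by (simp add: g'_def ee_def e_def power2_eq_square algebra_simps)
  qed
  \<comment> \<open>At \<open>z\<close> the operator on \<open>F\<close> is nonpositive by
    hypothesis, yet bounded below by its value on \<open>\<epsilon> * h\<close>, which is positive
    by \<open>key\<close>.\<close>
  have "0 \<ge> (\<Sum>n<N. frechet_derivative (\<lambda>y. frechet_derivative F (at y) (E z n)) (at z) (E z n)) +
       frechet_derivative F (at z) (b z)"
    using super[OF \<open>z \<in> S\<close>] .
  moreover have "(\<Sum>n<N. frechet_derivative (\<lambda>y. frechet_derivative F (at y) (E z n)) (at z) (E z n)) \<ge>
      (\<Sum>n<N. \<epsilon> * e * (4 * \<alpha>\<^sup>2 * ((z - c) \<bullet> E z n)\<^sup>2 - 2 * \<alpha> * (E z n \<bullet> E z n)))"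
    using line by (intro sum_mono) blast
  moreover have "(\<Sum>n<N. \<epsilon> * e * (4 * \<alpha>\<^sup>2 * ((z - c) \<bullet> E z n)\<^sup>2 - 2 * \<alpha> * (E z n \<bullet> E z n))) =
      \<epsilon> * e * (4 * \<alpha>\<^sup>2 * A z - 2 * \<alpha> * (\<Sum>n<N. E z n \<bullet> E z n))"
    by (simp add: A_def sum_subtractf sum_distrib_left right_diff_distrib inner_commute)
  moreover have "frechet_derivative F (at z) (b z) = - 2 * \<alpha> * \<epsilon> * e * (b z \<bullet> (z - c))"
    using line[of "b z"] by (simp add: inner_commute)
  ultimately have "0 \<ge> \<epsilon> * e * (4 * \<alpha>\<^sup>2 * A z - 2 * \<alpha> * T z)"
    by (simp add: T_def algebra_simps)
  moreover have "\<epsilon> * e * (4 * \<alpha>\<^sup>2 * A z - 2 * \<alpha> * T z) > 0"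
    using key[OF z(1)] \<epsilon>(1) \<open>e > 0\<close> by simp
  ultimately show False by linarith
qed

section \<open>Fixed points of the flow\<close>

text \<open>Kept apart from \<open>g2_fixed_point\<close> so that the derived forms have names when
  its assumptions are stated.\<close>

locale g2_data = g2_domain S \<phi> for S \<phi> +
  fixes F T\<^sub>0 :: "real^7 \<Rightarrow> real" and \<tau>\<^sub>1 \<tau>\<^sub>3 :: "real^7 \<Rightarrow> covector"
begin

definition "\<psi> u = hodge (gm u) (vl u) 3 (\<phi> u)"

definition "H u = (\<lambda>vs. 1/6 * (T\<^sub>0 u * \<phi> u vs) - contract (gm u) (\<tau>\<^sub>1 u) (\<psi> u) vs - \<tau>\<^sub>3 u vs)"

definition "dF = form_d (\<lambda>u. fun_covector (F u))"

definition "star_dF u = hodge (gm u) (vl u) 1 (dF u)"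

end

text \<open>The hypotheses read in one chart, with smoothness reduced to the derivatives that are
  taken and the Laplacian unfolded into star d star d.\<close>

locale g2_fixed_point = g2_data S \<phi> F T\<^sub>0 \<tau>\<^sub>1 \<tau>\<^sub>3 for S \<phi> F T\<^sub>0 \<tau>\<^sub>1 \<tau>\<^sub>3 +
  fixes \<tau>\<^sub>2 :: "real^7 \<Rightarrow> covector" and C \<gamma> \<sigma> :: real
  assumes C1_F: "C1 S F" and C1_DF: "\<And>v. C1 S (\<lambda>u. frechet_derivative F (at u) v)"
    and C1_T\<^sub>0: "C1 S T\<^sub>0"
    and covector_\<tau>\<^sub>1: "\<And>u. u \<in> S \<Longrightarrow> is_covector 1 (\<tau>\<^sub>1 u)" and C1_\<tau>\<^sub>1: "\<And>vs. C1 S (\<lambda>u. \<tau>\<^sub>1 u vs)"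
    and covector_\<tau>\<^sub>2: "\<And>u. u \<in> S \<Longrightarrow> is_covector 2 (\<tau>\<^sub>2 u)"
    and covector_\<tau>\<^sub>3: "\<And>u. u \<in> S \<Longrightarrow> is_covector 3 (\<tau>\<^sub>3 u)" and C1_\<tau>\<^sub>3: "\<And>vs. C1 S (\<lambda>u. \<tau>\<^sub>3 u vs)"
    and \<tau>\<^sub>2_\<psi>: "\<And>u vs. u \<in> S \<Longrightarrow> (\<tau>\<^sub>2 u \<and>\<^sub>\<Lambda> \<psi> u) vs = 0"
    and \<tau>\<^sub>3_\<phi>: "\<And>u vs. u \<in> S \<Longrightarrow> (\<tau>\<^sub>3 u \<and>\<^sub>\<Lambda> \<phi> u) vs = 0"
    and \<tau>\<^sub>3_\<psi>: "\<And>u vs. u \<in> S \<Longrightarrow> (\<tau>\<^sub>3 u \<and>\<^sub>\<Lambda> \<psi> u) vs = 0"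
    and d\<phi>: "\<And>u vs. u \<in> S \<Longrightarrow> form_d \<phi> u vs =
      T\<^sub>0 u * \<psi> u vs + 3 * (\<tau>\<^sub>1 u \<and>\<^sub>\<Lambda> \<phi> u) vs + hodge (gm u) (vl u) 3 (\<tau>\<^sub>3 u) vs"
    and d\<psi>: "\<And>u vs. u \<in> S \<Longrightarrow> form_d \<psi> u vs = 4 * (\<tau>\<^sub>1 u \<and>\<^sub>\<Lambda> \<psi> u) vs + (\<tau>\<^sub>2 u \<and>\<^sub>\<Lambda> \<phi> u) vs"
    and d_exp_\<psi>: "\<And>u vs. u \<in> S \<Longrightarrow> form_d (\<lambda>y vs. exp (- 4 * F y) * \<psi> y vs) u vs = 0"
    and dH: "\<And>u vs. u \<in> S \<Longrightarrow> - form_d H u vs + 7/4 * C * form_d (\<lambda>y vs. T\<^sub>0 y * \<phi> y vs) u vs = 0"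
    and laplace: "\<And>u. u \<in> S \<Longrightarrow> hodge (gm u) (vl u) 7 (form_d star_dF u) []
      - \<gamma> * covector_inner (gm u) 1 (dF u) (dF u) + 1/4 * covector_inner (gm u) 3 (\<tau>\<^sub>3 u) (\<tau>\<^sub>3 u)
      - \<sigma> * (T\<^sub>0 u)\<^sup>2 = 0"
begin

lemma C1_\<psi>: "C1 S (\<lambda>u. \<psi> u vs)"
  unfolding \<psi>_def by (intro C1_hodge covector_\<phi> C1_\<phi>) simp_all

lemma covector_dF: "u \<in> S \<Longrightarrow> is_covector 1 (dF u)"
  unfolding dF_def by (rule covector_form_d_fun_covector[OF C1_differentiable[OF C1_F]])

lemma C1_dF: "C1 S (\<lambda>u. dF u vs)"
  unfolding dF_def form_d_fun_covector by (cases "length vs = 1") (simp_all add: C1_DF C1_const del: C_on.simps)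

lemma C1_star_dF: "C1 S (\<lambda>u. star_dF u vs)"
  unfolding star_dF_def by (intro C1_hodge covector_dF C1_dF) simp_all

text \<open>Expanding the closedness condition gives
  \<open>d\<psi> = 4 * dF \<and>\<^sub>\<Lambda> \<psi>\<close>, with the same 4 as in the torsion
  equation. Subtracting the two leaves a relation covered by \<open>torsion_5_eq_0\<close>.\<close>

lemma torsion_classes:
  assumes u: "u \<in> S"
  shows "\<tau>\<^sub>1 u vs = dF u vs" "\<tau>\<^sub>2 u vs = 0"
proof -
  obtain E where "g2_frame (gm u) E (\<phi> u) (vl u)" using frame[OF u] by blast
  then interpret f: g2_frame "gm u" E "\<phi> u" "vl u" .
  have \<psi>: "f.\<psi> = \<psi> u" by (simp add: f.\<psi>_def \<psi>_def)
  have "((\<lambda>y. exp (- 4 * F y)) has_derivative (\<lambda>v. exp (- 4 * F u) * (- 4 * frechet_derivative F (at u) v))) (at u)"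
    by (auto intro!: derivative_eq_intros C1_has_derivative[OF C1_F u] simp del: C_on.simps)
  note e = this frechet_derivative_eq[OF this]
  then have "form_d (\<lambda>y. fun_covector (exp (- 4 * F y))) u = (\<lambda>vs. exp (- 4 * F u) * (- 4 * dF u vs))"
    by (auto simp: dF_def form_d_fun_covector)
  moreover have "form_d (\<lambda>y vs. exp (- 4 * F y) * \<psi> y vs) u vs =
      (form_d (\<lambda>y. fun_covector (exp (- 4 * F y))) u \<and>\<^sub>\<Lambda> \<psi> u) vs + exp (- 4 * F u) * form_d \<psi> u vs" for vs
    using e(1) C1_differentiable[OF C1_\<psi> u] by (intro form_d_fun_mult) (auto simp: differentiable_def)
  ultimately have "exp (- 4 * F u) * (- 4 * (dF u \<and>\<^sub>\<Lambda> \<psi> u) vs + form_d \<psi> u vs) = 0" for vs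
    using d_exp_\<psi>[OF u, of vs] by (simp only: wedge_scale_left distrib_left)
  then have "- 4 * (dF u \<and>\<^sub>\<Lambda> \<psi> u) vs + form_d \<psi> u vs = 0" for vs by simp
  then have 5: "4 * ((\<lambda>vs. \<tau>\<^sub>1 u vs - dF u vs) \<and>\<^sub>\<Lambda> f.\<psi>) vs + (\<tau>\<^sub>2 u \<and>\<^sub>\<Lambda> \<phi> u) vs = 0" for vs
    using d\<psi>[OF u, of vs] by (simp add: wedge_diff_left \<psi>)
  have 1: "is_covector 1 (\<lambda>vs. \<tau>\<^sub>1 u vs - dF u vs)"
    by (intro covector_diff covector_\<tau>\<^sub>1 covector_dF u)
  have 6: "(\<tau>\<^sub>2 u \<and>\<^sub>\<Lambda> f.\<psi>) vs = 0" for vs using \<tau>\<^sub>2_\<psi>[OF u] \<psi> by simp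
  show "\<tau>\<^sub>1 u vs = dF u vs" "\<tau>\<^sub>2 u vs = 0"
    using f.torsion_5_eq_0[OF 1 covector_\<tau>\<^sub>2[OF u] 5 6, of vs] by simp_all
qed

lemma d_star_dF:
  assumes u: "u \<in> S"
  shows "form_d star_dF u vs = 1/4 * ((7/6 - 49/4 * C) * (T\<^sub>0 u)\<^sup>2 +
    12 * covector_inner (gm u) 1 (dF u) (dF u) - covector_inner (gm u) 3 (\<tau>\<^sub>3 u) (\<tau>\<^sub>3 u)) * vl u vs"
proof -
  obtain E where "g2_frame (gm u) E (\<phi> u) (vl u)" using frame[OF u] by blast
  then interpret f: g2_frame "gm u" E "\<phi> u" "vl u" .
  have \<psi>: "f.\<psi> = \<psi> u" by (simp add: f.\<psi>_def \<psi>_def)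
  have \<tau>\<^sub>1: "\<tau>\<^sub>1 y = dF y" if "y \<in> S" for y using torsion_classes(1)[OF that] by blast
  \<comment> \<open>The identity is about to be differentiated, so it is needed at all nearby
    points, each with its own frame.\<close>
  have H\<phi>: "H y \<and>\<^sub>\<Lambda> \<phi> y = (\<lambda>vs. - 4 * star_dF y vs)" if y: "y \<in> S" for y
  proof -
    obtain E where "g2_frame (gm y) E (\<phi> y) (vl y)" using frame[OF y] by blast
    then interpret y: g2_frame "gm y" E "\<phi> y" "vl y" .
    have \<psi>: "y.\<psi> = \<psi> y" by (simp add: y.\<psi>_def \<psi>_def)
    show ?thesis
      using y.H_wedge_\<phi>[OF covector_\<tau>\<^sub>1[OF y] covector_\<tau>\<^sub>3[OF y], unfolded \<psi>, OF \<tau>\<^sub>3_\<phi>[OF y] \<tau>\<^sub>3_\<psi>[OF y], of "T\<^sub>0 y"]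
      by (auto simp: H_def star_dF_def \<tau>\<^sub>1[OF y])
  qed
  have covH: "is_covector 3 (H y)" if y: "y \<in> S" for y
  proof -
    obtain E where "g2_frame (gm y) E (\<phi> y) (vl y)" using frame[OF y] by blast
    then interpret y: g2_frame "gm y" E "\<phi> y" "vl y" .
    have \<psi>: "y.\<psi> = \<psi> y" by (simp add: y.\<psi>_def \<psi>_def)
    show ?thesis
      using y.covector_H[OF covector_\<tau>\<^sub>1[OF y] covector_\<tau>\<^sub>3[OF y], unfolded \<psi>, OF \<tau>\<^sub>3_\<phi>[OF y] \<tau>\<^sub>3_\<psi>[OF y], of "T\<^sub>0 y"]
      by (simp add: H_def)
  qed
  have C1_H: "C1 S (\<lambda>u. H u vs)" for vs
    unfolding H_def by (intro C1_diff C1_mult C1_const C1_T\<^sub>0 C1_\<phi> C1_contract C1_\<tau>\<^sub>1 C1_\<psi> C1_\<tau>\<^sub>3)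
  define D where "D = form_d \<phi> u"
  have D: "D = (\<lambda>vs. T\<^sub>0 u * f.\<psi> vs + 3 * (\<tau>\<^sub>1 u \<and>\<^sub>\<Lambda> \<phi> u) vs + hodge (gm u) (vl u) 3 (\<tau>\<^sub>3 u) vs)"
    using d\<phi>[OF u] by (auto simp: D_def \<psi>)
  note hyps = covector_\<tau>\<^sub>1[OF u] covector_\<tau>\<^sub>3[OF u] \<tau>\<^sub>3_\<phi>[OF u] \<tau>\<^sub>3_\<psi>[OF u, folded \<psi>]
  let ?dT = "form_d (\<lambda>y. fun_covector (T\<^sub>0 y)) u"
  have dT: "is_covector 1 ?dT"
    by (rule covector_form_d_fun_covector[OF C1_differentiable[OF C1_T\<^sub>0 u]])
  have "form_d (\<lambda>y vs. T\<^sub>0 y * \<phi> y vs) u vs = (?dT \<and>\<^sub>\<Lambda> \<phi> u) vs + T\<^sub>0 u * D vs" for vs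
    unfolding D_def
    by (rule form_d_fun_mult) (intro C1_differentiable[OF C1_T\<^sub>0 u] C1_differentiable[OF C1_\<phi> u])+
  then have dH_eq: "form_d H u = (\<lambda>vs. 7/4 * C * ((?dT \<and>\<^sub>\<Lambda> \<phi> u) vs + T\<^sub>0 u * D vs))"
    using dH[OF u] by (auto simp: fun_eq_iff algebra_simps)
  have D\<phi>: "(D \<and>\<^sub>\<Lambda> \<phi> u) vs = 7 * T\<^sub>0 u * vl u vs"
    using f.\<phi>_wedge_D[OF hyps, of "T\<^sub>0 u" vs] f.covector_D[OF hyps, of "T\<^sub>0 u"]
      wedge_commute[of 4 D 3 "\<phi> u" vs] f.covector_\<phi> by (simp add: D)
  \<comment> \<open>The unknown derivative of \<tau>0 drops out here, because it comes wedged with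
    \<phi> twice.\<close>
  have dT\<phi>\<phi>: "((?dT \<and>\<^sub>\<Lambda> \<phi> u) \<and>\<^sub>\<Lambda> \<phi> u) vs = 0"
    using wedge_commute[OF f.covector_a\<phi>[OF dT] f.covector_\<phi>, of vs] f.\<phi>_wedge_a\<phi>[OF dT] by simp
  have HD: "(H u \<and>\<^sub>\<Lambda> D) vs = (7/6 * (T\<^sub>0 u)\<^sup>2 + 12 * covector_inner (gm u) 1 (dF u) (dF u)
      - covector_inner (gm u) 3 (\<tau>\<^sub>3 u) (\<tau>\<^sub>3 u)) * vl u vs"
    using f.H_wedge_D[OF hyps, of "T\<^sub>0 u" vs] by (simp add: D H_def \<psi> \<tau>\<^sub>1[OF u])
  have "- 4 * form_d star_dF u vs = form_d (\<lambda>y. H y \<and>\<^sub>\<Lambda> \<phi> y) u vs"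
    using form_d_cmult[of star_dF u "- 4" vs, OF C1_differentiable[OF C1_star_dF u]] form_d_cong[OF open_S u H\<phi>] by simp
  also have "\<dots> = (form_d H u \<and>\<^sub>\<Lambda> \<phi> u) vs + (-1) ^ 3 * (H u \<and>\<^sub>\<Lambda> D) vs"
    unfolding D_def
    by (rule form_d_wedge[OF open_S u covector_length[OF covH] C1_differentiable[OF C1_H u] C1_differentiable[OF C1_\<phi> u]])
  \<comment> \<open>The constant is \<open>7/4 * 7\<close>: the coefficient in the flow times the 7
    of \<open>D\<phi>\<close>.\<close>
  also have "(form_d H u \<and>\<^sub>\<Lambda> \<phi> u) vs = 49/4 * C * (T\<^sub>0 u)\<^sup>2 * vl u vs"
    unfolding dH_eq wedge_scale_left wedge_add_left D\<phi> dT\<phi>\<phi> by (simp add: power2_eq_square)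
  finally show ?thesis unfolding HD by (simp add: field_simps)
qed

text \<open>The factor \<open>l\<close> between d star dF and the volume form is computed in three
  ways: it is the Laplacian in \<open>laplace\<close>, the torsion expression of
  \<open>d_star_dF\<close>, and the coordinate operator. Eliminating it gives the combination with
  weight twelve.\<close>

lemma laplace_equation:
  assumes u: "u \<in> S" and E: "g2_frame (gm u) E (\<phi> u) (vl u)"
  shows "16 * ((\<Sum>n<7. frechet_derivative (\<lambda>y. frechet_derivative F (at y) (E n)) (at u) (E n)) +
      frechet_derivative F (at u) (drift u)) =
    12 * (\<gamma> + 1) * covector_inner (gm u) 1 (dF u) (dF u) - 4 * covector_inner (gm u) 3 (\<tau>\<^sub>3 u) (\<tau>\<^sub>3 u) +
    12 * (\<sigma> - 7 * (21 * C - 2) / 144) * (T\<^sub>0 u)\<^sup>2"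
proof -
  interpret f: g2_frame "gm u" E "\<phi> u" "vl u" by (rule E)
  define l where "l = 1/4 * ((7/6 - 49/4 * C) * (T\<^sub>0 u)\<^sup>2 +
    12 * covector_inner (gm u) 1 (dF u) (dF u) - covector_inner (gm u) 3 (\<tau>\<^sub>3 u) (\<tau>\<^sub>3 u))"
  have d: "form_d star_dF u = (\<lambda>vs. l * vl u vs)" using d_star_dF[OF u] by (auto simp: l_def)
  have "hodge (gm u) (vl u) 7 (form_d star_dF u) [] = l" unfolding d by (rule f.hodge_7)
  moreover have "l = (\<Sum>n<7. frechet_derivative (\<lambda>y. frechet_derivative F (at y) (E n)) (at u) (E n)) +
      frechet_derivative F (at u) (drift u)"
    using d_star_d_coordinates[OF u C1_F C1_DF E, folded dF_def, folded star_dF_def] vol_metric_facts(1)[OF u]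
    by (simp add: d del: upt_rec_numeral)
  ultimately show ?thesis using laplace[OF u] unfolding l_def by (simp add: field_simps)
qed

lemma inner_nonneg:
  assumes u: "u \<in> S"
  shows "covector_inner (gm u) 1 (dF u) (dF u) \<ge> 0" "covector_inner (gm u) 3 (\<tau>\<^sub>3 u) (\<tau>\<^sub>3 u) \<ge> 0"
proof -
  obtain E where "g2_frame (gm u) E (\<phi> u) (vl u)" using frame[OF u] by blast
  then interpret f: g2_frame "gm u" E "\<phi> u" "vl u" .
  show "covector_inner (gm u) 1 (dF u) (dF u) \<ge> 0" "covector_inner (gm u) 3 (\<tau>\<^sub>3 u) (\<tau>\<^sub>3 u) \<ge> 0"
    using f.inner_nonneg covector_dF[OF u] covector_\<tau>\<^sub>3[OF u] by blast+
qed

context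
  assumes \<gamma>: "\<gamma> < -1" and \<sigma>: "\<sigma> < 7 * (21 * C - 2) / 144"
begin

lemma minimum_locally_constant:
  assumes "\<And>x. x \<in> S \<Longrightarrow> m \<le> F x" "F p = m" "cball p (2 * r) \<subseteq> S" "dist p q < r"
  shows "F q = m"
proof -
  obtain E where E: "\<And>u. u \<in> S \<Longrightarrow> g2_frame (gm u) (E u) (\<phi> u) (vl u)"
    using frame by metis
  have frm: "metric_frame (gm u) (E u)" if "u \<in> S" for u
    using E[OF that] by (simp add: g2_frame_def g2_basis_def)
  show ?thesis
  proof (rule strong_minimum_principle_local[where S = S and b = drift and E = E and N = 7])
    show "open S" "continuous_on S drift" by (rule open_S continuous_on_drift)+
    show "\<And>x. x \<in> S \<Longrightarrow> m \<le> F x" "F p = m" "cball p (2 * r) \<subseteq> S" "dist p q < r" by (rule assms; assumption?)+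
    show "F differentiable (at x)" if "x \<in> S" for x by (rule C1_differentiable[OF C1_F that])
    show "(\<lambda>y. frechet_derivative F (at y) v) differentiable (at x)" if "x \<in> S" for x v
      by (rule C1_differentiable[OF C1_DF that])
    \<comment> \<open>The frames were picked independently at each point; this sum is an entry of
      the inverse metric, which is continuous.\<close>
    show "continuous_on S (\<lambda>x. \<Sum>n<7. (E x n \<bullet> i) * (E x n \<bullet> j))"
      if ij: "i \<in> Basis" "j \<in> Basis" for i j
    proof -
      obtain k l where kl: "i = axis k 1" "j = axis l 1" using ij by (auto simp: Basis_vec_def)
      have "continuous_on S (\<lambda>x. inverse_metric (gm x) $ k $ l)"
        by (rule C1_continuous[OF C1_inverse_metric])
      then show ?thesis
        by (rule continuous_on_cong[THEN iffD1, rotated -1])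
          (simp_all add: kl inner_axis metric_frame.inverse_metric_eq[OF frm])
    qed
    \<comment> \<open>Ellipticity: the frame spans, so a vector Euclidean-orthogonal to all its
      members is orthogonal to itself.\<close>
    show "\<exists>n<7. E x n \<bullet> \<xi> \<noteq> 0" if "x \<in> S" "\<xi> \<noteq> 0" for x \<xi>
    proof (rule ccontr)
      assume *: "\<not> (\<exists>n<7. E x n \<bullet> \<xi> \<noteq> 0)"
      have "\<xi> \<bullet> \<xi> = (\<Sum>n<7. gm x \<xi> (E x n) *\<^sub>R E x n) \<bullet> \<xi>"
        using metric_frame.expand[OF frm[OF that(1)], of \<xi>] by simp
      also have "\<dots> = 0" using * by (simp add: inner_sum_left)
      finally show False using that(2) by simp
    qed
    show "(\<Sum>n<7. frechet_derivative (\<lambda>y. frechet_derivative F (at y) (E x n)) (at x) (E x n)) +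
       frechet_derivative F (at x) (drift x) \<le> 0" if x: "x \<in> S" for x
    proof -
      have "12 * (\<gamma> + 1) * covector_inner (gm x) 1 (dF x) (dF x) \<le> 0"
        "12 * (\<sigma> - 7 * (21 * C - 2) / 144) * (T\<^sub>0 x)\<^sup>2 \<le> 0"
        using \<gamma> \<sigma> inner_nonneg[OF x] by (simp_all add: mult_nonpos_nonneg)
      moreover have "l \<le> 0" if "16 * l = a - 4 * b + c" "a \<le> 0" "c \<le> 0" "b \<ge> 0" for a b c l :: real
        using that by linarith
      ultimately show ?thesis using laplace_equation[OF x E[OF x]] inner_nonneg(2)[OF x] by blast
    qed
  qed
qed

lemma constant_imp_torsion_free:
  assumes const: "\<And>x. x \<in> S \<Longrightarrow> F x = m" and u: "u \<in> S"
  shows "T\<^sub>0 u = 0" "\<tau>\<^sub>1 u vs = 0" "\<tau>\<^sub>2 u vs = 0" "\<tau>\<^sub>3 u vs = 0"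
proof -
  obtain E where E: "g2_frame (gm u) E (\<phi> u) (vl u)" using frame[OF u] by blast
  interpret f: g2_frame "gm u" E "\<phi> u" "vl u" by (rule E)
  have D0: "frechet_derivative F (at y) v = 0" if "y \<in> S" for y v
    using frechet_derivative_cong[OF open_S that, of F "\<lambda>_. m"] const by (simp add: frechet_derivative_const)
  then have D2: "frechet_derivative (\<lambda>y. frechet_derivative F (at y) v) (at u) w = 0" for v w
    using frechet_derivative_cong[OF open_S u, of "\<lambda>y. frechet_derivative F (at y) v" "\<lambda>_. 0"]
    by (simp add: frechet_derivative_const)
  have "dF u vs = 0" for vs using D0[OF u] by (simp add: dF_def form_d_fun_covector)
  then show "\<tau>\<^sub>1 u vs = 0" "\<tau>\<^sub>2 u vs = 0" using torsion_classes[OF u, of vs] by simp_all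
  define x y z where "x = 12 * (\<gamma> + 1) * covector_inner (gm u) 1 (dF u) (dF u)"
    and "y = covector_inner (gm u) 3 (\<tau>\<^sub>3 u) (\<tau>\<^sub>3 u)"
    and "z = 12 * (\<sigma> - 7 * (21 * C - 2) / 144) * (T\<^sub>0 u)\<^sup>2"
  have "x \<le> 0" "z \<le> 0" "y \<ge> 0"
    using \<gamma> \<sigma> inner_nonneg[OF u] by (simp_all add: x_def y_def z_def mult_nonpos_nonneg)
  moreover have "x - 4 * y + z = 0"
    using laplace_equation[OF u E] by (simp add: D0[OF u] D2 x_def y_def z_def)
  ultimately have "z = 0" "y = 0" by linarith+
  \<comment> \<open>The strict bound on \<sigma> makes the coefficient of the square
    nonzero.\<close>
  then show "T\<^sub>0 u = 0" using \<sigma> by (simp add: z_def)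
  show "\<tau>\<^sub>3 u vs = 0" using f.inner_eq_0[OF covector_\<tau>\<^sub>3[OF u]] \<open>y = 0\<close> by (simp add: y_def)
qed

end

end

section \<open>From charts to the whole manifold\<close>

theorem proposition3p13:
  fixes A :: "('m::{t2_space, second_countable_topology}) chart set"
    and \<phi> :: "'m form" and f :: "'m \<Rightarrow> real"
    and \<tau>\<^sub>0 :: "'m \<Rightarrow> real" and \<tau>\<^sub>1 \<tau>\<^sub>2 \<tau>\<^sub>3 :: "'m form"
    and C \<gamma> \<sigma> :: real
  assumes "compact (UNIV :: 'm set)" and "connected (UNIV :: 'm set)"
    and "oriented_atlas A" and "spin_manifold A"
    and "g2_structure A \<phi>" and "smooth_fun A f"
    and "torsion_forms A \<phi> \<tau>\<^sub>0 \<tau>\<^sub>1 \<tau>\<^sub>2 \<tau>\<^sub>3"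
    and "vanishes A (ext_d (fun_mult (\<lambda>p. exp (- 4 * f p)) (psi \<phi>)))"
    and "\<forall>c\<in>A. \<forall>u\<in>chart_img c. \<forall>vs.
           - ext_d (H_form \<phi> \<tau>\<^sub>0 \<tau>\<^sub>1 \<tau>\<^sub>3) c u vs + 7/4 * C * ext_d (fun_mult \<tau>\<^sub>0 \<phi>) c u vs = 0"
    and "\<forall>c\<in>A. \<forall>u\<in>chart_img c.
           laplacian \<phi> f c u - \<gamma> * norm2 \<phi> 1 (ext_d (fun_form f)) c u
             + 1/4 * norm2 \<phi> 3 \<tau>\<^sub>3 c u - \<sigma> * (\<tau>\<^sub>0 (chart_inv c u))\<^sup>2 = 0"
    and "\<gamma> < -1" and "\<sigma> < 7 * (21 * C - 2) / 144"
  shows "((\<forall>p. \<tau>\<^sub>0 p = 0) \<and> vanishes A \<tau>\<^sub>1 \<and> vanishes A \<tau>\<^sub>2 \<and> vanishes A \<tau>\<^sub>3)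
           \<and> (\<exists>k. \<forall>p. f p = k)"
proof -
  have chart: "is_chart c" if "c \<in> A" for c
    using assms(3) that by (auto simp: oriented_atlas_def smooth_atlas_def)
  have cover: "(\<Union>c\<in>A. chart_dom c) = UNIV"
    using assms(3) by (simp add: oriented_atlas_def smooth_atlas_def)
  have inv: "chart_inv c (chart_map c p) = p" "chart_map c p \<in> chart_img c" if "c \<in> A" "p \<in> chart_dom c" for c p
    using chart[OF that(1)] that(2) by (auto simp: is_chart_def homeomorphism_def chart_img_def)
  have chart_data: "g2_fixed_point (chart_img c) (\<phi> c) (f \<circ> chart_inv c) (\<tau>\<^sub>0 \<circ> chart_inv c)
      (\<tau>\<^sub>1 c) (\<tau>\<^sub>3 c) (\<tau>\<^sub>2 c) C \<gamma> \<sigma>"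
    if c: "c \<in> A" for c
  proof -
    let ?S = "chart_img c"
    interpret g2_data ?S "\<phi> c" "f \<circ> chart_inv c" "\<tau>\<^sub>0 \<circ> chart_inv c" "\<tau>\<^sub>1 c" "\<tau>\<^sub>3 c"
    proof
      show "open ?S" using chart[OF c] by (simp add: is_chart_def)
      show "is_covector 3 (\<phi> c u)" if "u \<in> ?S" for u
        using assms(5) c that by (simp add: g2_structure_def is_form_def)
      show "C1 ?S (\<lambda>u. \<phi> c u vs)" for vs
        using assms(5) c by (intro smooth_on_C1) (simp add: g2_structure_def is_form_def)
      show "\<exists>L. linear L \<and> bij L \<and> (\<forall>vs. \<phi> c u vs = phi0 (map L vs))" if "u \<in> ?S" for u
        using assms(5) c that by (simp add: g2_structure_def)
    qed
    have tf: "smooth_fun A \<tau>\<^sub>0" "is_form A 1 \<tau>\<^sub>1" "is_form A 2 \<tau>\<^sub>2" "is_form A 3 \<tau>\<^sub>3"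
      using assms(7) by (simp_all add: torsion_forms_def)
    have psi_c: "psi \<phi> c = \<psi>"
      by (rule ext) (simp add: psi_def star_def \<psi>_def)
    have fm: "fun_form f c = (\<lambda>u. fun_covector ((f \<circ> chart_inv c) u))"
      by (intro ext) (simp add: fun_form_def fun_covector_def)
    have fmul: "fun_mult h \<omega> c = (\<lambda>u vs. (h \<circ> chart_inv c) u * \<omega> c u vs)" for h \<omega>
      by (intro ext) (simp add: fun_mult_def)
    show ?thesis
    proof (unfold_locales, goal_cases)
      case 1 show ?case using assms(6) c by (intro smooth_on_C1) (simp add: smooth_fun_def)
    next
      case (2 v) show ?case using assms(6) c by (intro smooth_on_derivative_C1) (simp add: smooth_fun_def)
    next
      case 3 show ?case using tf(1) c by (intro smooth_on_C1) (simp add: smooth_fun_def)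
    next
      case (4 u) then show ?case using tf(2) c by (simp add: is_form_def)
    next
      case (5 vs) show ?case using tf(2) c by (intro smooth_on_C1) (simp add: is_form_def)
    next
      case (6 u) then show ?case using tf(3) c by (simp add: is_form_def)
    next
      case (7 u) then show ?case using tf(4) c by (simp add: is_form_def)
    next
      case (8 vs) show ?case using tf(4) c by (intro smooth_on_C1) (simp add: is_form_def)
    next
      case (9 u vs)
      have "wedge_form \<tau>\<^sub>2 (psi \<phi>) c u vs = 0"
        using assms(7) c 9 unfolding torsion_forms_def vanishes_def by blast
      then show ?case by (simp add: wedge_form_def psi_c)
    next
      case (10 u vs) then show ?case
        using assms(7) c by (simp add: torsion_forms_def vanishes_def wedge_form_def)
    next
      case (11 u vs)
      have "wedge_form \<tau>\<^sub>3 (psi \<phi>) c u vs = 0"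
        using assms(7) c 11 unfolding torsion_forms_def vanishes_def by blast
      then show ?case by (simp add: wedge_form_def psi_c)
    next
      case (12 u vs)
      have "ext_d \<phi> c u vs = fun_mult \<tau>\<^sub>0 (psi \<phi>) c u vs + 3 * wedge_form \<tau>\<^sub>1 \<phi> c u vs + star \<phi> 3 \<tau>\<^sub>3 c u vs"
        using assms(7) c 12 unfolding torsion_forms_def by blast
      then show ?case by (simp add: ext_d_form_d fmul wedge_form_def psi_c star_def)
    next
      case (13 u vs)
      have "ext_d (psi \<phi>) c u vs = 4 * wedge_form \<tau>\<^sub>1 (psi \<phi>) c u vs + wedge_form \<tau>\<^sub>2 \<phi> c u vs"
        using assms(7) c 13 unfolding torsion_forms_def by blast
      then show ?case by (simp add: ext_d_form_d wedge_form_def psi_c)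
    next
      case (14 u vs)
      have "ext_d (fun_mult (\<lambda>p. exp (- 4 * f p)) (psi \<phi>)) c u vs = 0"
        using assms(8) c 14 unfolding vanishes_def by blast
      then show ?case by (simp add: ext_d_form_d fmul psi_c)
    next
      case (15 u vs)
      have "H_form \<phi> \<tau>\<^sub>0 \<tau>\<^sub>1 \<tau>\<^sub>3 c = H"
        by (intro ext) (simp add: H_form_def fmul contract_form_def psi_c H_def)
      moreover have "- ext_d (H_form \<phi> \<tau>\<^sub>0 \<tau>\<^sub>1 \<tau>\<^sub>3) c u vs + 7/4 * C * ext_d (fun_mult \<tau>\<^sub>0 \<phi>) c u vs = 0"
        using assms(9) c 15 by blast
      ultimately show ?case by (simp only: ext_d_form_d fmul)
    next
      case (16 u)
      have dF: "form_d (\<lambda>u. fun_covector ((f \<circ> chart_inv c) u)) = dF" by (simp add: dF_def)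
      have s: "star \<phi> 1 (ext_d (fun_form f)) c = star_dF"
        by (rule ext) (simp only: star_def ext_d_form_d fm dF star_dF_def)
      have "laplacian \<phi> f c u - \<gamma> * norm2 \<phi> 1 (ext_d (fun_form f)) c u
             + 1/4 * norm2 \<phi> 3 \<tau>\<^sub>3 c u - \<sigma> * (\<tau>\<^sub>0 (chart_inv c u))\<^sup>2 = 0"
        using assms(10) c 16 by blast
      \<comment> \<open>The two minus signs, from \<open>laplacian\<close> and from
        \<open>codiff\<close> in degree 1, cancel; the outer star acts in degree
        \<open>8 - 1 = 7\<close>.\<close>
      moreover have "laplacian \<phi> f c u = hodge (gm u) (vl u) 7 (form_d (star \<phi> 1 (ext_d (fun_form f)) c) u) []"
        by (simp add: laplacian_def codiff_def star_def[of _ "8 - _"] star_def[of _ 7] ext_d_form_d)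
      ultimately show ?case
        by (simp only: s norm2_def ext_d_form_d fm dF) simp
    qed
  qed
  have "continuous_on (\<Union>c\<in>A. chart_dom c) f"
  proof (rule continuous_on_open_UN)
    fix c assume c: "c \<in> A"
    interpret g2_fixed_point "chart_img c" "\<phi> c" "f \<circ> chart_inv c" "\<tau>\<^sub>0 \<circ> chart_inv c" "\<tau>\<^sub>1 c" "\<tau>\<^sub>3 c" "\<tau>\<^sub>2 c" C \<gamma> \<sigma>
      by (rule chart_data[OF c])
    show "open (chart_dom c)" using chart[OF c] by (simp add: is_chart_def)
    have h: "continuous_on (chart_dom c) (chart_map c)" "chart_map c ` chart_dom c = chart_img c"
      using chart[OF c] by (auto simp: is_chart_def homeomorphism_def)
    have "continuous_on (chart_dom c) ((f \<circ> chart_inv c) \<circ> chart_map c)"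
      by (rule continuous_on_compose[OF h(1)]) (simp only: h(2) C1_continuous[OF C1_F])
    then show "continuous_on (chart_dom c) f"
      by (rule continuous_on_cong[THEN iffD1, rotated -1]) (simp_all add: inv[OF c])
  qed
  then have cont: "continuous_on UNIV f" by (simp only: cover)
  then obtain p0 where p0: "\<And>p. f p0 \<le> f p"
    using continuous_attains_inf[OF assms(1) UNIV_not_empty] by blast
  \<comment> \<open>The set of minimum points is closed by continuity and open by the local minimum
    principle; connectedness then makes it everything.\<close>
  define Z where "Z = {p. f p = f p0}"
  have "closed Z"
    unfolding Z_def using continuous_closed_vimage[of "{f p0}" f] cont
    by (simp add: continuous_on_eq_continuous_at vimage_def)
  moreover have "open Z"
  proof (subst openin_subopen[of euclidean, simplified open_openin[symmetric]], intro ballI)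
    fix p assume p: "p \<in> Z"
    obtain c where c: "c \<in> A" "p \<in> chart_dom c" using cover by blast
    interpret g2_fixed_point "chart_img c" "\<phi> c" "f \<circ> chart_inv c" "\<tau>\<^sub>0 \<circ> chart_inv c" "\<tau>\<^sub>1 c" "\<tau>\<^sub>3 c" "\<tau>\<^sub>2 c" C \<gamma> \<sigma>
      by (rule chart_data[OF c(1)])
    let ?u = "chart_map c p"
    obtain e where e: "e > 0" "cball ?u e \<subseteq> chart_img c"
      using open_S inv(2)[OF c] open_contains_cball by blast
    \<comment> \<open>The radius is halved because the local principle needs a ball of twice the
      radius inside the domain.\<close>
    let ?W = "chart_dom c \<inter> chart_map c -` ball ?u (e / 2)"
    have "open ?W"
      using chart[OF c(1)] by (intro continuous_open_preimage) (auto simp: is_chart_def homeomorphism_def)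
    moreover have "p \<in> ?W" using c(2) e(1) by simp
    moreover have "?W \<subseteq> Z"
    proof
      fix q assume q: "q \<in> ?W"
      have "(f \<circ> chart_inv c) (chart_map c q) = f p0"
        by (rule minimum_locally_constant[OF assms(11,12), of _ ?u "e / 2"])
          (use p p0 e q inv[OF c] in \<open>auto simp: Z_def\<close>)
      then show "q \<in> Z" using q inv(1)[OF c(1), of q] by (simp add: Z_def)
    qed
    ultimately show "\<exists>T. open T \<and> p \<in> T \<and> T \<subseteq> Z" by blast
  qed
  moreover have "p0 \<in> Z" by (simp add: Z_def)
  ultimately have "Z = UNIV"
    using assms(2) unfolding connected_clopen by (auto simp flip: open_openin closed_closedin)
  then have const: "f p = f p0" for p by (auto simp: Z_def)
  have zero: "\<tau>\<^sub>0 (chart_inv c u) = 0 \<and> \<tau>\<^sub>1 c u vs = 0 \<and> \<tau>\<^sub>2 c u vs = 0 \<and> \<tau>\<^sub>3 c u vs = 0"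
    if "c \<in> A" "u \<in> chart_img c" for c u vs
  proof -
    interpret g2_fixed_point "chart_img c" "\<phi> c" "f \<circ> chart_inv c" "\<tau>\<^sub>0 \<circ> chart_inv c" "\<tau>\<^sub>1 c" "\<tau>\<^sub>3 c" "\<tau>\<^sub>2 c" C \<gamma> \<sigma>
      by (rule chart_data[OF that(1)])
    have "(f \<circ> chart_inv c) x = f p0" for x using const by simp
    from constant_imp_torsion_free[OF assms(11,12) this that(2)] show ?thesis by simp
  qed
  have "\<tau>\<^sub>0 p = 0" for p
  proof -
    obtain c where c: "c \<in> A" "p \<in> chart_dom c" using cover by blast
    then show ?thesis using zero[OF c(1) inv(2)[OF c]] inv(1)[OF c] by simp
  qed
  moreover have "vanishes A \<tau>\<^sub>1" "vanishes A \<tau>\<^sub>2" "vanishes A \<tau>\<^sub>3"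
    using zero by (auto simp: vanishes_def)
  ultimately show ?thesis using const by blast
qed

end
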